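(* Let $k$ be any field, let $S=k[\![x_1,x_2,x_3,x_4,x_5]\!]$, and let $R=S[\![t]\!]/I$, where $I$ is the ideal of $S[\![t]\!]$ generated by $$(1+t)x_1x_3+x_2x_3,\quad x_1x_4+x_2x_4,\quad x_3^2+(1+t)x_1x_5-x_2x_5,\quad x_4^2+x_1x_5-x_2x_5,$$ $$x_1^2,\quad x_2^2,\quad x_3x_4,\quad x_3x_5,\quad x_4x_5,\quad x_5^2.$$ Consider the prime ideal $\mathfrak{p}=(x_1,x_2,x_3,x_4,x_5)$ of $R$. Then the localization $R_{\mathfrak{p}}$ is not an AB ring.
   Context: $S[\![t]\!]=k[\![x_1,x_2,x_3,x_4,x_5,t]\!]$ is the formal power series ring in six variables over $k$. The ring $R$ is a complete noetherian local ring. Elements of $S[\![t]\!]$ and their images in $R$ are denoted by the same symbols. For a commutative noetherian local ring $A$, define $$\operatorname{Ext-index}(A):=\sup\{n \mid \operatorname{Ext}^{i}_A(M,N)=0 \text{ for all } i>n \text{ and } \operatorname{Ext}^n_A(M,N)\neq 0\},$$ where the supremum is taken over all pairs of finitely generated $A$-modules $M$ and $N$ with $\operatorname{Ext}^{i}_A(M,N)=0$ for all $i\gg 0$. The ring $A$ satisfies the uniform Auslander condition if $\operatorname{Ext-index}(A)<\infty$. A commutative noetherian local ring is called an AB ring if it is Gorenstein and satisfies the uniform Auslander condition. *)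

theory Defs
  imports
    "HOL-Algebra.Algebra"
    "HOL-Algebra.Algebraic_Closure_Type"
    "HOL-Library.Poly_Mapping"
    "HOL-Library.Extended_Nat"
begin

section \<open>Power series in several variables\<close>

text \<open>
  An element of \<open>('v, 'k) mps\<close> is a power series in the variables \<open>'v\<close>, given by its
  coefficients; the monomial \<open>\<Prod>v. v ^ e v\<close> is encoded by its exponent vector \<open>e\<close>.
\<close>

typedef ('v, 'k) mps = "UNIV :: (('v \<Rightarrow>\<^sub>0 nat) \<Rightarrow> 'k) set"
  morphisms mps_coeff Abs_mps ..

lemmas mps_coeff_Abs [simp] = Abs_mps_inverse [OF UNIV_I]

lemma mps_eqI: "(\<And>e. mps_coeff f e = mps_coeff g e) \<Longrightarrow> f = g"
  by (metis ext mps_coeff_inject)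

lemma finite_exponent_splittings: "finite {(a, b). a + b = (e :: 'v \<Rightarrow>\<^sub>0 nat)}"
proof -
  define K where "K = Poly_Mapping.keys e"
  define m where "m = Max (Poly_Mapping.lookup e ` K)"
  define F where "F = {g. \<forall>v. (v \<in> K \<longrightarrow> g v \<in> {..m}) \<and> (v \<notin> K \<longrightarrow> g v = (0::nat))}"
  have fin: "finite F"
    unfolding F_def K_def by (rule finite_set_of_finite_funs) simp_all
  have "Poly_Mapping.lookup a \<in> F" if "a + b = e" for a b
  proof -
    have le: "Poly_Mapping.lookup a v \<le> Poly_Mapping.lookup e v" for v
      using lookup_add [of a b v] that by simp
    have "Poly_Mapping.lookup a v \<le> m" if "v \<in> K" for v
    proof -
      have "Poly_Mapping.lookup e v \<le> m"
        unfolding m_def using that by (intro Max_ge) (simp_all add: K_def)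
      thus ?thesis using le [of v] by simp
    qed
    moreover have "Poly_Mapping.lookup a v = 0" if "v \<notin> K" for v
      using le [of v] that by (simp add: K_def in_keys_iff)
    ultimately show ?thesis by (simp add: F_def)
  qed
  hence "(\<lambda>y. Poly_Mapping.lookup (fst y)) ` {(a, b). a + b = e} \<subseteq> F" by auto
  hence "finite ((\<lambda>y. Poly_Mapping.lookup (fst y)) ` {(a, b). a + b = e})"
    using fin by (rule finite_subset)
  thus ?thesis
  proof (rule finite_imageD)
    show "inj_on (\<lambda>y. Poly_Mapping.lookup (fst y)) {(a, b). a + b = e}"
    proof (rule inj_onI)
      fix y z assume y: "y \<in> {(a, b). a + b = e}" and z: "z \<in> {(a, b). a + b = e}"
        and "Poly_Mapping.lookup (fst y) = Poly_Mapping.lookup (fst z)"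
      hence fst: "fst y = fst z" by (simp add: poly_mapping.lookup_inject)
      have "fst y + snd y = fst y + snd z" using y z fst by (simp add: case_prod_unfold)
      hence "snd y = snd z" by (rule add_left_imp_eq)
      thus "y = z" using fst by (simp add: prod_eq_iff)
    qed
  qed
qed

lemma sum_splittings_single:
  fixes u w e :: "'v \<Rightarrow>\<^sub>0 nat" and h :: "_ \<Rightarrow> 'a::comm_monoid_add"
  assumes "u + w = e"
  shows "(\<Sum>(a, b) | a + b = e. if a = u then h b else 0) = h w"
proof -
  have "(\<Sum>(a, b) | a + b = e. if a = u then h b else 0) = (\<Sum>(a, b) \<in> {(u, w)}. if a = u then h b else 0)"
  proof (rule sum.mono_neutral_right [OF finite_exponent_splittings])
    show "\<forall>y\<in>{(a, b). a + b = e} - {(u, w)}. (case y of (a, b) \<Rightarrow> if a = u then h b else 0) = 0"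
    proof
      fix y assume y: "y \<in> {(a, b). a + b = e} - {(u, w)}"
      obtain a b where ab: "y = (a, b)" by (cases y)
      have "a \<noteq> u"
      proof
        assume "a = u"
        hence "u + b = u + w" using y assms by (simp add: ab)
        hence "b = w" by (rule add_left_imp_eq)
        thus False using y \<open>a = u\<close> by (simp add: ab)
      qed
      thus "(case y of (a, b) \<Rightarrow> if a = u then h b else 0) = 0" by (simp add: ab)
    qed
  qed (use assms in auto)
  thus ?thesis by simp
qed

instantiation mps :: (type, comm_ring_1) comm_ring_1
begin

definition "0 = Abs_mps (\<lambda>_. 0)"
definition "1 = Abs_mps (\<lambda>e. if e = 0 then 1 else 0)"
definition "f + g = Abs_mps (\<lambda>e. mps_coeff f e + mps_coeff g e)"
definition "f - g = Abs_mps (\<lambda>e. mps_coeff f e - mps_coeff g e)"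
definition "- f = Abs_mps (\<lambda>e. - mps_coeff f e)"
definition "f * g = Abs_mps (\<lambda>e. \<Sum>(a, b) | a + b = e. mps_coeff f a * mps_coeff g b)"

instance
proof
  fix f g h :: "('a, 'b) mps"
  show "f * g * h = f * (g * h)"
  proof (rule mps_eqI)
    fix e
    have "mps_coeff (f * g * h) e =
        (\<Sum>(s, c) | s + c = e. \<Sum>(a, b) | a + b = s. mps_coeff f a * mps_coeff g b * mps_coeff h c)"
      by (simp add: times_mps_def sum_distrib_right case_prod_unfold)
    also have "\<dots> = (\<Sum>((s, c), (a, b)) \<in> (SIGMA x : {(s, c). s + c = e}. {(a, b). a + b = fst x}).
        mps_coeff f a * mps_coeff g b * mps_coeff h c)"
      by (subst sum.Sigma [symmetric])
         (auto simp: finite_exponent_splittings [unfolded case_prod_unfold] case_prod_unfold)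
    also have "\<dots> = (\<Sum>((a, s), (b, c)) \<in> (SIGMA x : {(a, s). a + s = e}. {(b, c). b + c = snd x}).
        mps_coeff f a * (mps_coeff g b * mps_coeff h c))"
      by (rule sum.reindex_bij_witness
          [where i = "\<lambda>((a, s), (b, c)). ((a + b, c), (a, b))"
             and j = "\<lambda>((s, c), (a, b)). ((a, b + c), (b, c))"])
         (auto simp: ac_simps)
    also have "\<dots> = (\<Sum>(a, s) | a + s = e. \<Sum>(b, c) | b + c = s. mps_coeff f a * (mps_coeff g b * mps_coeff h c))"
      by (subst sum.Sigma [symmetric])
         (auto simp: finite_exponent_splittings [unfolded case_prod_unfold] case_prod_unfold)
    also have "\<dots> = mps_coeff (f * (g * h)) e"
      by (simp add: times_mps_def sum_distrib_left case_prod_unfold)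
    finally show "mps_coeff (f * g * h) e = mps_coeff (f * (g * h)) e" .
  qed
  show "f * g = g * f"
  proof (rule mps_eqI)
    fix e
    show "mps_coeff (f * g) e = mps_coeff (g * f) e"
      unfolding times_mps_def mps_coeff_Abs
      by (rule sum.reindex_bij_witness [where i = prod.swap and j = prod.swap]) (auto simp: ac_simps)
  qed
  show "1 * f = f"
  proof (rule mps_eqI)
    fix e
    have "mps_coeff (1 * f) e = (\<Sum>(a, b) | a + b = e. if a = 0 then mps_coeff f b else 0)"
      unfolding times_mps_def one_mps_def mps_coeff_Abs by (intro sum.cong) auto
    also have "\<dots> = mps_coeff f e" by (rule sum_splittings_single) simp
    finally show "mps_coeff (1 * f) e = mps_coeff f e" .
  qed
  show "(f + g) * h = f * h + g * h"
    by (rule mps_eqI)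
       (simp add: times_mps_def plus_mps_def distrib_right case_prod_unfold sum.distrib)
  show "(0 :: ('a, 'b) mps) \<noteq> 1"
  proof
    assume "(0 :: ('a, 'b) mps) = 1"
    hence "mps_coeff (0 :: ('a, 'b) mps) 0 = mps_coeff 1 0" by simp
    thus False by (simp add: zero_mps_def one_mps_def)
  qed
  show "f + g + h = f + (g + h)" by (rule mps_eqI) (simp add: plus_mps_def add.assoc)
  show "f + g = g + f" by (rule mps_eqI) (simp add: plus_mps_def add.commute)
  show "0 + f = f" by (rule mps_eqI) (simp add: plus_mps_def zero_mps_def)
  show "- f + f = 0" by (rule mps_eqI) (simp add: plus_mps_def uminus_mps_def zero_mps_def)
  show "f - g = f + - g" by (rule mps_eqI) (simp add: plus_mps_def uminus_mps_def minus_mps_def)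
qed

end

definition mps_var :: "'v \<Rightarrow> ('v, 'k :: comm_ring_1) mps" where
  "mps_var v = Abs_mps (\<lambda>e. if e = Poly_Mapping.single v 1 then 1 else 0)"


section \<open>Modules over a commutative ring\<close>

text \<open>
  The fields \<open>mult\<close> and \<open>one\<close> of a module record play no role in the locale \<open>module\<close>;
  they are left undefined below.
\<close>

definition regular_module :: "'a ring \<Rightarrow> ('a, 'a) module" where
  "regular_module A = \<lparr>carrier = carrier A, monoid.mult = undefined, one = undefined,
     ring.zero = \<zero>\<^bsub>A\<^esub>, add = (\<oplus>\<^bsub>A\<^esub>), module.smult = (\<otimes>\<^bsub>A\<^esub>)\<rparr>"

definition free_module :: "'a ring \<Rightarrow> nat \<Rightarrow> ('a, nat \<Rightarrow> 'a) module" where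
  "free_module A n = \<lparr>carrier = {..<n} \<rightarrow>\<^sub>E carrier A, monoid.mult = undefined, one = undefined,
     ring.zero = (\<lambda>i\<in>{..<n}. \<zero>\<^bsub>A\<^esub>),
     add = (\<lambda>v w. \<lambda>i\<in>{..<n}. v i \<oplus>\<^bsub>A\<^esub> w i),
     module.smult = (\<lambda>a v. \<lambda>i\<in>{..<n}. a \<otimes>\<^bsub>A\<^esub> v i)\<rparr>"

definition module_homs :: "'a ring \<Rightarrow> ('a, 'm) module \<Rightarrow> ('a, 'n) module \<Rightarrow> ('m \<Rightarrow> 'n) set" where
  "module_homs A M N = {f \<in> carrier M \<rightarrow> carrier N.
     (\<forall>x\<in>carrier M. \<forall>y\<in>carrier M. f (x \<oplus>\<^bsub>M\<^esub> y) = f x \<oplus>\<^bsub>N\<^esub> f y) \<and>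
     (\<forall>a\<in>carrier A. \<forall>x\<in>carrier M. f (a \<odot>\<^bsub>M\<^esub> x) = a \<odot>\<^bsub>N\<^esub> f x)}"

text \<open>The homomorphisms are taken extensional, so that equality in \<open>Hom\<close> is equality on \<open>M\<close>.\<close>

definition hom_module :: "'a ring \<Rightarrow> ('a, 'm) module \<Rightarrow> ('a, 'n) module \<Rightarrow> ('a, 'm \<Rightarrow> 'n) module" where
  "hom_module A M N = \<lparr>carrier = module_homs A M N \<inter> extensional (carrier M),
     monoid.mult = undefined, one = undefined,
     ring.zero = (\<lambda>x\<in>carrier M. \<zero>\<^bsub>N\<^esub>),
     add = (\<lambda>f g. \<lambda>x\<in>carrier M. f x \<oplus>\<^bsub>N\<^esub> g x),
     module.smult = (\<lambda>a f. \<lambda>x\<in>carrier M. a \<odot>\<^bsub>N\<^esub> f x)\<rparr>"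

definition quotient_module :: "('a, 'm) module \<Rightarrow> 'm set \<Rightarrow> ('a, 'm set) module" where
  "quotient_module M H = \<lparr>carrier = a_rcosets\<^bsub>M\<^esub> H, monoid.mult = undefined, one = undefined,
     ring.zero = H,
     add = set_add M,
     module.smult = (\<lambda>a U. \<Union>x\<in>U. H +>\<^bsub>M\<^esub> (a \<odot>\<^bsub>M\<^esub> x))\<rparr>"

definition is_zero_module :: "('a, 'm) module \<Rightarrow> bool" where
  "is_zero_module M \<longleftrightarrow> carrier M = {\<zero>\<^bsub>M\<^esub>}"

definition fg_module :: "'a ring \<Rightarrow> ('a, 'm) module \<Rightarrow> bool" where
  "fg_module A M \<longleftrightarrow> module A M \<and>
     (\<exists>B. finite B \<and> B \<subseteq> carrier M \<and>
       (\<forall>x\<in>carrier M. \<exists>c\<in>B \<rightarrow> carrier A. x = (\<Oplus>\<^bsub>M\<^esub>b\<in>B. c b \<odot>\<^bsub>M\<^esub> b)))"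

text \<open>
  HOL cannot quantify over carrier types inside a formula, so "all modules" has to mean all
  modules with elements in one fixed type.  Every finitely generated \<open>A\<close>-module is isomorphic to
  a quotient of some \<open>A\<^sup>n\<close>, whose elements are sets of functions \<open>nat \<Rightarrow> 'a\<close>; hence \<open>'a univ_module\<close>
  contains all of them up to isomorphism.  It also contains every module of cardinality at most
  \<open>max |A| \<aleph>\<^sub>0\<close>, and so, for noetherian \<open>A\<close>, the terms of the minimal injective resolution of any
  finitely generated module.
\<close>

type_synonym 'a univ_module = "('a, (nat \<Rightarrow> 'a) set) module"


section \<open>Ext\<close>

text \<open>
  \<open>\<dots> \<rightarrow> A\<^bsup>r 2\<^esup> \<rightarrow> A\<^bsup>r 1\<^esup> \<rightarrow> A\<^bsup>r 0\<^esup> \<rightarrow> M \<rightarrow> 0\<close> with differentials \<open>d i : A\<^bsup>r (i + 1)\<^esup> \<rightarrow> A\<^bsup>r i\<^esup>\<close>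
  and augmentation \<open>\<epsilon>\<close>.
\<close>

definition free_resolution ::
  "'a ring \<Rightarrow> ('a, 'm) module \<Rightarrow> (nat \<Rightarrow> nat) \<Rightarrow> (nat \<Rightarrow> (nat \<Rightarrow> 'a) \<Rightarrow> (nat \<Rightarrow> 'a)) \<Rightarrow>
   ((nat \<Rightarrow> 'a) \<Rightarrow> 'm) \<Rightarrow> bool" where
  "free_resolution A M r d \<epsilon> \<longleftrightarrow>
     (let F = (\<lambda>i. free_module A (r i)) in
       \<epsilon> \<in> module_homs A (F 0) M \<and>
       (\<forall>i. d i \<in> module_homs A (F (Suc i)) (F i)) \<and>
       \<epsilon> ` carrier (F 0) = carrier M \<and>
       d 0 ` carrier (F 1) = a_kernel (F 0) M \<epsilon> \<and>
       (\<forall>i. d (Suc i) ` carrier (F (Suc (Suc i))) = a_kernel (F (Suc i)) (F i) (d i)))"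

definition ext_cocycles ::
  "'a ring \<Rightarrow> ('a, 'n) module \<Rightarrow> (nat \<Rightarrow> nat) \<Rightarrow> (nat \<Rightarrow> (nat \<Rightarrow> 'a) \<Rightarrow> (nat \<Rightarrow> 'a)) \<Rightarrow> nat \<Rightarrow>
   ((nat \<Rightarrow> 'a) \<Rightarrow> 'n) set" where
  "ext_cocycles A N r d i =
     {f \<in> carrier (hom_module A (free_module A (r i)) N).
        \<forall>v\<in>carrier (free_module A (r (Suc i))). f (d i v) = \<zero>\<^bsub>N\<^esub>}"

fun ext_coboundaries ::
  "'a ring \<Rightarrow> ('a, 'n) module \<Rightarrow> (nat \<Rightarrow> nat) \<Rightarrow> (nat \<Rightarrow> (nat \<Rightarrow> 'a) \<Rightarrow> (nat \<Rightarrow> 'a)) \<Rightarrow> nat \<Rightarrow>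
   ((nat \<Rightarrow> 'a) \<Rightarrow> 'n) set" where
  "ext_coboundaries A N r d 0 = {\<zero>\<^bsub>hom_module A (free_module A (r 0)) N\<^esub>}"
| "ext_coboundaries A N r d (Suc i) =
     (\<lambda>f. compose (carrier (free_module A (r (Suc i)))) f (d i)) `
       carrier (hom_module A (free_module A (r i)) N)"

text \<open>
  \<open>Ext i A M N\<close> is the \<open>i\<close>-th cohomology of \<open>Hom(F, N)\<close> for some resolution \<open>F\<close> of \<open>M\<close> by
  finitely generated free modules; it is independent of \<open>F\<close> up to isomorphism.  Such an \<open>F\<close>
  exists whenever \<open>A\<close> is noetherian and \<open>M\<close> is finitely generated, the only case used below.
\<close>

definition Ext :: "nat \<Rightarrow> 'a ring \<Rightarrow> ('a, 'm) module \<Rightarrow> ('a, 'n) module \<Rightarrow>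
    ('a, ((nat \<Rightarrow> 'a) \<Rightarrow> 'n) set) module" where
  "Ext i A M N =
     (let (r, d) = (SOME (r, d). \<exists>\<epsilon>. free_resolution A M r d \<epsilon>) in
       quotient_module
         ((hom_module A (free_module A (r i)) N)\<lparr>carrier := ext_cocycles A N r d i\<rparr>)
         (ext_coboundaries A N r d i))"

definition ext_index :: "'a ring \<Rightarrow> enat" where
  "ext_index A = Sup {enat n | n. \<exists>(M :: 'a univ_module) (N :: 'a univ_module).
     fg_module A M \<and> fg_module A N \<and>
     (\<forall>i>n. is_zero_module (Ext i A M N)) \<and> \<not> is_zero_module (Ext n A M N)}"

definition uniform_auslander :: "'a ring \<Rightarrow> bool" where
  "uniform_auslander A \<longleftrightarrow> ext_index A < \<infinity>"


section \<open>Gorenstein rings and AB rings\<close>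

text \<open>
  The test modules \<open>U\<close>, \<open>V\<close> include copies of \<open>A\<close> and of its ideals, so by Baer's criterion
  restricting them to \<open>'a univ_module\<close> loses nothing.
\<close>

definition injective_module :: "'a ring \<Rightarrow> ('a, 'e) module \<Rightarrow> bool" where
  "injective_module A E \<longleftrightarrow> module A E \<and>
     (\<forall>(U :: 'a univ_module) (V :: 'a univ_module). \<forall>g\<in>module_homs A U V. \<forall>f\<in>module_homs A U E.
        module A U \<and> module A V \<and> inj_on g (carrier U) \<longrightarrow>
        (\<exists>h\<in>module_homs A V E. \<forall>x\<in>carrier U. h (g x) = f x))"

definition injective_resolution ::
  "'a ring \<Rightarrow> ('a, 'm) module \<Rightarrow> (nat \<Rightarrow> ('a, 'e) module) \<Rightarrow> (nat \<Rightarrow> 'e \<Rightarrow> 'e) \<Rightarrow> ('m \<Rightarrow> 'e) \<Rightarrow> bool" where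
  "injective_resolution A M E d \<eta> \<longleftrightarrow>
     (\<forall>i. injective_module A (E i)) \<and>
     \<eta> \<in> module_homs A M (E 0) \<and>
     (\<forall>i. d i \<in> module_homs A (E i) (E (Suc i))) \<and>
     inj_on \<eta> (carrier M) \<and>
     \<eta> ` carrier M = a_kernel (E 0) (E 1) (d 0) \<and>
     (\<forall>i. d i ` carrier (E i) = a_kernel (E (Suc i)) (E (Suc (Suc i))) (d (Suc i)))"

definition finite_injective_dimension :: "'a ring \<Rightarrow> ('a, 'm) module \<Rightarrow> bool" where
  "finite_injective_dimension A M \<longleftrightarrow>
     (\<exists>n (E :: nat \<Rightarrow> 'a univ_module) d \<eta>.
        injective_resolution A M E d \<eta> \<and> (\<forall>i>n. is_zero_module (E i)))"

definition noetherian_local_ring :: "'a ring \<Rightarrow> bool" where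
  "noetherian_local_ring A \<longleftrightarrow> cring A \<and> noetherian_ring A \<and> (\<exists>!m. maximalideal m A)"

definition gorenstein_local_ring :: "'a ring \<Rightarrow> bool" where
  "gorenstein_local_ring A \<longleftrightarrow>
     noetherian_local_ring A \<and> finite_injective_dimension A (regular_module A)"

definition AB_ring :: "'a ring \<Rightarrow> bool" where
  "AB_ring A \<longleftrightarrow> gorenstein_local_ring A \<and> uniform_auslander A"


section \<open>Localization\<close>

text \<open>
  \<open>(a, s)\<close> and \<open>(b, t)\<close> represent the same fraction iff \<open>u (t a - s b) = 0\<close> for some \<open>u \<in> S\<close>.
\<close>

definition fraction_rel :: "'a ring \<Rightarrow> 'a set \<Rightarrow> (('a \<times> 'a) \<times> ('a \<times> 'a)) set" where
  "fraction_rel R S = {((a, s), (b, t)). a \<in> carrier R \<and> b \<in> carrier R \<and> s \<in> S \<and> t \<in> S \<and>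
     (\<exists>u\<in>S. u \<otimes>\<^bsub>R\<^esub> (t \<otimes>\<^bsub>R\<^esub> a \<ominus>\<^bsub>R\<^esub> s \<otimes>\<^bsub>R\<^esub> b) = \<zero>\<^bsub>R\<^esub>)}"

definition fraction :: "'a ring \<Rightarrow> 'a set \<Rightarrow> 'a \<Rightarrow> 'a \<Rightarrow> ('a \<times> 'a) set" where
  "fraction R S a s = fraction_rel R S `` {(a, s)}"

definition localization :: "'a ring \<Rightarrow> 'a set \<Rightarrow> ('a \<times> 'a) set ring" where
  "localization R S = \<lparr>carrier = (carrier R \<times> S) // fraction_rel R S,
     monoid.mult = (\<lambda>U V. \<Union>(a, s)\<in>U. \<Union>(b, t)\<in>V. fraction R S (a \<otimes>\<^bsub>R\<^esub> b) (s \<otimes>\<^bsub>R\<^esub> t)),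
     one = fraction R S \<one>\<^bsub>R\<^esub> \<one>\<^bsub>R\<^esub>,
     ring.zero = fraction R S \<zero>\<^bsub>R\<^esub> \<one>\<^bsub>R\<^esub>,
     add = (\<lambda>U V. \<Union>(a, s)\<in>U. \<Union>(b, t)\<in>V.
       fraction R S (t \<otimes>\<^bsub>R\<^esub> a \<oplus>\<^bsub>R\<^esub> s \<otimes>\<^bsub>R\<^esub> b) (s \<otimes>\<^bsub>R\<^esub> t))\<rparr>"

definition localization_at_prime :: "'a ring \<Rightarrow> 'a set \<Rightarrow> ('a \<times> 'a) set ring" where
  "localization_at_prime R p = localization R (carrier R - p)"


section \<open>The ring \<open>R = S[[t]]/I\<close>\<close>

datatype xvar = X1 | X2 | X3 | X4 | X5

text \<open>\<open>S = k[[x\<^sub>1,\<dots>,x\<^sub>5]]\<close>, and \<open>S[[t]]\<close> is the ring of formal power series in one variable over \<open>S\<close>.\<close>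

type_synonym 'k S = "(xvar, 'k) mps"

definition St :: "'k::field S fps ring" where
  "St = ring_of_type_algebra"

definition x_elem :: "xvar \<Rightarrow> 'k::field S fps" where
  "x_elem i = fps_const (mps_var i)"

definition ideal_I :: "'k::field S fps set" where
  "ideal_I =
    (let t = fps_X; x1 = x_elem X1; x2 = x_elem X2; x3 = x_elem X3; x4 = x_elem X4; x5 = x_elem X5 in
      Idl\<^bsub>St\<^esub>
       {(1 + t) * x1 * x3 + x2 * x3,
        x1 * x4 + x2 * x4,
        x3^2 + (1 + t) * x1 * x5 - x2 * x5,
        x4^2 + x1 * x5 - x2 * x5,
        x1^2, x2^2, x3 * x4, x3 * x5, x4 * x5, x5^2})"

definition ring_R :: "'k::field S fps set ring" where
  "ring_R = St Quot ideal_I"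

definition prime_p :: "'k::field S fps set set" where
  "prime_p = Idl\<^bsub>ring_R\<^esub> (range (\<lambda>i. ideal_I +>\<^bsub>St\<^esub> x_elem i))"


subsection \<open>The ideal \<open>(x\<^sub>1, \<dots>, x\<^sub>5)\<close> of \<open>R\<close> is prime\<close>

lemma St_simps [simp]:
  "carrier St = UNIV" "f \<otimes>\<^bsub>St\<^esub> g = f * g" "f \<oplus>\<^bsub>St\<^esub> g = f + g" "\<one>\<^bsub>St\<^esub> = 1" "\<zero>\<^bsub>St\<^esub> = 0"
  by (simp_all add: St_def ring_of_type_algebra_def)

lemma cring_St: "cring St"
  unfolding St_def by (rule cring_from_type_algebra)

definition red_x :: "'k::field S fps \<Rightarrow> 'k fps" where
  "red_x f = Abs_fps (\<lambda>n. mps_coeff (fps_nth f n) 0)"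

lemma mps_coeff_0_mult:
  "mps_coeff (f * g) (0 :: 'v \<Rightarrow>\<^sub>0 nat) = mps_coeff f 0 * mps_coeff g 0"
proof -
  have z: "Poly_Mapping.lookup a v = 0 \<and> Poly_Mapping.lookup b v = 0" if "a + b = 0" for a b :: "'v \<Rightarrow>\<^sub>0 nat" and v
    using that by (metis add_is_0 lookup_add lookup_zero)
  have "{(a, b). a + b = (0 :: 'v \<Rightarrow>\<^sub>0 nat)} = {(0, 0)}"
    by (auto intro!: poly_mapping_eqI dest: z)
  thus ?thesis by (simp add: times_mps_def)
qed

lemma mps_coeff_simps:
  "mps_coeff (f + g) e = mps_coeff f e + mps_coeff g e"
  "mps_coeff (f - g) e = mps_coeff f e - mps_coeff g e"
  "mps_coeff 0 e = 0" "mps_coeff 1 e = (if e = 0 then 1 else 0)"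
  by (simp_all add: plus_mps_def minus_mps_def zero_mps_def one_mps_def)

lemma mps_coeff_sum: "mps_coeff (sum f A) e = (\<Sum>a\<in>A. mps_coeff (f a) e)"
  by (induction A rule: infinite_finite_induct) (simp_all add: mps_coeff_simps)

lemma red_x_add: "red_x (f + g) = red_x f + red_x g"
  and red_x_diff: "red_x (f - g) = red_x f - red_x g"
  and red_x_mult: "red_x (f * g) = red_x f * red_x g"
  and red_x_0: "red_x 0 = 0" and red_x_1: "red_x 1 = 1"
  by (auto simp: red_x_def fps_eq_iff mps_coeff_simps fps_mult_nth mps_coeff_sum mps_coeff_0_mult)

lemma red_x_x_elem: "red_x (x_elem i) = 0"
proof -
  have "Poly_Mapping.single i (1::nat) \<noteq> 0"
    by (metis lookup_single_eq lookup_zero zero_neq_one)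
  thus ?thesis
    by (auto simp: red_x_def x_elem_def mps_var_def fps_eq_iff mps_coeff_simps)
qed

lemma red_x_power: "red_x (f ^ n) = red_x f ^ n"
  by (induction n) (simp_all add: red_x_1 red_x_mult)

lemma ideal_red_x: "ideal {f. red_x f = 0} (St :: 'k::field S fps ring)"
proof (rule idealI)
  show "ring (St :: 'k S fps ring)" using cring_St cring_def by blast
  interpret St: ring "St :: 'k S fps ring" by fact
  have [simp]: "\<ominus>\<^bsub>St\<^esub> f = - f" for f :: "'k S fps"
    by (rule St.minus_equality) auto
  show "subgroup {f. red_x f = 0} (add_monoid (St :: 'k S fps ring))"
    by (rule St.add.subgroupI)
       (use red_x_diff [of "0 :: 'k S fps"] in
         \<open>auto simp: red_x_0 red_x_add intro!: exI [of _ 0] simp flip: a_inv_def\<close>)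
qed (auto simp: red_x_mult)

lemma ideal_I_red_x: "f \<in> ideal_I \<Longrightarrow> red_x f = 0"
proof -
  interpret cring "St :: 'a S fps ring" by (rule cring_St)
  have "ideal_I \<subseteq> {f :: 'a S fps. red_x f = 0}"
    unfolding ideal_I_def Let_def
    by (rule genideal_minimal [OF ideal_red_x])
       (auto simp: red_x_mult red_x_add red_x_diff red_x_x_elem red_x_power)
  thus "f \<in> ideal_I \<Longrightarrow> red_x f = 0" by blast
qed

lemma ideal_ideal_I: "ideal (ideal_I :: 'k::field S fps set) St"
proof -
  interpret cring "St :: 'k S fps ring" by (rule cring_St)
  show ?thesis unfolding ideal_I_def Let_def by (rule genideal_ideal) auto
qed

lemma mps_decompose:
  fixes f :: "'k::field S"
  assumes "mps_coeff f 0 = 0"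
  shows "\<exists>g. f = (\<Sum>i\<in>{X1, X2, X3, X4, X5}. mps_var i * g i)"
proof -
  define c where "c = (\<lambda>e :: xvar \<Rightarrow>\<^sub>0 nat. SOME i. Poly_Mapping.lookup e i \<noteq> 0)"
  have c: "Poly_Mapping.lookup e (c e) \<noteq> 0" if "e \<noteq> 0" for e
  proof -
    have "\<exists>i. Poly_Mapping.lookup e i \<noteq> 0" using that by (metis lookup_zero poly_mapping_eqI)
    thus ?thesis unfolding c_def by (rule someI_ex)
  qed
  define u where "u = (\<lambda>i :: xvar. Poly_Mapping.single i (1::nat))"
  define g where "g = (\<lambda>i. Abs_mps (\<lambda>e. if c (u i + e) = i then mps_coeff f (u i + e) else 0))"
  have split: "u i + (e - u i) = e" if "Poly_Mapping.lookup e i \<noteq> 0" for e i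
    using that by (intro poly_mapping_eqI) (auto simp: lookup_add lookup_minus u_def lookup_single when_def)
  have coeff: "mps_coeff (mps_var i * g i) e = (if e \<noteq> 0 \<and> c e = i then mps_coeff f e else 0)" for i e
  proof -
    have "mps_coeff (mps_var i * g i) e =
        (\<Sum>(a, b) | a + b = e. if a = u i then mps_coeff (g i) b else 0)"
      unfolding times_mps_def mps_var_def mps_coeff_Abs u_def by (intro sum.cong) auto
    also have "\<dots> = (if e \<noteq> 0 \<and> c e = i then mps_coeff f e else 0)"
    proof (cases "Poly_Mapping.lookup e i = 0")
      case True
      have "a \<noteq> u i" if "a + b = e" for a b
        using True that by (auto simp: u_def lookup_add)
      hence "(\<Sum>(a, b) | a + b = e. if a = u i then mps_coeff (g i) b else 0) = 0"
        by (intro sum.neutral) auto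
      thus ?thesis using True c [of e] by auto
    next
      case False
      have "(\<Sum>(a, b) | a + b = e. if a = u i then mps_coeff (g i) b else 0) = mps_coeff (g i) (e - u i)"
        by (rule sum_splittings_single) (rule split [OF False])
      thus ?thesis using False split [OF False] by (auto simp: g_def)
    qed
    finally show ?thesis .
  qed
  have "f = (\<Sum>i\<in>{X1, X2, X3, X4, X5}. mps_var i * g i)"
  proof (rule mps_eqI)
    fix e
    show "mps_coeff f e = mps_coeff (\<Sum>i\<in>{X1, X2, X3, X4, X5}. mps_var i * g i) e"
      using assms by (cases "e = 0"; cases "c e") (simp_all add: mps_coeff_simps coeff)
  qed
  thus ?thesis by (rule exI [where x = g])
qed

lemma red_x_decompose:
  fixes f :: "'k::field S fps"
  assumes "red_x f = 0"
  shows "\<exists>g. f = (\<Sum>i\<in>{X1, X2, X3, X4, X5}. x_elem i * g i)"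
proof -
  have "mps_coeff (fps_nth f n) 0 = 0" for n
    using assms by (simp add: red_x_def fps_eq_iff)
  hence "\<exists>g. fps_nth f n = (\<Sum>i\<in>{X1, X2, X3, X4, X5}. mps_var i * g i)" for n
    by (rule mps_decompose)
  then obtain g where g: "fps_nth f n = (\<Sum>i\<in>{X1, X2, X3, X4, X5}. mps_var i * g n i)" for n
    by metis
  have "f = (\<Sum>i\<in>{X1, X2, X3, X4, X5}. x_elem i * Abs_fps (\<lambda>n. g n i))"
    by (auto simp: fps_eq_iff g x_elem_def)
  thus ?thesis by (rule exI [where x = "\<lambda>i. Abs_fps (\<lambda>n. g n i)"])
qed

lemma primeideal_prime_p: "primeideal (prime_p :: 'k::field S fps set set) ring_R"
proof -
  interpret St: cring "St :: 'k S fps ring" by (rule cring_St)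
  interpret I: ideal "ideal_I :: 'k S fps set" St by (rule ideal_ideal_I)
  let ?R = "ring_R :: 'k S fps set ring"
  interpret R: cring ?R unfolding ring_R_def by (rule I.quotient_is_cring) (rule cring_St)
  define q where "q = (\<lambda>f :: 'k S fps. ideal_I +>\<^bsub>St\<^esub> f)"
  have hom: "q \<in> ring_hom St ?R"
    unfolding q_def ring_R_def by (rule I.rcos_ring_hom)
  have q_in: "q f \<in> carrier ?R" for f
    using ring_hom_closed [OF hom] by simp
  have q_add: "q (f + g) = q f \<oplus>\<^bsub>?R\<^esub> q g" and q_mult: "q (f * g) = q f \<otimes>\<^bsub>?R\<^esub> q g" for f g
    using ring_hom_add [OF hom, of f g] ring_hom_mult [OF hom, of f g] by auto
  have surj: "\<exists>f. U = q f" if "U \<in> carrier ?R" for U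
    using that by (auto simp: ring_R_def FactRing_def A_RCOSETS_def' q_def)
  have red: "red_x f = red_x g" if "q f = q g" for f g
  proof -
    have "f \<in> ideal_I +>\<^bsub>St\<^esub> g"
      using I.a_rcos_self [of f] that by (simp add: q_def)
    then obtain h where "h \<in> ideal_I" "f = h + g" by (auto simp: a_r_coset_def')
    thus ?thesis by (simp add: red_x_add ideal_I_red_x)
  qed
  interpret ring_hom_ring "St :: 'k S fps ring" ?R q
    using hom St.ring_axioms R.ring_axioms by (simp add: ring_hom_ring.intro ring_hom_ring_axioms.intro)
  have gens: "range (\<lambda>i. q (x_elem i)) \<subseteq> carrier ?R" using q_in by auto
  have p_def: "prime_p = Idl\<^bsub>?R\<^esub> (range (\<lambda>i. q (x_elem i)))"
    by (simp add: prime_p_def q_def)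
  interpret p: ideal "prime_p :: 'k S fps set set" ?R
    unfolding p_def by (rule R.genideal_ideal [OF gens])
  have J: "ideal (q ` {f. red_x f = 0}) ?R"
  proof (rule idealI [OF R.ring_axioms])
    show "subgroup (q ` {f. red_x f = 0}) (add_monoid ?R)"
    proof (rule R.add.subgroupI)
      fix a assume "a \<in> q ` {f. red_x f = 0}"
      then obtain f where f: "a = q f" "red_x f = 0" by auto
      have "q (- f) \<oplus>\<^bsub>?R\<^esub> q f = \<zero>\<^bsub>?R\<^esub>"
        using q_add [of "- f" f] ring_hom_zero [OF hom St.ring_axioms R.ring_axioms] by simp
      hence "\<ominus>\<^bsub>?R\<^esub> a = q (- f)"
        using R.minus_equality q_in f by blast
      thus "\<ominus>\<^bsub>?R\<^esub> a \<in> q ` {f. red_x f = 0}"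
        using f red_x_diff [of 0 f] by (auto simp: red_x_0)
    next
      show "q ` {f. red_x f = 0} \<noteq> {}" using red_x_0 by blast
    next
      fix a b assume "a \<in> q ` {f. red_x f = 0}" "b \<in> q ` {f. red_x f = 0}"
      then obtain f g where "a = q f" "b = q g" "red_x f = 0" "red_x g = 0" by auto
      thus "a \<oplus>\<^bsub>?R\<^esub> b \<in> q ` {f. red_x f = 0}"
        by (auto simp: red_x_add simp flip: q_add)
    qed (use q_in in auto)
  next
    fix a y assume "a \<in> q ` {f. red_x f = 0}" "y \<in> carrier ?R"
    then obtain f g where "a = q f" "y = q g" "red_x f = 0" using surj by blast
    thus "y \<otimes>\<^bsub>?R\<^esub> a \<in> q ` {f. red_x f = 0}" "a \<otimes>\<^bsub>?R\<^esub> y \<in> q ` {f. red_x f = 0}"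
      by (auto simp: red_x_mult simp flip: q_mult)
  qed
  have p_sub: "prime_p \<subseteq> q ` {f. red_x f = 0}"
    unfolding p_def by (rule R.genideal_minimal [OF J]) (auto simp: red_x_x_elem)
  have gen_in: "q (x_elem i) \<in> prime_p" for i
    using R.genideal_self [OF gens] unfolding p_def by auto
  have p_sup: "q f \<in> prime_p" if f0: "red_x f = 0" for f
  proof -
    obtain g where g: "f = (\<Sum>i\<in>{X1, X2, X3, X4, X5}. x_elem i * g i)"
      using red_x_decompose [OF f0] by blast
    have "q (x_elem i * g i) \<in> prime_p" for i
      unfolding q_mult by (rule p.I_r_closed [OF gen_in q_in])
    hence "q (x_elem X1 * g X1 + (x_elem X2 * g X2 + (x_elem X3 * g X3 +
        (x_elem X4 * g X4 + x_elem X5 * g X5)))) \<in> prime_p"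
      unfolding q_add by (intro p.a_closed)
    thus ?thesis by (simp add: g)
  qed
  have mem: "q f \<in> prime_p \<longleftrightarrow> red_x f = 0" for f
  proof
    assume "q f \<in> prime_p"
    then obtain h where "q f = q h" "red_x h = 0" using p_sub by blast
    thus "red_x f = 0" using red by metis
  qed (rule p_sup)
  show ?thesis
  proof (rule primeidealI [OF p.ideal_axioms R.cring_axioms])
    have "q 1 \<notin> prime_p" by (simp add: mem red_x_1)
    thus "carrier ?R \<noteq> prime_p" using q_in by blast
  next
    fix a b assume "a \<in> carrier ?R" "b \<in> carrier ?R" "a \<otimes>\<^bsub>?R\<^esub> b \<in> prime_p"
    moreover from this obtain f g where "a = q f" "b = q g" using surj by blast
    ultimately have "a = q f" "b = q g" "q (f * g) \<in> prime_p" by (simp_all add: q_mult)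
    thus "a \<in> prime_p \<or> b \<in> prime_p" by (auto simp: mem red_x_mult)
  qed
qed

end

theory Submission
  imports Defs "HOL-Computational_Algebra.Formal_Laurent_Series"
begin

text \<open>
  Write \<open>\<alpha> = 1 + t\<close> and \<open>K = k((t))\<close>.  The ring \<open>R\<close> is free over \<open>k[[t]]\<close> on the monomials
  \<open>1, x\<^sub>1, \<dots>, x\<^sub>5, x\<^sub>1x\<^sub>2, x\<^sub>1x\<^sub>3, x\<^sub>1x\<^sub>4, x\<^sub>1x\<^sub>5, x\<^sub>2x\<^sub>5\<close> and \<open>w = x\<^sub>1x\<^sub>2x\<^sub>5\<close>, and localizing at \<open>\<pp>\<close>
  inverts \<open>t\<close>; so \<open>A = R\<^sub>\<pp>\<close> is a twelve-dimensional local \<open>K\<close>-algebra with maximal ideal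
  \<open>\<mm> = (x\<^sub>1, \<dots>, x\<^sub>5)\<close>, \<open>\<mm>\<^sup>4 = 0\<close> and socle \<open>K w\<close> (\<open>local_ring_copy\<close>).  It violates the uniform
  Auslander condition, for the following reason.

  For \<open>b \<in> K\<close>, \<open>b \<noteq> 0\<close>, let \<open>D\<^sub>b\<close> be the endomorphism of \<open>A\<^sup>2\<close> with rows \<open>(x\<^sub>1, b x\<^sub>3)\<close> and
  \<open>(x\<^sub>4, x\<^sub>2)\<close>.  The relations \<open>\<alpha> x\<^sub>1x\<^sub>3 + x\<^sub>2x\<^sub>3 = 0\<close> and \<open>x\<^sub>1x\<^sub>4 + x\<^sub>2x\<^sub>4 = 0\<close> give \<open>D\<^sub>b D\<^bsub>\<alpha>b\<^esub> = 0\<close>, and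
  comparing coordinates shows that the kernel of \<open>D\<^sub>b\<close> is exactly the image of \<open>D\<^bsub>\<alpha>b\<^esub>\<close>
  (\<open>matrix_kernel\<close>).  Hence the image \<open>M\<close> of \<open>D\<^sub>1\<close> has the free resolution
  \<open>\<dots> \<rightarrow> A\<^sup>2 \<rightarrow> A\<^sup>2 \<rightarrow> M\<close> with differentials \<open>D\<^bsub>\<alpha>\<^esub>\<close>, \<open>D\<^bsub>\<alpha>\<alpha>\<^esub>\<close>, \<dots>: the shape of the matrix is constant, but
  its parameter runs through the powers of \<open>\<alpha>\<close>.

  A second module detects the parameter.  For \<open>c \<in> K\<close> let \<open>y = x\<^sub>1x\<^sub>3 + x\<^sub>1x\<^sub>4 + c x\<^sub>1x\<^sub>5 + x\<^sub>2x\<^sub>5\<close>.  The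
  variables \<open>x\<^sub>1, \<dots>, x\<^sub>4\<close> multiply \<open>y\<close> by \<open>w, c w, w, w\<close>, so the ideal \<open>N\<^sub>c = A y = K y + K w\<close> is
  two-dimensional, and \<open>D\<^sub>b\<close> induces on \<open>Hom(A\<^sup>2, N\<^sub>c)\<close> the map \<open>(K y)\<^sup>2 \<rightarrow> (K w)\<^sup>2\<close> with rows \<open>(1, 1)\<close> and
  \<open>(b, c)\<close>.  Its determinant is \<open>c - b\<close>.  So, for the resolution \<open>F\<close> of \<open>M\<close>, the complex
  \<open>Hom(F, N\<^sub>c)\<close> is exact in each positive degree where neither of the two adjacent parameters is \<open>c\<close>,
  and it is not exact at the target of the map with \<open>b = c\<close>.
  Now \<open>\<alpha>\<close> has infinite multiplicative order in \<open>K\<close>, in every characteristic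
  (\<open>alpha_power_neq_1\<close>).  With \<open>c = \<alpha>\<^bsup>n + 1\<^esup>\<close> it follows that \<open>Ext\<^sup>i(M, N\<^sub>c)\<close> vanishes for all
  \<open>i > n + 1\<close> but not for \<open>i = n + 1\<close> (\<open>Ext_vanishes\<close>, \<open>Ext_nonzero\<close>).  As \<open>n\<close> is arbitrary, the
  Ext-index of \<open>A\<close> is infinite.

  \<open>Ext\<close> is defined by some resolution that is not specified further; that the explicit one may be
  used instead is the comparison theorem for projective resolutions (\<open>is_zero_Ext_Suc_iff\<close>).
\<close>


section \<open>Module homomorphisms\<close>

lemma module_homsI:
  assumes "\<And>x. x \<in> carrier M \<Longrightarrow> f x \<in> carrier N"
    and "\<And>x y. x \<in> carrier M \<Longrightarrow> y \<in> carrier M \<Longrightarrow> f (x \<oplus>\<^bsub>M\<^esub> y) = f x \<oplus>\<^bsub>N\<^esub> f y"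
    and "\<And>a x. a \<in> carrier A \<Longrightarrow> x \<in> carrier M \<Longrightarrow> f (a \<odot>\<^bsub>M\<^esub> x) = a \<odot>\<^bsub>N\<^esub> f x"
  shows "f \<in> module_homs A M N"
  using assms by (auto simp: module_homs_def)

lemma
  assumes "f \<in> module_homs A M N"
  shows module_homs_closed: "x \<in> carrier M \<Longrightarrow> f x \<in> carrier N"
    and module_homs_add:
      "x \<in> carrier M \<Longrightarrow> y \<in> carrier M \<Longrightarrow> f (x \<oplus>\<^bsub>M\<^esub> y) = f x \<oplus>\<^bsub>N\<^esub> f y"
    and module_homs_smult: "a \<in> carrier A \<Longrightarrow> x \<in> carrier M \<Longrightarrow> f (a \<odot>\<^bsub>M\<^esub> x) = a \<odot>\<^bsub>N\<^esub> f x"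
  using assms by (auto simp: module_homs_def)

lemma module_homs_zero:
  assumes "module A M" "module A N" "f \<in> module_homs A M N"
  shows "f \<zero>\<^bsub>M\<^esub> = \<zero>\<^bsub>N\<^esub>"
proof -
  interpret M: module A M by fact
  interpret N: module A N by fact
  have "f \<zero>\<^bsub>M\<^esub> = f (\<zero>\<^bsub>A\<^esub> \<odot>\<^bsub>M\<^esub> \<zero>\<^bsub>M\<^esub>)" by simp
  also have "\<dots> = \<zero>\<^bsub>A\<^esub> \<odot>\<^bsub>N\<^esub> f \<zero>\<^bsub>M\<^esub>" using module_homs_smult [OF assms(3)] by blast
  also have "\<dots> = \<zero>\<^bsub>N\<^esub>" using module_homs_closed [OF assms(3)] by simp
  finally show ?thesis .
qed

lemma module_homs_minus:
  assumes "module A M" "module A N" "f \<in> module_homs A M N" "x \<in> carrier M" "y \<in> carrier M"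
  shows "f (x \<ominus>\<^bsub>M\<^esub> y) = f x \<ominus>\<^bsub>N\<^esub> f y"
proof -
  interpret M: module A M by fact
  interpret N: module A N by fact
  note f = module_homs_closed [OF assms(3)] module_homs_add [OF assms(3)]
  have "(x \<ominus>\<^bsub>M\<^esub> y) \<oplus>\<^bsub>M\<^esub> y = x"
    using assms(4,5) by (simp add: M.minus_eq M.a_assoc M.l_neg)
  hence "f (x \<ominus>\<^bsub>M\<^esub> y) \<oplus>\<^bsub>N\<^esub> f y = f x"
    using f(2) [of "x \<ominus>\<^bsub>M\<^esub> y" y] assms(4,5) by simp
  hence "f (x \<ominus>\<^bsub>M\<^esub> y) \<oplus>\<^bsub>N\<^esub> f y \<ominus>\<^bsub>N\<^esub> f y = f x \<ominus>\<^bsub>N\<^esub> f y" by simp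
  thus ?thesis
    using assms(4,5) f(1) by (simp add: N.minus_eq N.a_assoc N.r_neg)
qed

lemma module_homs_comp:
  assumes "f \<in> module_homs A M N" "g \<in> module_homs A N P"
  shows "(\<lambda>x. g (f x)) \<in> module_homs A M P"
  using assms by (auto simp: module_homs_def Pi_iff)

lemma module_homs_id: "(\<lambda>x. x) \<in> module_homs A M M"
  by (auto simp: module_homs_def)

lemma module_homs_plus:
  assumes "module A N" "f \<in> module_homs A M N" "g \<in> module_homs A M N"
  shows "(\<lambda>x. f x \<oplus>\<^bsub>N\<^esub> g x) \<in> module_homs A M N"
proof -
  interpret N: module A N by fact
  note f = module_homs_closed [OF assms(2)] module_homs_add [OF assms(2)] module_homs_smult [OF assms(2)]
  note g = module_homs_closed [OF assms(3)] module_homs_add [OF assms(3)] module_homs_smult [OF assms(3)]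
  show ?thesis by (rule module_homsI) (simp_all add: f g N.a_ac N.smult_r_distr)
qed

lemma module_homs_diff:
  assumes "module A N" "f \<in> module_homs A M N" "g \<in> module_homs A M N"
  shows "(\<lambda>x. f x \<ominus>\<^bsub>N\<^esub> g x) \<in> module_homs A M N"
proof -
  interpret N: module A N by fact
  note f = module_homs_closed [OF assms(2)] module_homs_add [OF assms(2)] module_homs_smult [OF assms(2)]
  note g = module_homs_closed [OF assms(3)] module_homs_add [OF assms(3)] module_homs_smult [OF assms(3)]
  show ?thesis
    by (rule module_homsI)
       (simp_all add: f g N.minus_eq N.a_ac N.smult_r_distr N.minus_add N.smult_r_minus)
qed

lemma module_homs_cong:
  assumes "f \<in> module_homs A M N" "module A M" "\<And>x. x \<in> carrier M \<Longrightarrow> g x = f x"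
  shows "g \<in> module_homs A M N"
proof -
  interpret M: module A M by fact
  show ?thesis
    by (rule module_homsI)
       (simp_all add: assms(3) module_homs_closed [OF assms(1)] module_homs_add [OF assms(1)]
          module_homs_smult [OF assms(1)])
qed


section \<open>Free modules\<close>

lemma free_module_simps [simp]:
  "carrier (free_module A n) = {..<n} \<rightarrow>\<^sub>E carrier A"
  "\<zero>\<^bsub>free_module A n\<^esub> = (\<lambda>i\<in>{..<n}. \<zero>\<^bsub>A\<^esub>)"
  "v \<oplus>\<^bsub>free_module A n\<^esub> w = (\<lambda>i\<in>{..<n}. v i \<oplus>\<^bsub>A\<^esub> w i)"
  "a \<odot>\<^bsub>free_module A n\<^esub> v = (\<lambda>i\<in>{..<n}. a \<otimes>\<^bsub>A\<^esub> v i)"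
  by (simp_all add: free_module_def)

lemma module_free_module:
  assumes "cring A"
  shows "module A (free_module A n)"
proof -
  interpret A: cring A by fact
  have "abelian_group (free_module A n)"
  proof (rule abelian_groupI)
    fix v assume v: "v \<in> carrier (free_module A n)"
    show "\<exists>w\<in>carrier (free_module A n). w \<oplus>\<^bsub>free_module A n\<^esub> v = \<zero>\<^bsub>free_module A n\<^esub>"
      using v by (intro bexI [where x = "\<lambda>i\<in>{..<n}. \<ominus>\<^bsub>A\<^esub> v i"])
        (auto simp: PiE_iff A.l_neg intro!: restrict_ext)
    show "\<zero>\<^bsub>free_module A n\<^esub> \<oplus>\<^bsub>free_module A n\<^esub> v = v"
      using v by (auto simp: PiE_iff extensional_def fun_eq_iff)
  qed (auto simp: PiE_iff A.a_ac intro!: restrict_ext)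
  thus ?thesis
  proof (rule moduleI [OF assms])
    fix v assume v: "v \<in> carrier (free_module A n)"
    show "\<one>\<^bsub>A\<^esub> \<odot>\<^bsub>free_module A n\<^esub> v = v"
      using v by (auto simp: PiE_iff extensional_def fun_eq_iff)
  qed (auto simp: PiE_iff A.l_distr A.r_distr A.m_assoc intro!: restrict_ext)
qed

definition unit_vector :: "'a ring \<Rightarrow> nat \<Rightarrow> nat \<Rightarrow> nat \<Rightarrow> 'a" where
  "unit_vector A n i = (\<lambda>j\<in>{..<n}. if j = i then \<one>\<^bsub>A\<^esub> else \<zero>\<^bsub>A\<^esub>)"

lemma unit_vector_closed: "cring A \<Longrightarrow> unit_vector A n i \<in> carrier (free_module A n)"
proof -
  assume "cring A"
  then interpret A: cring A .
  show ?thesis by (auto simp: unit_vector_def)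
qed

text \<open>
  Every vector is reached from \<open>0\<close> by adding multiples of unit vectors, so a property closed
  under these steps holds for all vectors.
\<close>

lemma free_module_induct [consumes 2, case_names zero step]:
  assumes "cring A" "v \<in> carrier (free_module A n)"
    and "P \<zero>\<^bsub>free_module A n\<^esub>"
    and step: "\<And>w a i. w \<in> carrier (free_module A n) \<Longrightarrow> a \<in> carrier A \<Longrightarrow> i < n \<Longrightarrow> P w \<Longrightarrow>
      P (w \<oplus>\<^bsub>free_module A n\<^esub> a \<odot>\<^bsub>free_module A n\<^esub> unit_vector A n i)"
  shows "P v"
proof -
  interpret A: cring A by fact
  have v: "v i \<in> carrier A" if "i < n" for i using assms(2) that by (auto simp: PiE_iff)
  \<comment> \<open>The truncation of \<open>v\<close> to its first \<open>k\<close> coordinates.\<close>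
  define t where "t = (\<lambda>k. \<lambda>i\<in>{..<n}. if i < k then v i else \<zero>\<^bsub>A\<^esub>)"
  have "P (t k)" if "k \<le> n" for k
    using that
  proof (induction k)
    case 0
    have "t 0 = \<zero>\<^bsub>free_module A n\<^esub>" by (simp add: t_def)
    thus ?case using assms(3) by metis
  next
    case (Suc k)
    have t: "t k \<in> carrier (free_module A n)" by (auto simp: t_def v)
    have "t (Suc k) = t k \<oplus>\<^bsub>free_module A n\<^esub> v k \<odot>\<^bsub>free_module A n\<^esub> unit_vector A n k"
      using Suc.prems by (auto simp: t_def unit_vector_def v less_Suc_eq)
    moreover have "P (t k \<oplus>\<^bsub>free_module A n\<^esub> v k \<odot>\<^bsub>free_module A n\<^esub> unit_vector A n k)"
      by (rule step [OF t v]) (use Suc in simp_all)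
    ultimately show ?case by metis
  qed
  from this [of n] have "P (t n)" by simp
  moreover have "t n = v" using assms(2) by (auto simp: t_def PiE_iff extensional_def)
  ultimately show ?thesis by simp
qed

lemma hom_from_free_module_eqI:
  assumes "cring A" "f \<in> module_homs A (free_module A n) N" "g \<in> module_homs A (free_module A n) N"
    and "module A N"
    and "\<And>i. i < n \<Longrightarrow> f (unit_vector A n i) = g (unit_vector A n i)"
    and "v \<in> carrier (free_module A n)"
  shows "f v = g v"
  using assms(1,6)
proof (induction v rule: free_module_induct)
  case zero
  show ?case
    using module_homs_zero [OF module_free_module [OF assms(1)] assms(4)] assms(2,3) by metis
next
  case (step w a i)
  interpret F: module A "free_module A n" by (rule module_free_module [OF assms(1)])
  have s: "a \<odot>\<^bsub>free_module A n\<^esub> unit_vector A n i \<in> carrier (free_module A n)"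
    using step unit_vector_closed [OF assms(1)] by blast
  show ?case
    using module_homs_add [OF assms(2) step(1) s] module_homs_add [OF assms(3) step(1) s]
      module_homs_smult [OF assms(2) step(2) unit_vector_closed [OF assms(1)]]
      module_homs_smult [OF assms(3) step(2) unit_vector_closed [OF assms(1)]]
      step assms(5) by metis
qed

lemma hom_from_free_module_exists:
  assumes "cring A" "module A N" "\<And>i. i < n \<Longrightarrow> m i \<in> carrier N"
  shows "\<exists>h\<in>module_homs A (free_module A n) N. \<forall>i<n. h (unit_vector A n i) = m i"
  using assms(3)
proof (induction n)
  case 0
  interpret N: module A N by fact
  show ?case by (rule bexI [where x = "\<lambda>_. \<zero>\<^bsub>N\<^esub>"], simp, rule module_homsI) auto
next
  case (Suc n)
  interpret A: cring A by fact
  interpret N: module A N by fact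
  obtain h where h: "h \<in> module_homs A (free_module A n) N" "\<And>i. i < n \<Longrightarrow> h (unit_vector A n i) = m i"
    using Suc by force
  define c where "c = (\<lambda>v :: nat \<Rightarrow> 'a. restrict v {..<n})"
  have c: "c v \<in> carrier (free_module A n)" if "v \<in> carrier (free_module A (Suc n))" for v
    using that by (auto simp: c_def PiE_iff)
  have c_add: "c (v \<oplus>\<^bsub>free_module A (Suc n)\<^esub> w) = c v \<oplus>\<^bsub>free_module A n\<^esub> c w"
    and c_smult: "c (a \<odot>\<^bsub>free_module A (Suc n)\<^esub> v) = a \<odot>\<^bsub>free_module A n\<^esub> c v" for a v w
    by (auto simp: c_def)
  have last: "v n \<in> carrier A" if "v \<in> carrier (free_module A (Suc n))" for v
    using that by (auto simp: PiE_iff)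
  have mn: "m n \<in> carrier N" using Suc.prems by simp
  define h' where "h' = (\<lambda>v. h (c v) \<oplus>\<^bsub>N\<^esub> v n \<odot>\<^bsub>N\<^esub> m n)"
  have "h' \<in> module_homs A (free_module A (Suc n)) N"
  proof (rule module_homsI)
    fix v w assume v: "v \<in> carrier (free_module A (Suc n))" and w: "w \<in> carrier (free_module A (Suc n))"
    have "h' (v \<oplus>\<^bsub>free_module A (Suc n)\<^esub> w) =
        (h (c v) \<oplus>\<^bsub>N\<^esub> h (c w)) \<oplus>\<^bsub>N\<^esub> (v n \<oplus>\<^bsub>A\<^esub> w n) \<odot>\<^bsub>N\<^esub> m n"
      unfolding h'_def c_add module_homs_add [OF h(1) c [OF v] c [OF w]] by simp
    thus "h' (v \<oplus>\<^bsub>free_module A (Suc n)\<^esub> w) = h' v \<oplus>\<^bsub>N\<^esub> h' w"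
      using last [OF v] last [OF w] mn module_homs_closed [OF h(1) c [OF v]]
        module_homs_closed [OF h(1) c [OF w]]
      by (simp add: h'_def N.smult_l_distr N.a_ac)
  next
    fix a v assume a: "a \<in> carrier A" and v: "v \<in> carrier (free_module A (Suc n))"
    have "h' (a \<odot>\<^bsub>free_module A (Suc n)\<^esub> v) = a \<odot>\<^bsub>N\<^esub> h (c v) \<oplus>\<^bsub>N\<^esub> (a \<otimes>\<^bsub>A\<^esub> v n) \<odot>\<^bsub>N\<^esub> m n"
      unfolding h'_def c_smult module_homs_smult [OF h(1) a c [OF v]] by simp
    thus "h' (a \<odot>\<^bsub>free_module A (Suc n)\<^esub> v) = a \<odot>\<^bsub>N\<^esub> h' v"
      using last [OF v] mn a module_homs_closed [OF h(1) c [OF v]]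
      by (simp add: h'_def N.smult_r_distr N.smult_assoc1)
  next
    fix v assume v: "v \<in> carrier (free_module A (Suc n))"
    show "h' v \<in> carrier N"
      using last [OF v] mn module_homs_closed [OF h(1) c [OF v]] by (simp add: h'_def)
  qed
  moreover have "h' (unit_vector A (Suc n) i) = m i" if "i < Suc n" for i
  proof (cases "i = n")
    case True
    have "c (unit_vector A (Suc n) n) = \<zero>\<^bsub>free_module A n\<^esub>"
      by (auto simp: c_def unit_vector_def)
    hence "h (c (unit_vector A (Suc n) n)) = \<zero>\<^bsub>N\<^esub>"
      using module_homs_zero [OF module_free_module [OF assms(1)] assms(2) h(1)] by simp
    thus ?thesis using True mn by (simp add: h'_def unit_vector_def)
  next
    case False
    have "c (unit_vector A (Suc n) i) = unit_vector A n i"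
      by (auto simp: c_def unit_vector_def)
    thus ?thesis
      using False that h(2) Suc.prems [of i] mn by (simp add: h'_def unit_vector_def)
  qed
  ultimately show ?case by blast
qed

text \<open>Free modules are projective: a lift is determined by choosing preimages of the unit vectors.\<close>

lemma free_module_lift:
  assumes "cring A" "module A P" "module A N"
    and f: "f \<in> module_homs A (free_module A n) N" and g: "g \<in> module_homs A P N"
    and sub: "\<And>v. v \<in> carrier (free_module A n) \<Longrightarrow> f v \<in> g ` carrier P"
  shows "\<exists>h\<in>module_homs A (free_module A n) P. \<forall>v\<in>carrier (free_module A n). g (h v) = f v"
proof -
  have "\<forall>i. \<exists>p\<in>carrier P. g p = f (unit_vector A n i)"
    using sub [OF unit_vector_closed [OF assms(1)]] by (metis imageE)
  then obtain p where p: "\<And>i. p i \<in> carrier P" "\<And>i. g (p i) = f (unit_vector A n i)" by metis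
  obtain h where h: "h \<in> module_homs A (free_module A n) P" "\<And>i. i < n \<Longrightarrow> h (unit_vector A n i) = p i"
    using hom_from_free_module_exists [OF assms(1,2), of n p] p(1) by blast
  have "g (h v) = f v" if "v \<in> carrier (free_module A n)" for v
    by (rule hom_from_free_module_eqI [OF assms(1) module_homs_comp [OF h(1) g] f assms(3) _ that])
       (simp add: h p)
  thus ?thesis using h(1) by blast
qed

text \<open>
  The images of the unit vectors need not be distinct, so the coefficients of a vector cannot be
  used as they stand.  The span of the set of these images is shown to be closed under adding
  multiples of generators instead.
\<close>

lemma fg_module_image_free:
  assumes "cring A" "module A M" "\<epsilon> \<in> module_homs A (free_module A n) M"
    and surj: "\<epsilon> ` carrier (free_module A n) = carrier M"
  shows "fg_module A M"
proof -
  interpret A: cring A by fact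
  interpret M: module A M by fact
  interpret F: module A "free_module A n" by (rule module_free_module [OF assms(1)])
  define b where "b = (\<lambda>i. \<epsilon> (unit_vector A n i))"
  define B where "B = b ` {..<n}"
  have b: "b i \<in> carrier M" for i
    using module_homs_closed [OF assms(3) unit_vector_closed [OF assms(1)]] by (simp add: b_def)
  have B: "finite B" "B \<subseteq> carrier M" by (auto simp: B_def b)
  define Span where "Span = {x. \<exists>c\<in>B \<rightarrow> carrier A. x = (\<Oplus>\<^bsub>M\<^esub>y\<in>B. c y \<odot>\<^bsub>M\<^esub> y)}"
  have Pi: "(\<lambda>y. c y \<odot>\<^bsub>M\<^esub> y) \<in> B \<rightarrow> carrier M" if "c \<in> B \<rightarrow> carrier A" for c
    using that B by auto
  have Span_zero: "\<zero>\<^bsub>M\<^esub> \<in> Span"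
  proof -
    have "(\<Oplus>\<^bsub>M\<^esub>y\<in>B. \<zero>\<^bsub>A\<^esub> \<odot>\<^bsub>M\<^esub> y) = (\<Oplus>\<^bsub>M\<^esub>y\<in>B. \<zero>\<^bsub>M\<^esub>)"
      using B by (intro M.finsum_cong') auto
    thus ?thesis unfolding Span_def by (auto intro!: bexI [where x = "\<lambda>_. \<zero>\<^bsub>A\<^esub>"])
  qed
  have Span_step: "x \<oplus>\<^bsub>M\<^esub> a \<odot>\<^bsub>M\<^esub> z \<in> Span" if "x \<in> Span" "a \<in> carrier A" "z \<in> B" for x a z
  proof -
    from that(1) have "\<exists>c\<in>B \<rightarrow> carrier A. x = (\<Oplus>\<^bsub>M\<^esub>y\<in>B. c y \<odot>\<^bsub>M\<^esub> y)"
      unfolding Span_def by (rule CollectD)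
    then obtain c where c: "c \<in> B \<rightarrow> carrier A" "x = (\<Oplus>\<^bsub>M\<^esub>y\<in>B. c y \<odot>\<^bsub>M\<^esub> y)" ..
    \<comment> \<open>The coefficients of the one-term combination \<open>a z\<close>, to be added to those of \<open>x\<close>.\<close>
    define e where "e = (\<lambda>y. if z = y then a else \<zero>\<^bsub>A\<^esub>)"
    have e: "e \<in> B \<rightarrow> carrier A" using that(2) by (simp add: e_def)
    have "(\<Oplus>\<^bsub>M\<^esub>y\<in>B. e y \<odot>\<^bsub>M\<^esub> y) = (\<Oplus>\<^bsub>M\<^esub>y\<in>B. if z = y then a \<odot>\<^bsub>M\<^esub> y else \<zero>\<^bsub>M\<^esub>)"
      by (rule M.finsum_cong') (use B that in \<open>auto simp: e_def subset_iff\<close>)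
    also have "\<dots> = a \<odot>\<^bsub>M\<^esub> z"
      by (rule M.finsum_singleton) (use B that in \<open>auto simp: subset_iff\<close>)
    finally have "x \<oplus>\<^bsub>M\<^esub> a \<odot>\<^bsub>M\<^esub> z = (\<Oplus>\<^bsub>M\<^esub>y\<in>B. c y \<odot>\<^bsub>M\<^esub> y) \<oplus>\<^bsub>M\<^esub> (\<Oplus>\<^bsub>M\<^esub>y\<in>B. e y \<odot>\<^bsub>M\<^esub> y)"
      by (simp only: c(2))
    also have "\<dots> = (\<Oplus>\<^bsub>M\<^esub>y\<in>B. c y \<odot>\<^bsub>M\<^esub> y \<oplus>\<^bsub>M\<^esub> e y \<odot>\<^bsub>M\<^esub> y)"
      by (rule M.finsum_addf [symmetric]) (use c(1) e Pi in auto)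
    also have "\<dots> = (\<Oplus>\<^bsub>M\<^esub>y\<in>B. (c y \<oplus>\<^bsub>A\<^esub> e y) \<odot>\<^bsub>M\<^esub> y)"
      by (rule M.finsum_cong') (use B c(1) e in \<open>auto simp: Pi_iff M.smult_l_distr subset_iff\<close>)
    finally have "x \<oplus>\<^bsub>M\<^esub> a \<odot>\<^bsub>M\<^esub> z = (\<Oplus>\<^bsub>M\<^esub>y\<in>B. (c y \<oplus>\<^bsub>A\<^esub> e y) \<odot>\<^bsub>M\<^esub> y)" .
    moreover have "(\<lambda>y. c y \<oplus>\<^bsub>A\<^esub> e y) \<in> B \<rightarrow> carrier A"
      using c(1) e by (simp add: Pi_iff)
    ultimately show ?thesis unfolding Span_def by (intro CollectI bexI)
  qed
  have "\<epsilon> v \<in> Span" if "v \<in> carrier (free_module A n)" for v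
    using assms(1) that
  proof (induction v rule: free_module_induct)
    case zero
    show ?case
      unfolding module_homs_zero [OF module_free_module [OF assms(1)] assms(2,3)] by (rule Span_zero)
  next
    case (step w a i)
    have u: "unit_vector A n i \<in> carrier (free_module A n)" by (rule unit_vector_closed [OF assms(1)])
    have "\<epsilon> (w \<oplus>\<^bsub>free_module A n\<^esub> a \<odot>\<^bsub>free_module A n\<^esub> unit_vector A n i) = \<epsilon> w \<oplus>\<^bsub>M\<^esub> a \<odot>\<^bsub>M\<^esub> b i"
      unfolding b_def module_homs_add [OF assms(3) step(1) F.smult_closed [OF step(2) u]]
        module_homs_smult [OF assms(3) step(2) u] ..
    moreover have "b i \<in> B" using step(3) by (simp add: B_def)
    ultimately show ?case using Span_step [OF step(4,2)] by metis
  qed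
  hence "\<forall>x\<in>carrier M. x \<in> Span" by (simp flip: surj)
  thus ?thesis
    unfolding fg_module_def Span_def mem_Collect_eq using assms(2) B by (intro conjI exI)
qed


declare free_module_simps [simp del]

section \<open>Free resolutions and Ext\<close>

lemma free_resolutionD:
  assumes "free_resolution A M r d \<epsilon>"
  shows "\<epsilon> \<in> module_homs A (free_module A (r 0)) M"
    and "d i \<in> module_homs A (free_module A (r (Suc i))) (free_module A (r i))"
    and "\<epsilon> ` carrier (free_module A (r 0)) = carrier M"
    and "d 0 ` carrier (free_module A (r (Suc 0))) = {v \<in> carrier (free_module A (r 0)). \<epsilon> v = \<zero>\<^bsub>M\<^esub>}"
    and "d (Suc i) ` carrier (free_module A (r (Suc (Suc i)))) =
      {v \<in> carrier (free_module A (r (Suc i))). d i v = \<zero>\<^bsub>free_module A (r i)\<^esub>}"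
  using assms by (simp_all add: free_resolution_def Let_def a_kernel_def')

lemma free_resolution_cycle:
  assumes "free_resolution A M r d \<epsilon>" "v \<in> carrier (free_module A (r (Suc (Suc i))))"
  shows "d i (d (Suc i) v) = \<zero>\<^bsub>free_module A (r i)\<^esub>"
  using free_resolutionD(5) [OF assms(1), of i] assms(2) by blast

text \<open>
  A chain map over the identity of \<open>M\<close> is built one degree at a time; the invariant that makes
  the next lift possible is that \<open>\<phi> n\<close> maps the image of \<open>d n\<close> into the image of \<open>e n\<close>.
\<close>

lemma free_resolution_chain_map:
  assumes "cring A" "module A M"
    and r: "free_resolution A M r d \<epsilon>" and s: "free_resolution A M s e \<eta>"
  shows "\<exists>\<phi>. (\<forall>n. \<phi> n \<in> module_homs A (free_module A (r n)) (free_module A (s n))) \<and>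
      (\<forall>v\<in>carrier (free_module A (r 0)). \<eta> (\<phi> 0 v) = \<epsilon> v) \<and>
      (\<forall>n. \<forall>v\<in>carrier (free_module A (r (Suc n))). e n (\<phi> (Suc n) v) = \<phi> n (d n v))"
proof -
  let ?F = "\<lambda>n. free_module A (r n)" and ?G = "\<lambda>n. free_module A (s n)"
  note free = module_free_module [OF assms(1)]
  note d = free_resolutionD(2) [OF r] and e = free_resolutionD(2) [OF s]
  define P where "P = (\<lambda>n \<phi>. \<phi> \<in> module_homs A (?F n) (?G n) \<and>
    (\<forall>v\<in>carrier (?F (Suc n)). \<phi> (d n v) \<in> e n ` carrier (?G (Suc n))) \<and>
    (n = 0 \<longrightarrow> (\<forall>v\<in>carrier (?F 0). \<eta> (\<phi> v) = \<epsilon> v)))"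
  define Q where "Q = (\<lambda>n \<phi> \<phi>'. \<forall>v\<in>carrier (?F (Suc n)). e n (\<phi>' v) = \<phi> (d n v))"
  have "\<exists>\<phi>. \<forall>n. P n (\<phi> n) \<and> Q n (\<phi> n) (\<phi> (Suc n))"
  proof (rule dependent_nat_choice)
    have "\<exists>h\<in>module_homs A (?F 0) (?G 0). \<forall>v\<in>carrier (?F 0). \<eta> (h v) = \<epsilon> v"
      by (rule free_module_lift [OF assms(1) free assms(2) free_resolutionD(1) [OF r]
            free_resolutionD(1) [OF s]])
         (use module_homs_closed [OF free_resolutionD(1) [OF r]] free_resolutionD(3) [OF s] in blast)
    then obtain h where h: "h \<in> module_homs A (?F 0) (?G 0)" "\<forall>v\<in>carrier (?F 0). \<eta> (h v) = \<epsilon> v"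
      by blast
    have "h (d 0 v) \<in> e 0 ` carrier (?G (Suc 0))" if "v \<in> carrier (?F (Suc 0))" for v
    proof -
      have "d 0 v \<in> carrier (?F 0)" "\<epsilon> (d 0 v) = \<zero>\<^bsub>M\<^esub>"
        using free_resolutionD(4) [OF r] that by blast+
      thus ?thesis
        using h module_homs_closed [OF h(1)] unfolding free_resolutionD(4) [OF s] by simp
    qed
    hence "P 0 h" using h unfolding P_def by simp
    thus "\<exists>\<phi>. P 0 \<phi>" by (rule exI [where x = h])
  next
    fix \<phi> n assume "P n \<phi>"
    hence \<phi>: "\<phi> \<in> module_homs A (?F n) (?G n)"
      "\<And>v. v \<in> carrier (?F (Suc n)) \<Longrightarrow> \<phi> (d n v) \<in> e n ` carrier (?G (Suc n))"
      unfolding P_def by simp_all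
    obtain h where h: "h \<in> module_homs A (?F (Suc n)) (?G (Suc n))"
      "\<And>v. v \<in> carrier (?F (Suc n)) \<Longrightarrow> e n (h v) = \<phi> (d n v)"
      using free_module_lift [OF assms(1) free free module_homs_comp [OF d \<phi>(1)] e \<phi>(2)] by blast
    have "h (d (Suc n) v) \<in> e (Suc n) ` carrier (?G (Suc (Suc n)))" if v: "v \<in> carrier (?F (Suc (Suc n)))" for v
    proof -
      have "e n (h (d (Suc n) v)) = \<phi> (d n (d (Suc n) v))"
        by (rule h(2)) (rule module_homs_closed [OF d v])
      also have "\<dots> = \<zero>\<^bsub>?G n\<^esub>"
        unfolding free_resolution_cycle [OF r v] by (rule module_homs_zero [OF free free \<phi>(1)])
      finally show ?thesis
        using module_homs_closed [OF h(1) module_homs_closed [OF d v]]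
        unfolding free_resolutionD(5) [OF s] by simp
    qed
    hence "P (Suc n) h \<and> Q n \<phi> h" using h unfolding P_def Q_def by simp
    thus "\<exists>\<phi>'. P (Suc n) \<phi>' \<and> Q n \<phi> \<phi>'" by (rule exI [where x = h])
  qed
  then obtain \<phi> where "\<forall>n. P n (\<phi> n) \<and> Q n (\<phi> n) (\<phi> (Suc n))" ..
  thus ?thesis unfolding P_def Q_def by (intro exI [where x = \<phi>]) simp
qed

text \<open>
  The homotopy from a chain endomorphism over the identity of \<open>M\<close> to the identity is again built
  degree by degree; the invariant is that the next obstruction is a cycle.
\<close>

lemma free_resolution_homotopy:
  assumes "cring A" "module A M" and r: "free_resolution A M r d \<epsilon>"
    and \<theta>: "\<And>n. \<theta> n \<in> module_homs A (free_module A (r n)) (free_module A (r n))"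
    and \<theta>_\<epsilon>: "\<And>v. v \<in> carrier (free_module A (r 0)) \<Longrightarrow> \<epsilon> (\<theta> 0 v) = \<epsilon> v"
    and \<theta>_d: "\<And>n v. v \<in> carrier (free_module A (r (Suc n))) \<Longrightarrow> d n (\<theta> (Suc n) v) = \<theta> n (d n v)"
  shows "\<exists>h. (\<forall>n. h n \<in> module_homs A (free_module A (r n)) (free_module A (r (Suc n)))) \<and>
    (\<forall>n. \<forall>v\<in>carrier (free_module A (r (Suc n))). d (Suc n) (h (Suc n) v) =
       (\<theta> (Suc n) v \<ominus>\<^bsub>free_module A (r (Suc n))\<^esub> v) \<ominus>\<^bsub>free_module A (r (Suc n))\<^esub> h n (d n v))"
proof -
  let ?F = "\<lambda>n. free_module A (r n)"
  note free = module_free_module [OF assms(1)]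
  note d = free_resolutionD(2) [OF r]
  have ab: "abelian_group (?F n)" for n using free module.axioms(2) by blast
  interpret M: module A M by fact
  define g where "g = (\<lambda>n h v. (\<theta> (Suc n) v \<ominus>\<^bsub>?F (Suc n)\<^esub> v) \<ominus>\<^bsub>?F (Suc n)\<^esub> h (d n v))"
  have sub: "(\<lambda>v. \<theta> n v \<ominus>\<^bsub>?F n\<^esub> v) \<in> module_homs A (?F n) (?F n)" for n
    by (rule module_homs_diff [OF free \<theta> module_homs_id])
  have g: "g n h \<in> module_homs A (?F (Suc n)) (?F (Suc n))"
    if "h \<in> module_homs A (?F n) (?F (Suc n))" for n h
    unfolding g_def by (rule module_homs_diff [OF free sub module_homs_comp [OF d that]])
  have d_g: "d n (g n h v) = (\<theta> n (d n v) \<ominus>\<^bsub>?F n\<^esub> d n v) \<ominus>\<^bsub>?F n\<^esub> d n (h (d n v))"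
    if "h \<in> module_homs A (?F n) (?F (Suc n))" "v \<in> carrier (?F (Suc n))" for n h v
    unfolding g_def
    using that module_homs_closed [OF \<theta>] module_homs_closed [OF d] module_homs_closed [OF that(1)]
      module_homs_closed [OF sub]
    by (simp add: module_homs_minus [OF free free d] \<theta>_d)
  define P where "P = (\<lambda>n h. h \<in> module_homs A (?F n) (?F (Suc n)) \<and>
    (\<forall>v\<in>carrier (?F (Suc n)). d n (g n h v) = \<zero>\<^bsub>?F n\<^esub>))"
  define Q where "Q = (\<lambda>n h h'. \<forall>v\<in>carrier (?F (Suc n)). d (Suc n) (h' v) = g n h v)"
  have cancel: "x \<ominus>\<^bsub>?F n\<^esub> x = \<zero>\<^bsub>?F n\<^esub>" if "x \<in> carrier (?F n)" for x n
    using that abelian_group.r_neg [OF ab] by (simp add: a_minus_def)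
  have "\<exists>h. \<forall>n. P n (h n) \<and> Q n (h n) (h (Suc n))"
  proof (rule dependent_nat_choice)
    have "\<theta> 0 v \<ominus>\<^bsub>?F 0\<^esub> v \<in> d 0 ` carrier (?F (Suc 0))" if v: "v \<in> carrier (?F 0)" for v
    proof -
      have "\<epsilon> (\<theta> 0 v \<ominus>\<^bsub>?F 0\<^esub> v) = \<zero>\<^bsub>M\<^esub>"
        using v module_homs_closed [OF \<theta> v] module_homs_closed [OF free_resolutionD(1) [OF r] v]
        by (simp add: module_homs_minus [OF free assms(2) free_resolutionD(1) [OF r]] \<theta>_\<epsilon>
            M.minus_eq M.r_neg)
      thus ?thesis using module_homs_closed [OF sub v] unfolding free_resolutionD(4) [OF r] by simp
    qed
    then obtain h where h: "h \<in> module_homs A (?F 0) (?F (Suc 0))"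
      "\<And>v. v \<in> carrier (?F 0) \<Longrightarrow> d 0 (h v) = \<theta> 0 v \<ominus>\<^bsub>?F 0\<^esub> v"
      using free_module_lift [OF assms(1) free free sub d] by blast
    have "d 0 (g 0 h v) = \<zero>\<^bsub>?F 0\<^esub>" if v: "v \<in> carrier (?F (Suc 0))" for v
      unfolding d_g [OF h(1) v] h(2) [OF module_homs_closed [OF d v]]
      by (rule cancel) (rule module_homs_closed [OF sub module_homs_closed [OF d v]])
    hence "P 0 h" using h(1) unfolding P_def by simp
    thus "\<exists>h. P 0 h" by (rule exI [where x = h])
  next
    fix h n assume "P n h"
    hence h: "h \<in> module_homs A (?F n) (?F (Suc n))"
      "\<And>v. v \<in> carrier (?F (Suc n)) \<Longrightarrow> d n (g n h v) = \<zero>\<^bsub>?F n\<^esub>"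
      unfolding P_def by simp_all
    have "g n h v \<in> d (Suc n) ` carrier (?F (Suc (Suc n)))" if v: "v \<in> carrier (?F (Suc n))" for v
      using module_homs_closed [OF g [OF h(1)] v] h(2) [OF v] unfolding free_resolutionD(5) [OF r] by simp
    then obtain h' where h': "h' \<in> module_homs A (?F (Suc n)) (?F (Suc (Suc n)))"
      "\<And>v. v \<in> carrier (?F (Suc n)) \<Longrightarrow> d (Suc n) (h' v) = g n h v"
      using free_module_lift [OF assms(1) free free g [OF h(1)] d] by blast
    have "d (Suc n) (g (Suc n) h' v) = \<zero>\<^bsub>?F (Suc n)\<^esub>" if v: "v \<in> carrier (?F (Suc (Suc n)))" for v
    proof -
      let ?w = "d (Suc n) v"
      have w: "?w \<in> carrier (?F (Suc n))" by (rule module_homs_closed [OF d v])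
      have "h (d n ?w) = \<zero>\<^bsub>?F (Suc n)\<^esub>"
        unfolding free_resolution_cycle [OF r v] by (rule module_homs_zero [OF free free h(1)])
      moreover have "x \<ominus>\<^bsub>?F (Suc n)\<^esub> \<zero>\<^bsub>?F (Suc n)\<^esub> = x" if "x \<in> carrier (?F (Suc n))" for x
      proof -
        interpret F: module A "?F (Suc n)" by (rule free)
        show ?thesis using that by (simp add: F.minus_eq)
      qed
      ultimately have "g n h ?w = \<theta> (Suc n) ?w \<ominus>\<^bsub>?F (Suc n)\<^esub> ?w"
        unfolding g_def using module_homs_closed [OF sub w] by simp
      thus ?thesis
        unfolding d_g [OF h'(1) v] h'(2) [OF w] using cancel [OF module_homs_closed [OF sub w]] by simp
    qed
    hence "P (Suc n) h' \<and> Q n h h'" using h' unfolding P_def Q_def by simp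
    thus "\<exists>h'. P (Suc n) h' \<and> Q n h h'" by (rule exI [where x = h'])
  qed
  then obtain h where "\<forall>n. P n (h n) \<and> Q n (h n) (h (Suc n))" ..
  thus ?thesis unfolding P_def Q_def g_def by (intro exI [where x = h]) simp
qed

text \<open>
  Vanishing of the cohomology of \<open>Hom(F, N)\<close> does not depend on \<open>F\<close>: a cocycle \<open>f\<close> on \<open>F\<close> is pulled
  back along a chain map to another resolution \<open>G\<close>, bounded there, and pulled back to \<open>F\<close>; a homotopy
  bounds the difference from \<open>f\<close>.
\<close>

lemma cocycles_bound_transfer:
  assumes "cring A" "module A M" "module A N"
    and r: "free_resolution A M r d \<epsilon>" and s: "free_resolution A M s e \<eta>"
    and bound: "\<And>f. f \<in> module_homs A (free_module A (s (Suc j))) N \<Longrightarrow>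
      \<forall>v\<in>carrier (free_module A (s (Suc (Suc j)))). f (e (Suc j) v) = \<zero>\<^bsub>N\<^esub> \<Longrightarrow>
      \<exists>g\<in>module_homs A (free_module A (s j)) N.
        \<forall>v\<in>carrier (free_module A (s (Suc j))). f v = g (e j v)"
    and f: "f \<in> module_homs A (free_module A (r (Suc j))) N"
      "\<forall>v\<in>carrier (free_module A (r (Suc (Suc j)))). f (d (Suc j) v) = \<zero>\<^bsub>N\<^esub>"
  shows "\<exists>g\<in>module_homs A (free_module A (r j)) N.
    \<forall>v\<in>carrier (free_module A (r (Suc j))). f v = g (d j v)"
proof -
  let ?F = "\<lambda>n. free_module A (r n)" and ?G = "\<lambda>n. free_module A (s n)"
  note free = module_free_module [OF assms(1)]
  note d = free_resolutionD(2) [OF r] and e = free_resolutionD(2) [OF s]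
  interpret N: module A N by fact
  obtain \<phi> where \<phi>: "\<And>n. \<phi> n \<in> module_homs A (?F n) (?G n)"
    "\<And>v. v \<in> carrier (?F 0) \<Longrightarrow> \<eta> (\<phi> 0 v) = \<epsilon> v"
    "\<And>n v. v \<in> carrier (?F (Suc n)) \<Longrightarrow> e n (\<phi> (Suc n) v) = \<phi> n (d n v)"
    using free_resolution_chain_map [OF assms(1,2) r s] by blast
  obtain \<psi> where \<psi>: "\<And>n. \<psi> n \<in> module_homs A (?G n) (?F n)"
    "\<And>v. v \<in> carrier (?G 0) \<Longrightarrow> \<epsilon> (\<psi> 0 v) = \<eta> v"
    "\<And>n v. v \<in> carrier (?G (Suc n)) \<Longrightarrow> d n (\<psi> (Suc n) v) = \<psi> n (e n v)"
    using free_resolution_chain_map [OF assms(1,2) s r] by blast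
  have "\<exists>h. (\<forall>n. h n \<in> module_homs A (?F n) (?F (Suc n))) \<and>
    (\<forall>n. \<forall>v\<in>carrier (?F (Suc n)). d (Suc n) (h (Suc n) v) =
       (\<psi> (Suc n) (\<phi> (Suc n) v) \<ominus>\<^bsub>?F (Suc n)\<^esub> v) \<ominus>\<^bsub>?F (Suc n)\<^esub> h n (d n v))"
    by (rule free_resolution_homotopy [OF assms(1,2) r, of "\<lambda>n v. \<psi> n (\<phi> n v)"])
       (use module_homs_comp [OF \<phi>(1) \<psi>(1)] module_homs_closed [OF \<phi>(1)] \<phi>(2,3) \<psi>(2,3) in auto)
  then obtain h where h: "\<And>n. h n \<in> module_homs A (?F n) (?F (Suc n))"
    "\<And>n v. v \<in> carrier (?F (Suc n)) \<Longrightarrow> d (Suc n) (h (Suc n) v) =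
       (\<psi> (Suc n) (\<phi> (Suc n) v) \<ominus>\<^bsub>?F (Suc n)\<^esub> v) \<ominus>\<^bsub>?F (Suc n)\<^esub> h n (d n v)"
    by blast
  have "\<forall>v\<in>carrier (?G (Suc (Suc j))). f (\<psi> (Suc j) (e (Suc j) v)) = \<zero>\<^bsub>N\<^esub>"
    using f(2) module_homs_closed [OF \<psi>(1)] by (simp flip: \<psi>(3))
  then obtain g where g: "g \<in> module_homs A (?G j) N"
    "\<And>v. v \<in> carrier (?G (Suc j)) \<Longrightarrow> f (\<psi> (Suc j) v) = g (e j v)"
    using bound [OF module_homs_comp [OF \<psi>(1) f(1)]] by blast
  let ?g = "\<lambda>v. g (\<phi> j v) \<ominus>\<^bsub>N\<^esub> f (h j v)"
  have g_hom: "?g \<in> module_homs A (?F j) N"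
    by (rule module_homs_diff [OF assms(3) module_homs_comp [OF \<phi>(1) g(1)] module_homs_comp [OF h(1) f(1)]])
  have "\<forall>v\<in>carrier (?F (Suc j)). f v = ?g (d j v)"
  proof
    fix v assume v: "v \<in> carrier (?F (Suc j))"
    let ?u = "\<psi> (Suc j) (\<phi> (Suc j) v)" and ?w = "h j (d j v)"
    interpret F: module A "?F (Suc j)" by (rule free)
    have u: "?u \<in> carrier (?F (Suc j))" and w: "?w \<in> carrier (?F (Suc j))"
      using v module_homs_closed [OF \<phi>(1)] module_homs_closed [OF \<psi>(1)] module_homs_closed [OF h(1)]
        module_homs_closed [OF d] by auto
    note fN = module_homs_closed [OF f(1) u] module_homs_closed [OF f(1) v] module_homs_closed [OF f(1) w]
    have "\<zero>\<^bsub>N\<^esub> = f (d (Suc j) (h (Suc j) v))"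
      using f(2) module_homs_closed [OF h(1) v] by simp
    also have "\<dots> = (f ?u \<ominus>\<^bsub>N\<^esub> f v) \<ominus>\<^bsub>N\<^esub> f ?w"
      unfolding h(2) [OF v] using u v w by (simp add: module_homs_minus [OF free assms(3) f(1)])
    also have "\<dots> = (f ?u \<ominus>\<^bsub>N\<^esub> f ?w) \<ominus>\<^bsub>N\<^esub> f v"
      using fN by (simp add: N.minus_eq N.a_ac)
    finally have "(f ?u \<ominus>\<^bsub>N\<^esub> f ?w) \<ominus>\<^bsub>N\<^esub> f v = \<zero>\<^bsub>N\<^esub>" by (rule sym)
    hence "\<zero>\<^bsub>N\<^esub> \<oplus>\<^bsub>N\<^esub> f v = ((f ?u \<ominus>\<^bsub>N\<^esub> f ?w) \<ominus>\<^bsub>N\<^esub> f v) \<oplus>\<^bsub>N\<^esub> f v" by (simp only:)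
    also have "\<dots> = f ?u \<ominus>\<^bsub>N\<^esub> f ?w"
      using fN by (simp add: N.minus_eq N.a_assoc N.l_neg)
    finally have "f v = f ?u \<ominus>\<^bsub>N\<^esub> f ?w" using fN by simp
    moreover have "f ?u = g (\<phi> j (d j v))"
      unfolding g(2) [OF module_homs_closed [OF \<phi>(1) v]] \<phi>(3) [OF v] ..
    ultimately show "f v = ?g (d j v)" by (simp only:)
  qed
  thus ?thesis using g_hom by (rule bexI [where x = ?g])
qed

text \<open>
  The carrier of \<open>M\<close> is replaced by \<open>Z\<close> because \<open>Ext\<close> is the quotient of the cocycles, as a part of
  the module of all homomorphisms, by the coboundaries.
\<close>

lemma is_zero_quotient_module_iff:
  assumes "module A M" "submodule H A M" "H \<subseteq> Z" "Z \<subseteq> carrier M"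
  shows "is_zero_module (quotient_module (M\<lparr>carrier := Z\<rparr>) H) \<longleftrightarrow> Z \<subseteq> H"
proof -
  interpret M: module A M by fact
  interpret H: submodule H A M by fact
  have zero: "\<zero>\<^bsub>M\<^esub> \<in> H" using H.one_closed by simp
  have coset: "H +>\<^bsub>M\<lparr>carrier := Z\<rparr>\<^esub> x = (\<lambda>h. h \<oplus>\<^bsub>M\<^esub> x) ` H" for x
    by (auto simp: a_r_coset_def')
  have "(\<lambda>h. h \<oplus>\<^bsub>M\<^esub> x) ` H = H \<longleftrightarrow> x \<in> H" if "x \<in> Z" for x
  proof
    assume "(\<lambda>h. h \<oplus>\<^bsub>M\<^esub> x) ` H = H"
    hence "\<zero>\<^bsub>M\<^esub> \<oplus>\<^bsub>M\<^esub> x \<in> H" using zero by blast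
    thus "x \<in> H" using that assms(4) by auto
  next
    assume x: "x \<in> H"
    have "h = (h \<ominus>\<^bsub>M\<^esub> x) \<oplus>\<^bsub>M\<^esub> x \<and> h \<ominus>\<^bsub>M\<^esub> x \<in> H" if "h \<in> H" for h
      using that x H.subset H.m_closed H.m_inv_closed
      by (auto simp: M.minus_eq M.a_assoc M.l_neg subset_iff simp flip: a_inv_def)
    thus "(\<lambda>h. h \<oplus>\<^bsub>M\<^esub> x) ` H = H" using x H.m_closed by (fastforce)
  qed
  moreover have "is_zero_module (quotient_module (M\<lparr>carrier := Z\<rparr>) H) \<longleftrightarrow>
      (\<lambda>x. (\<lambda>h. h \<oplus>\<^bsub>M\<^esub> x) ` H) ` Z = {H}"
    unfolding is_zero_module_def quotient_module_def by (simp add: A_RCOSETS_def' coset UNION_singleton_eq_range)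
  moreover have "(\<lambda>x. (\<lambda>h. h \<oplus>\<^bsub>M\<^esub> x) ` H) ` Z = {H} \<longleftrightarrow> (\<forall>x\<in>Z. (\<lambda>h. h \<oplus>\<^bsub>M\<^esub> x) ` H = H)"
  proof
    assume "\<forall>x\<in>Z. (\<lambda>h. h \<oplus>\<^bsub>M\<^esub> x) ` H = H"
    moreover have "Z \<noteq> {}" using zero assms(3) by blast
    ultimately show "(\<lambda>x. (\<lambda>h. h \<oplus>\<^bsub>M\<^esub> x) ` H) ` Z = {H}" by (simp add: image_constant_conv)
  next
    assume *: "(\<lambda>x. (\<lambda>h. h \<oplus>\<^bsub>M\<^esub> x) ` H) ` Z = {H}"
    show "\<forall>x\<in>Z. (\<lambda>h. h \<oplus>\<^bsub>M\<^esub> x) ` H = H"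
    proof
      fix x assume "x \<in> Z"
      thus "(\<lambda>h. h \<oplus>\<^bsub>M\<^esub> x) ` H = H"
        using * imageI [of x Z "\<lambda>x. (\<lambda>h. h \<oplus>\<^bsub>M\<^esub> x) ` H"] by (metis singletonD)
    qed
  qed
  ultimately show ?thesis by (simp add: subset_eq)
qed

lemma hom_module_simps:
  "carrier (hom_module A M N) = module_homs A M N \<inter> extensional (carrier M)"
  "\<zero>\<^bsub>hom_module A M N\<^esub> = (\<lambda>x\<in>carrier M. \<zero>\<^bsub>N\<^esub>)"
  "f \<oplus>\<^bsub>hom_module A M N\<^esub> g = (\<lambda>x\<in>carrier M. f x \<oplus>\<^bsub>N\<^esub> g x)"
  "a \<odot>\<^bsub>hom_module A M N\<^esub> f = (\<lambda>x\<in>carrier M. a \<odot>\<^bsub>N\<^esub> f x)"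
  by (simp_all add: hom_module_def)

lemma module_hom_module:
  assumes "module A M" "module A N"
  shows "module A (hom_module A M N)"
proof -
  interpret M: module A M by fact
  interpret N: module A N by fact
  note closed = module_homs_closed [of _ A M N]
  have cr: "(\<lambda>x\<in>carrier M. f x) \<in> module_homs A M N" if "f \<in> module_homs A M N" for f
    by (rule module_homs_cong [OF that assms(1)]) simp
  have zero: "(\<lambda>x. \<zero>\<^bsub>N\<^esub>) \<in> module_homs A M N"
    by (rule module_homsI) simp_all
  have smult: "(\<lambda>x. a \<odot>\<^bsub>N\<^esub> f x) \<in> module_homs A M N"
    if a: "a \<in> carrier A" and f: "f \<in> module_homs A M N" for a f
  proof (rule module_homsI)
    fix b x assume "b \<in> carrier A" "x \<in> carrier M"
    thus "a \<odot>\<^bsub>N\<^esub> f (b \<odot>\<^bsub>M\<^esub> x) = b \<odot>\<^bsub>N\<^esub> (a \<odot>\<^bsub>N\<^esub> f x)"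
      using a closed [OF f]
      by (simp add: module_homs_smult [OF f] M.R.m_comm flip: N.smult_assoc1)
  qed (use a closed [OF f] in \<open>simp_all add: module_homs_add [OF f] N.smult_r_distr\<close>)
  have "abelian_group (hom_module A M N)"
  proof (rule abelian_groupI)
    fix f assume f: "f \<in> carrier (hom_module A M N)"
    hence f': "f \<in> module_homs A M N" by (simp add: hom_module_simps)
    let ?g = "\<lambda>x\<in>carrier M. \<zero>\<^bsub>N\<^esub> \<ominus>\<^bsub>N\<^esub> f x"
    show "\<exists>g\<in>carrier (hom_module A M N). g \<oplus>\<^bsub>hom_module A M N\<^esub> f = \<zero>\<^bsub>hom_module A M N\<^esub>"
    proof (rule bexI)
      show "?g \<oplus>\<^bsub>hom_module A M N\<^esub> f = \<zero>\<^bsub>hom_module A M N\<^esub>"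
        using closed [OF f'] by (auto simp: hom_module_simps N.minus_eq N.l_neg intro!: restrict_ext)
      show "?g \<in> carrier (hom_module A M N)"
        using cr [OF module_homs_diff [OF assms(2) zero f']] by (simp add: hom_module_simps)
    qed
    show "\<zero>\<^bsub>hom_module A M N\<^esub> \<oplus>\<^bsub>hom_module A M N\<^esub> f = f"
      using f closed [OF f'] by (auto simp: hom_module_simps fun_eq_iff extensional_def)
  next
    fix f g assume "f \<in> carrier (hom_module A M N)" "g \<in> carrier (hom_module A M N)"
    thus "f \<oplus>\<^bsub>hom_module A M N\<^esub> g \<in> carrier (hom_module A M N)"
      using cr [OF module_homs_plus [OF assms(2)]] by (simp add: hom_module_simps)
  next
    show "\<zero>\<^bsub>hom_module A M N\<^esub> \<in> carrier (hom_module A M N)"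
      using cr [OF zero] by (simp add: hom_module_simps)
  qed (auto simp: hom_module_simps module_homs_def Pi_iff N.a_ac intro!: restrict_ext)
  thus ?thesis
  proof (rule moduleI [OF M.R.is_cring])
    fix f assume f: "f \<in> carrier (hom_module A M N)"
    thus "\<one>\<^bsub>A\<^esub> \<odot>\<^bsub>hom_module A M N\<^esub> f = f"
      by (auto simp: hom_module_simps module_homs_def Pi_iff fun_eq_iff extensional_def)
  next
    fix a f assume "a \<in> carrier A" "f \<in> carrier (hom_module A M N)"
    thus "a \<odot>\<^bsub>hom_module A M N\<^esub> f \<in> carrier (hom_module A M N)"
      using cr [OF smult] by (simp add: hom_module_simps)
  qed (auto simp: hom_module_simps module_homs_def Pi_iff N.smult_l_distr N.smult_r_distr
          N.smult_assoc1 intro!: restrict_ext)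
qed

lemma submodule_image:
  assumes "module A M" "module A N" "f \<in> module_homs A M N"
  shows "submodule (f ` carrier M) A N"
proof -
  interpret M: module A M by fact
  interpret N: module A N by fact
  note f = module_homs_closed [OF assms(3)]
  show ?thesis
  proof (rule N.submoduleI)
    show "\<zero>\<^bsub>N\<^esub> \<in> f ` carrier M"
      using module_homs_zero [OF assms] by (metis M.zero_closed imageI)
  next
    fix y assume "y \<in> f ` carrier M"
    then obtain x where x: "x \<in> carrier M" "y = f x" by blast
    hence "\<ominus>\<^bsub>N\<^esub> y = f (\<zero>\<^bsub>M\<^esub> \<ominus>\<^bsub>M\<^esub> x)"
      using f by (simp add: module_homs_minus [OF assms] module_homs_zero [OF assms] N.minus_eq)
    thus "\<ominus>\<^bsub>N\<^esub> y \<in> f ` carrier M" using x by simp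
  next
    fix y z assume "y \<in> f ` carrier M" "z \<in> f ` carrier M"
    thus "y \<oplus>\<^bsub>N\<^esub> z \<in> f ` carrier M"
      by (auto simp flip: module_homs_add [OF assms(3)])
  next
    fix a y assume "a \<in> carrier A" "y \<in> f ` carrier M"
    thus "a \<odot>\<^bsub>N\<^esub> y \<in> f ` carrier M"
      by (auto simp flip: module_homs_smult [OF assms(3)])
  qed (use f in auto)
qed

text \<open>
  The vanishing of \<open>Ext\<close> can be tested on any resolution at hand, and by homomorphisms that are
  not extensional: a cocycle is a homomorphism that kills the incoming differential, and it is a
  coboundary iff it factors through the outgoing one.
\<close>

lemma is_zero_Ext_Suc_iff:
  assumes "cring A" "module A M" "module A N" and s: "free_resolution A M s e \<eta>"
  shows "is_zero_module (Ext (Suc j) A M N) \<longleftrightarrow>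
    (\<forall>f\<in>module_homs A (free_module A (s (Suc j))) N.
       (\<forall>v\<in>carrier (free_module A (s (Suc (Suc j)))). f (e (Suc j) v) = \<zero>\<^bsub>N\<^esub>) \<longrightarrow>
       (\<exists>g\<in>module_homs A (free_module A (s j)) N.
          \<forall>v\<in>carrier (free_module A (s (Suc j))). f v = g (e j v)))"
proof -
  note free = module_free_module [OF assms(1)]
  interpret N: module A N by fact
  define rd where "rd = (SOME (r, d). \<exists>\<epsilon>. free_resolution A M r d \<epsilon>)"
  obtain r d where rd: "rd = (r, d)" by (cases rd)
  have "case (s, e) of (r, d) \<Rightarrow> \<exists>\<epsilon>. free_resolution A M r d \<epsilon>" using s by auto
  hence "case rd of (r, d) \<Rightarrow> \<exists>\<epsilon>. free_resolution A M r d \<epsilon>" unfolding rd_def by (rule someI)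
  then obtain \<epsilon> where r: "free_resolution A M r d \<epsilon>" by (auto simp: rd)
  let ?F = "\<lambda>n. free_module A (r n)"
  let ?H = "\<lambda>n. hom_module A (?F n) N"
  note d = free_resolutionD(2) [OF r]
  have cr: "(\<lambda>x\<in>carrier (?F n). f x) \<in> module_homs A (?F n) N" if "f \<in> module_homs A (?F n) N" for f n
    by (rule module_homs_cong [OF that free]) simp
  let ?\<delta> = "\<lambda>f. compose (carrier (?F (Suc j))) f (d j)"
  have "?\<delta> \<in> module_homs A (?H j) (?H (Suc j))"
  proof (rule module_homsI)
    fix f assume "f \<in> carrier (?H j)"
    hence "f \<in> module_homs A (?F j) N" by (simp add: hom_module_simps)
    from cr [OF module_homs_comp [OF d this]]
    show "?\<delta> f \<in> carrier (?H (Suc j))" by (simp add: hom_module_simps compose_def)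
  qed (use module_homs_closed [OF d] in \<open>auto simp: hom_module_simps compose_def intro!: restrict_ext\<close>)
  hence sub: "submodule (ext_coboundaries A N r d (Suc j)) A (?H (Suc j))"
    using submodule_image [OF module_hom_module [OF free assms(3)] module_hom_module [OF free assms(3)]] by simp
  have coboundary_iff: "f \<in> ext_coboundaries A N r d (Suc j) \<longleftrightarrow>
      (\<exists>g\<in>module_homs A (?F j) N. \<forall>v\<in>carrier (?F (Suc j)). f v = g (d j v))"
    if f: "f \<in> carrier (?H (Suc j))" for f
  proof
    assume "f \<in> ext_coboundaries A N r d (Suc j)"
    then obtain g where "g \<in> carrier (?H j)" "f = ?\<delta> g" by auto
    thus "\<exists>g\<in>module_homs A (?F j) N. \<forall>v\<in>carrier (?F (Suc j)). f v = g (d j v)"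
      by (intro bexI [where x = g]) (auto simp: compose_def hom_module_simps)
  next
    assume "\<exists>g\<in>module_homs A (?F j) N. \<forall>v\<in>carrier (?F (Suc j)). f v = g (d j v)"
    then obtain g where g: "g \<in> module_homs A (?F j) N" "\<And>v. v \<in> carrier (?F (Suc j)) \<Longrightarrow> f v = g (d j v)" by blast
    let ?g = "\<lambda>x\<in>carrier (?F j). g x"
    have "f = ?\<delta> ?g"
      using f g(2) module_homs_closed [OF d]
      by (auto simp: compose_def hom_module_simps fun_eq_iff extensional_def)
    moreover have "?g \<in> carrier (?H j)" using cr [OF g(1)] by (simp add: hom_module_simps)
    ultimately show "f \<in> ext_coboundaries A N r d (Suc j)" by simp
  qed
  have cycles: "ext_coboundaries A N r d (Suc j) \<subseteq> ext_cocycles A N r d (Suc j)"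
  proof
    fix f assume f: "f \<in> ext_coboundaries A N r d (Suc j)"
    hence f': "f \<in> carrier (?H (Suc j))" using submodule.axioms(1) [OF sub] subgroup.subset by fastforce
    obtain g where g: "g \<in> module_homs A (?F j) N" "\<And>v. v \<in> carrier (?F (Suc j)) \<Longrightarrow> f v = g (d j v)"
      using coboundary_iff [OF f'] f by blast
    have "f (d (Suc j) v) = \<zero>\<^bsub>N\<^esub>" if v: "v \<in> carrier (?F (Suc (Suc j)))" for v
      unfolding g(2) [OF module_homs_closed [OF d v]] free_resolution_cycle [OF r v]
      by (rule module_homs_zero [OF free assms(3) g(1)])
    thus "f \<in> ext_cocycles A N r d (Suc j)" using f' by (simp add: ext_cocycles_def)
  qed
  have cocycles_sub: "ext_cocycles A N r d (Suc j) \<subseteq> carrier (?H (Suc j))"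
    by (auto simp: ext_cocycles_def)
  have "Ext (Suc j) A M N = quotient_module ((?H (Suc j))\<lparr>carrier := ext_cocycles A N r d (Suc j)\<rparr>)
      (ext_coboundaries A N r d (Suc j))"
    unfolding Ext_def rd_def [symmetric] rd by simp
  hence "is_zero_module (Ext (Suc j) A M N) \<longleftrightarrow>
      ext_cocycles A N r d (Suc j) \<subseteq> ext_coboundaries A N r d (Suc j)"
    using is_zero_quotient_module_iff [OF module_hom_module [OF free assms(3)] sub cycles cocycles_sub] by simp
  also have "\<dots> \<longleftrightarrow> (\<forall>f\<in>module_homs A (?F (Suc j)) N.
       (\<forall>v\<in>carrier (?F (Suc (Suc j))). f (d (Suc j) v) = \<zero>\<^bsub>N\<^esub>) \<longrightarrow>
       (\<exists>g\<in>module_homs A (?F j) N. \<forall>v\<in>carrier (?F (Suc j)). f v = g (d j v)))"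
    (is "_ \<longleftrightarrow> ?bounded")
  proof
    assume sub': "ext_cocycles A N r d (Suc j) \<subseteq> ext_coboundaries A N r d (Suc j)"
    show ?bounded
    proof (intro ballI impI)
      fix f assume f: "f \<in> module_homs A (?F (Suc j)) N"
        and z: "\<forall>v\<in>carrier (?F (Suc (Suc j))). f (d (Suc j) v) = \<zero>\<^bsub>N\<^esub>"
      let ?f = "\<lambda>x\<in>carrier (?F (Suc j)). f x"
      have f': "?f \<in> carrier (?H (Suc j))" using cr [OF f] by (simp add: hom_module_simps)
      have "?f \<in> ext_cocycles A N r d (Suc j)"
        using f' z module_homs_closed [OF d] by (simp add: ext_cocycles_def)
      hence "\<exists>g\<in>module_homs A (?F j) N. \<forall>v\<in>carrier (?F (Suc j)). ?f v = g (d j v)"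
        using sub' coboundary_iff [OF f'] by blast
      thus "\<exists>g\<in>module_homs A (?F j) N. \<forall>v\<in>carrier (?F (Suc j)). f v = g (d j v)" by simp
    qed
  next
    assume b: ?bounded
    show "ext_cocycles A N r d (Suc j) \<subseteq> ext_coboundaries A N r d (Suc j)"
    proof
      fix f assume f: "f \<in> ext_cocycles A N r d (Suc j)"
      hence f': "f \<in> carrier (?H (Suc j))" using cocycles_sub by blast
      thus "f \<in> ext_coboundaries A N r d (Suc j)"
        unfolding coboundary_iff [OF f'] using b f by (simp add: ext_cocycles_def hom_module_simps)
    qed
  qed
  also have "\<dots> \<longleftrightarrow> (\<forall>f\<in>module_homs A (free_module A (s (Suc j))) N.
       (\<forall>v\<in>carrier (free_module A (s (Suc (Suc j)))). f (e (Suc j) v) = \<zero>\<^bsub>N\<^esub>) \<longrightarrow>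
       (\<exists>g\<in>module_homs A (free_module A (s j)) N.
          \<forall>v\<in>carrier (free_module A (s (Suc j))). f v = g (e j v)))"
    (is "_ \<longleftrightarrow> ?bounded'")
  proof
    assume b: ?bounded
    show ?bounded'
      by (intro ballI impI, rule cocycles_bound_transfer [OF assms(1-3) s r]) (use b in blast)+
  next
    assume b: ?bounded'
    show ?bounded
      by (intro ballI impI, rule cocycles_bound_transfer [OF assms(1-3) r s]) (use b in blast)+
  qed
  finally show ?thesis .
qed


section \<open>Submodules of free modules as modules\<close>

text \<open>
  The elements of a submodule \<open>P\<close> are wrapped into singletons: a submodule of \<open>A\<^sup>n\<close> thereby has its
  elements in \<open>(nat \<Rightarrow> 'a) set\<close>, the type over which the modules in the Ext-index range.
\<close>

definition singleton_module :: "('a, 'm) module \<Rightarrow> 'm set \<Rightarrow> ('a, 'm set) module" where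
  "singleton_module M P = \<lparr>carrier = (\<lambda>x. {x}) ` P, monoid.mult = undefined, one = undefined,
     ring.zero = {\<zero>\<^bsub>M\<^esub>},
     add = (\<lambda>U V. {the_elem U \<oplus>\<^bsub>M\<^esub> the_elem V}),
     module.smult = (\<lambda>a U. {a \<odot>\<^bsub>M\<^esub> the_elem U})\<rparr>"

lemma singleton_module_simps:
  "carrier (singleton_module M P) = (\<lambda>x. {x}) ` P"
  "\<zero>\<^bsub>singleton_module M P\<^esub> = {\<zero>\<^bsub>M\<^esub>}"
  "{x} \<oplus>\<^bsub>singleton_module M P\<^esub> {y} = {x \<oplus>\<^bsub>M\<^esub> y}"
  "a \<odot>\<^bsub>singleton_module M P\<^esub> {x} = {a \<odot>\<^bsub>M\<^esub> x}"
  by (simp_all add: singleton_module_def)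

lemma module_singleton_module:
  assumes "module A M" "submodule P A M"
  shows "module A (singleton_module M P)"
proof -
  interpret M: module A M by fact
  have sub: "subgroup P (add_monoid M)" by (rule submodule.axioms(1) [OF assms(2)])
  have P: "x \<in> carrier M" if "x \<in> P" for x
    using subgroup.subset [OF sub] that by auto
  have add: "x \<oplus>\<^bsub>M\<^esub> y \<in> P" if "x \<in> P" "y \<in> P" for x y
    using subgroup.m_closed [OF sub] that by simp
  have neg: "\<ominus>\<^bsub>M\<^esub> x \<in> P" if "x \<in> P" for x
    using subgroup.m_inv_closed [OF sub] that by (simp add: a_inv_def)
  have zero: "\<zero>\<^bsub>M\<^esub> \<in> P" using subgroup.one_closed [OF sub] by simp
  have smult: "a \<odot>\<^bsub>M\<^esub> x \<in> P" if "a \<in> carrier A" "x \<in> P" for a x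
    using submodule.smult_closed [OF assms(2)] that by simp
  have cases: thesis
    if "U \<in> carrier (singleton_module M P)" "\<And>x. x \<in> P \<Longrightarrow> x \<in> carrier M \<Longrightarrow> U = {x} \<Longrightarrow> thesis" for U thesis
    using that P by (auto simp: singleton_module_simps)
  have in_carrier: "{x} \<in> carrier (singleton_module M P) \<longleftrightarrow> x \<in> P" for x
    by (auto simp: singleton_module_simps)
  note simps = singleton_module_simps(2-)
  have "abelian_group (singleton_module M P)"
  proof (rule abelian_groupI)
    fix U assume "U \<in> carrier (singleton_module M P)"
    then obtain x where x: "x \<in> P" "x \<in> carrier M" "U = {x}" by (rule cases)
    show "\<exists>V\<in>carrier (singleton_module M P). V \<oplus>\<^bsub>singleton_module M P\<^esub> U = \<zero>\<^bsub>singleton_module M P\<^esub>"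
      by (rule bexI [where x = "{\<ominus>\<^bsub>M\<^esub> x}"]) (simp_all add: x simps neg in_carrier M.l_neg)
  qed (auto elim!: cases simp: simps in_carrier zero add M.a_ac)
  thus ?thesis
    by (rule moduleI [OF M.R.is_cring])
       (auto elim!: cases simp: simps in_carrier smult M.smult_l_distr M.smult_r_distr M.smult_assoc1)
qed

lemma singleton_module_image_hom:
  assumes "f \<in> module_homs A M N"
  shows "(\<lambda>x. {f x}) \<in> module_homs A M (singleton_module N (f ` carrier M))"
  by (rule module_homsI)
     (simp_all add: singleton_module_simps module_homs_add [OF assms] module_homs_smult [OF assms])

lemma fg_singleton_module_image:
  assumes "cring A" "module A N" "f \<in> module_homs A (free_module A n) N"
  shows "fg_module A (singleton_module N (f ` carrier (free_module A n)))"
proof (rule fg_module_image_free [OF assms(1) _ singleton_module_image_hom [OF assms(3)]])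
  show "module A (singleton_module N (f ` carrier (free_module A n)))"
    by (rule module_singleton_module [OF assms(2) submodule_image [OF module_free_module [OF assms(1)] assms(2,3)]])
qed (auto simp: singleton_module_simps)


section \<open>A twelve-dimensional algebra over the field of Laurent series\<close>

text \<open>
  The multiplication table of the algebra involves a parameter \<open>\<alpha>\<close>.  A class attaches it to the
  coefficient ring, so that the coordinate vectors over a coefficient type form a ring type.
\<close>

class parametrized_comm_ring = comm_ring_1 +
  fixes alpha :: 'a

text \<open>
  The coordinates with respect to \<open>1, x\<^sub>1, \<dots>, x\<^sub>5, x\<^sub>1x\<^sub>2, x\<^sub>1x\<^sub>3, x\<^sub>1x\<^sub>4, x\<^sub>1x\<^sub>5, x\<^sub>2x\<^sub>5, x\<^sub>1x\<^sub>2x\<^sub>5\<close>.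
  The other products of two variables are \<open>x\<^sub>2x\<^sub>3 = -\<alpha> x\<^sub>1x\<^sub>3\<close>, \<open>x\<^sub>2x\<^sub>4 = -x\<^sub>1x\<^sub>4\<close>,
  \<open>x\<^sub>3\<^sup>2 = x\<^sub>2x\<^sub>5 - \<alpha> x\<^sub>1x\<^sub>5\<close>, \<open>x\<^sub>4\<^sup>2 = x\<^sub>2x\<^sub>5 - x\<^sub>1x\<^sub>5\<close> and zero otherwise.  A variable times a quadratic
  basis element is \<open>w = x\<^sub>1x\<^sub>2x\<^sub>5\<close> in the cases \<open>x\<^sub>1 \<cdot> x\<^sub>2x\<^sub>5\<close>, \<open>x\<^sub>2 \<cdot> x\<^sub>1x\<^sub>5\<close>, \<open>x\<^sub>3 \<cdot> x\<^sub>1x\<^sub>3\<close>, \<open>x\<^sub>4 \<cdot> x\<^sub>1x\<^sub>4\<close>,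
  \<open>x\<^sub>5 \<cdot> x\<^sub>1x\<^sub>2\<close>, and zero otherwise.
\<close>

datatype 'c alg = Alg (a0: 'c) (a1: 'c) (a2: 'c) (a3: 'c) (a4: 'c)
  (a5: 'c) (a12: 'c) (a13: 'c) (a14: 'c) (a15: 'c) (a25: 'c) (aw: 'c)

instantiation alg :: (parametrized_comm_ring) comm_ring_1
begin

definition "0 = Alg 0 0 0 0 0 0 0 0 0 0 0 0"
definition "1 = Alg 1 0 0 0 0 0 0 0 0 0 0 0"
definition "f + g = Alg (a0 f + a0 g) (a1 f + a1 g) (a2 f + a2 g) (a3 f + a3 g) (a4 f + a4 g)
  (a5 f + a5 g) (a12 f + a12 g) (a13 f + a13 g) (a14 f + a14 g) (a15 f + a15 g) (a25 f + a25 g)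
  (aw f + aw g)"
definition "f - g = Alg (a0 f - a0 g) (a1 f - a1 g) (a2 f - a2 g) (a3 f - a3 g) (a4 f - a4 g)
  (a5 f - a5 g) (a12 f - a12 g) (a13 f - a13 g) (a14 f - a14 g) (a15 f - a15 g) (a25 f - a25 g)
  (aw f - aw g)"
definition "- f = Alg (- a0 f) (- a1 f) (- a2 f) (- a3 f) (- a4 f) (- a5 f) (- a12 f) (- a13 f)
  (- a14 f) (- a15 f) (- a25 f) (- aw f)"
definition "f * g = Alg
  (a0 f * a0 g)
  (a0 f * a1 g + a1 f * a0 g)
  (a0 f * a2 g + a2 f * a0 g)
  (a0 f * a3 g + a3 f * a0 g)
  (a0 f * a4 g + a4 f * a0 g)
  (a0 f * a5 g + a5 f * a0 g)
  (a0 f * a12 g + a12 f * a0 g + (a1 f * a2 g + a2 f * a1 g))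
  (a0 f * a13 g + a13 f * a0 g + (a1 f * a3 g + a3 f * a1 g) - alpha * (a2 f * a3 g + a3 f * a2 g))
  (a0 f * a14 g + a14 f * a0 g + (a1 f * a4 g + a4 f * a1 g) - (a2 f * a4 g + a4 f * a2 g))
  (a0 f * a15 g + a15 f * a0 g + (a1 f * a5 g + a5 f * a1 g) - alpha * (a3 f * a3 g) - a4 f * a4 g)
  (a0 f * a25 g + a25 f * a0 g + (a2 f * a5 g + a5 f * a2 g) + a3 f * a3 g + a4 f * a4 g)
  (a0 f * aw g + aw f * a0 g + (a1 f * a25 g + a25 f * a1 g) + (a2 f * a15 g + a15 f * a2 g)
    + (a3 f * a13 g + a13 f * a3 g) + (a4 f * a14 g + a14 f * a4 g) + (a5 f * a12 g + a12 f * a5 g))"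

instance
proof
  fix f g h :: "'a alg"
  show "f * g * h = f * (g * h)"
    by (simp add: times_alg_def algebra_simps)
  show "f * g = g * f" by (simp add: times_alg_def algebra_simps)
  show "1 * f = f" by (simp add: times_alg_def one_alg_def)
  show "(f + g) * h = f * h + g * h" by (simp add: times_alg_def plus_alg_def algebra_simps)
  show "(0 :: 'a alg) \<noteq> 1" by (simp add: zero_alg_def one_alg_def)
qed (simp_all add: plus_alg_def minus_alg_def uminus_alg_def zero_alg_def)

end

lemma alg_sel_0 [simp]:
  "a0 0 = 0" "a1 0 = 0" "a2 0 = 0" "a3 0 = 0" "a4 0 = 0" "a5 0 = 0" "a12 0 = 0" "a13 0 = 0"
  "a14 0 = 0" "a15 0 = 0" "a25 0 = 0" "aw 0 = 0"
  by (simp_all add: zero_alg_def)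

lemma alg_sel_plus [simp]:
  "a0 (f + g) = a0 f + a0 g" "a1 (f + g) = a1 f + a1 g" "a2 (f + g) = a2 f + a2 g"
  "a3 (f + g) = a3 f + a3 g" "a4 (f + g) = a4 f + a4 g" "a5 (f + g) = a5 f + a5 g"
  "a12 (f + g) = a12 f + a12 g" "a13 (f + g) = a13 f + a13 g" "a14 (f + g) = a14 f + a14 g"
  "a15 (f + g) = a15 f + a15 g" "a25 (f + g) = a25 f + a25 g" "aw (f + g) = aw f + aw g"
  by (simp_all add: plus_alg_def)

definition scalar :: "'c \<Rightarrow> 'c::parametrized_comm_ring alg" where
  "scalar c = Alg c 0 0 0 0 0 0 0 0 0 0 0"

fun xv :: "xvar \<Rightarrow> 'c::parametrized_comm_ring alg" where
  "xv X1 = Alg 0 1 0 0 0 0 0 0 0 0 0 0"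
| "xv X2 = Alg 0 0 1 0 0 0 0 0 0 0 0 0"
| "xv X3 = Alg 0 0 0 1 0 0 0 0 0 0 0 0"
| "xv X4 = Alg 0 0 0 0 1 0 0 0 0 0 0 0"
| "xv X5 = Alg 0 0 0 0 0 1 0 0 0 0 0 0"

lemma scalar_mult: "scalar c * f = Alg (c * a0 f) (c * a1 f) (c * a2 f) (c * a3 f) (c * a4 f)
    (c * a5 f) (c * a12 f) (c * a13 f) (c * a14 f) (c * a15 f) (c * a25 f) (c * aw f)"
  by (simp add: scalar_def times_alg_def)

lemma scalar_hom:
  "scalar (c + d) = scalar c + scalar d" "scalar (c * d) = scalar c * scalar d"
  "scalar 0 = 0" "scalar 1 = 1" "scalar (c - d) = scalar c - scalar d"
  "scalar (- c) = - scalar c"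
  by (simp_all add: scalar_def plus_alg_def times_alg_def zero_alg_def one_alg_def minus_alg_def
      uminus_alg_def)

lemma scalar_sum: "scalar (sum f A) = (\<Sum>x\<in>A. scalar (f x))"
  by (induction A rule: infinite_finite_induct) (simp_all add: scalar_hom)

lemma xv_mult:
  "xv X1 * f = Alg 0 (a0 f) 0 0 0 0 (a2 f) (a3 f) (a4 f) (a5 f) 0 (a25 f)"
  "xv X2 * f = Alg 0 0 (a0 f) 0 0 0 (a1 f) (- alpha * a3 f) (- a4 f) 0 (a5 f) (a15 f)"
  "xv X3 * f = Alg 0 0 0 (a0 f) 0 0 0 (a1 f - alpha * a2 f) 0 (- alpha * a3 f) (a3 f) (a13 f)"
  "xv X4 * f = Alg 0 0 0 0 (a0 f) 0 0 0 (a1 f - a2 f) (- a4 f) (a4 f) (a14 f)"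
  "xv X5 * f = Alg 0 0 0 0 0 (a0 f) 0 0 0 (a1 f) (a2 f) (a12 f)"
  by (simp_all add: times_alg_def)

lemma xv_sel:
  "a0 (xv i) = 0" "a1 (xv i) = (if i = X1 then 1 else 0)" "a2 (xv i) = (if i = X2 then 1 else 0)"
  "a3 (xv i) = (if i = X3 then 1 else 0)" "a4 (xv i) = (if i = X4 then 1 else 0)"
  "a5 (xv i) = (if i = X5 then 1 else 0)" "a12 (xv i) = 0" "a13 (xv i) = 0" "a14 (xv i) = 0"
  "a15 (xv i) = 0" "a25 (xv i) = 0" "aw (xv i) = 0"
  by (cases i; simp)+

declare xv.simps [simp del]

instantiation fls :: (field) parametrized_comm_ring
begin

definition "alpha = (1 + fls_X :: 'a fls)"

instance ..

end

lemma alpha_nonzero: "(alpha :: 'k::field fls) \<noteq> 0"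
proof
  assume "(alpha :: 'k fls) = 0"
  hence "fls_nth (alpha :: 'k fls) 0 = 0" by simp
  thus False by (simp add: alpha_fls_def)
qed

text \<open>
  In every characteristic, \<open>(1 + t)\<^sup>n\<close> is a monic polynomial of degree \<open>n\<close>.
\<close>

lemma alpha_power_neq_1:
  assumes "n > 0"
  shows "(alpha :: 'k::field fls) ^ n \<noteq> 1"
proof
  let ?p = "[:1, 1:] :: 'k poly"
  have X: "fps_of_poly ?p = 1 + fps_X" by (simp add: fps_of_poly_pCons)
  assume "(alpha :: 'k fls) ^ n = 1"
  moreover have "(alpha :: 'k fls) ^ n = fps_to_fls (fps_of_poly (?p ^ n))"
    by (simp add: alpha_fls_def fps_to_fls_power fps_of_poly_power X)
  ultimately have "fps_of_poly (?p ^ n) = 1" by (metis fps_to_fls_eq_1_iff)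
  hence "?p ^ n = 1" by (metis fps_of_poly_1 fps_of_poly_eq_iff)
  hence "degree (?p ^ n) = 0" by simp
  moreover have "degree (?p ^ n) = n" by (subst degree_power_eq) simp_all
  ultimately show False using assms by simp
qed


section \<open>The homomorphism from the power series ring\<close>

text \<open>
  The homomorphism replaces each variable by its namesake in the algebra and leaves \<open>t\<close> alone.  Since
  monomials of degree at least four vanish in the algebra, only finitely many coefficients matter.
\<close>

definition mon :: "(xvar \<Rightarrow>\<^sub>0 nat) \<Rightarrow> 'c::parametrized_comm_ring alg" where
  "mon e = xv X1 ^ Poly_Mapping.lookup e X1 * xv X2 ^ Poly_Mapping.lookup e X2 *
     xv X3 ^ Poly_Mapping.lookup e X3 * xv X4 ^ Poly_Mapping.lookup e X4 * xv X5 ^ Poly_Mapping.lookup e X5"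

definition deg :: "(xvar \<Rightarrow>\<^sub>0 nat) \<Rightarrow> nat" where
  "deg e = Poly_Mapping.lookup e X1 + Poly_Mapping.lookup e X2 + Poly_Mapping.lookup e X3 +
     Poly_Mapping.lookup e X4 + Poly_Mapping.lookup e X5"

lemma mon_add: "mon (a + b) = mon a * mon b"
  by (simp only: mon_def lookup_add power_add ac_simps)

lemma deg_add: "deg (a + b) = deg a + deg b"
  by (simp add: deg_def lookup_add)

text \<open>Membership in the \<open>d\<close>-th power of the maximal ideal, which is zero for \<open>d \<ge> 4\<close>, in coordinates.\<close>

definition alg_max_power :: "nat \<Rightarrow> 'c::parametrized_comm_ring alg \<Rightarrow> bool" where
  "alg_max_power d f \<longleftrightarrow> (d \<ge> 1 \<longrightarrow> a0 f = 0) \<and>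
     (d \<ge> 2 \<longrightarrow> a1 f = 0 \<and> a2 f = 0 \<and> a3 f = 0 \<and> a4 f = 0 \<and> a5 f = 0) \<and>
     (d \<ge> 3 \<longrightarrow> a12 f = 0 \<and> a13 f = 0 \<and> a14 f = 0 \<and> a15 f = 0 \<and> a25 f = 0) \<and>
     (d \<ge> 4 \<longrightarrow> aw f = 0)"

lemma alg_max_power_xv: "alg_max_power d f \<Longrightarrow> alg_max_power (Suc d) (xv i * f)"
  by (cases i) (auto simp: alg_max_power_def xv_mult)

lemma alg_max_power_xv_power: "alg_max_power d f \<Longrightarrow> alg_max_power (d + k) (xv i ^ k * f)"
proof (induction k)
  case (Suc k)
  from alg_max_power_xv [OF Suc.IH [OF Suc.prems]] show ?case by (simp add: mult.assoc)
qed simp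

lemma alg_max_power_mon: "alg_max_power (deg e) (mon e)"
proof -
  have "alg_max_power 0 1" by (simp add: alg_max_power_def)
  hence "alg_max_power (0 + Poly_Mapping.lookup e X5 + Poly_Mapping.lookup e X4 + Poly_Mapping.lookup e X3 +
      Poly_Mapping.lookup e X2 + Poly_Mapping.lookup e X1)
    (xv X1 ^ Poly_Mapping.lookup e X1 * (xv X2 ^ Poly_Mapping.lookup e X2 * (xv X3 ^ Poly_Mapping.lookup e X3 *
       (xv X4 ^ Poly_Mapping.lookup e X4 * (xv X5 ^ Poly_Mapping.lookup e X5 * 1)))))"
    by (intro alg_max_power_xv_power)
  thus ?thesis by (simp add: mon_def deg_def ac_simps)
qed

lemma alg_max_power_4: "alg_max_power d f \<Longrightarrow> d \<ge> 4 \<Longrightarrow> f = 0"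
  by (cases f) (simp add: alg_max_power_def zero_alg_def)

lemma mon_eq_0: "deg e \<ge> 4 \<Longrightarrow> mon e = 0"
  by (rule alg_max_power_4 [OF alg_max_power_mon])

definition low_exponents :: "(xvar \<Rightarrow>\<^sub>0 nat) set" where
  "low_exponents = {e. deg e \<le> 3}"

lemma finite_low_exponents: "finite low_exponents"
proof (rule finite_imageD)
  let ?f = "\<lambda>e :: xvar \<Rightarrow>\<^sub>0 nat. (Poly_Mapping.lookup e X1, Poly_Mapping.lookup e X2,
    Poly_Mapping.lookup e X3, Poly_Mapping.lookup e X4, Poly_Mapping.lookup e X5)"
  have "?f ` low_exponents \<subseteq> {..3} \<times> {..3} \<times> {..3} \<times> {..3} \<times> {..3}"
    by (auto simp: low_exponents_def deg_def)
  thus "finite (?f ` low_exponents)" by (rule finite_subset) simp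
  show "inj_on ?f low_exponents"
  proof (rule inj_onI)
    fix e e' assume "?f e = ?f e'"
    hence "Poly_Mapping.lookup e i = Poly_Mapping.lookup e' i" for i by (cases i) auto
    thus "e = e'" by (rule poly_mapping_eqI)
  qed
qed

text \<open>
  A power series in \<open>t\<close> over \<open>S\<close> is read here as a power series in the variables \<open>x\<^sub>i\<close> over \<open>k[[t]]\<close>.
\<close>

definition coeff_series :: "(xvar \<Rightarrow>\<^sub>0 nat) \<Rightarrow> 'k::field S fps \<Rightarrow> 'k fps" where
  "coeff_series e f = Abs_fps (\<lambda>n. mps_coeff (fps_nth f n) e)"

lemma coeff_series_add: "coeff_series e (f + g) = coeff_series e f + coeff_series e g"
  by (simp add: coeff_series_def fps_eq_iff mps_coeff_simps)

lemma mps_coeff_mult: "mps_coeff (f * g) e = (\<Sum>(a, b) | a + b = e. mps_coeff f a * mps_coeff g b)"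
  by (simp add: times_mps_def)

lemma coeff_series_mult:
  "coeff_series e (f * g) = (\<Sum>(a, b) | a + b = e. coeff_series a f * coeff_series b g)"
proof (rule fps_ext)
  fix n
  have "fps_nth (coeff_series e (f * g)) n =
      (\<Sum>i=0..n. \<Sum>(a, b) | a + b = e. mps_coeff (fps_nth f i) a * mps_coeff (fps_nth g (n - i)) b)"
    by (simp add: coeff_series_def fps_mult_nth mps_coeff_sum mps_coeff_mult)
  also have "\<dots> = (\<Sum>(a, b) | a + b = e. \<Sum>i=0..n. mps_coeff (fps_nth f i) a * mps_coeff (fps_nth g (n - i)) b)"
    by (subst sum.swap) (simp add: case_prod_unfold)
  also have "\<dots> = fps_nth (\<Sum>(a, b) | a + b = e. coeff_series a f * coeff_series b g) n"
    by (simp add: coeff_series_def fps_mult_nth fps_sum_nth case_prod_unfold)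
  finally show "fps_nth (coeff_series e (f * g)) n =
    fps_nth (\<Sum>(a, b) | a + b = e. coeff_series a f * coeff_series b g) n" .
qed

definition to_alg :: "'k::field S fps \<Rightarrow> 'k fls alg" where
  "to_alg f = (\<Sum>e\<in>low_exponents. scalar (fps_to_fls (coeff_series e f)) * mon e)"

lemma to_alg_add: "to_alg (f + g) = to_alg f + to_alg g"
  by (simp add: to_alg_def coeff_series_add scalar_hom distrib_right sum.distrib)

lemma fps_to_fls_sum: "fps_to_fls (sum f A) = (\<Sum>x\<in>A. fps_to_fls (f x :: 'k::field fps))"
  by (induction A rule: infinite_finite_induct) simp_all

text \<open>
  The product formula for coefficients turns \<open>to_alg (f * g)\<close> into a sum over pairs of exponents
  with sum of degree at most three.  The remaining pairs of low exponents may be added, because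
  their monomials multiply to zero; the result is the product of the two sums.
\<close>

lemma to_alg_mult: "to_alg (f * g) = to_alg f * to_alg g"
proof -
  let ?c = "\<lambda>e f. scalar (fps_to_fls (coeff_series e f)) * mon e :: 'a fls alg"
  let ?h = "\<lambda>(a, b). ?c a f * ?c b g"
  let ?E = low_exponents
  let ?P = "{(a, b). a + b \<in> ?E}"
  have sub: "?P \<subseteq> ?E \<times> ?E" by (auto simp: low_exponents_def deg_add)
  have fin: "finite ?P" using finite_low_exponents by (intro finite_subset [OF sub]) simp
  have "to_alg (f * g) = (\<Sum>e\<in>?E. \<Sum>(a, b) | a + b = e. ?c a f * ?c b g)"
    unfolding to_alg_def
  proof (rule sum.cong)
    fix e
    have "scalar (fps_to_fls (coeff_series e (f * g))) * mon e =
        (\<Sum>(a, b) | a + b = e. scalar (fps_to_fls (coeff_series a f * coeff_series b g)) * mon e)"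
      by (simp add: coeff_series_mult fps_to_fls_sum scalar_sum sum_distrib_right case_prod_unfold)
    also have "\<dots> = (\<Sum>(a, b) | a + b = e. ?c a f * ?c b g)"
      by (rule sum.cong) (auto simp: fls_times_fps_to_fls scalar_hom mon_add ac_simps)
    finally show "?c e (f * g) = (\<Sum>(a, b) | a + b = e. ?c a f * ?c b g)" .
  qed simp
  also have "\<dots> = (\<Sum>e\<in>?E. \<Sum>x | x \<in> ?P \<and> fst x + snd x = e. ?h x)"
    by (rule sum.cong [OF refl], rule sum.cong) auto
  also have "\<dots> = sum ?h ?P"
    by (rule sum.group [OF fin finite_low_exponents]) auto
  also have "\<dots> = sum ?h (?E \<times> ?E)"
  proof (rule sum.mono_neutral_left)
    show "finite (?E \<times> ?E)" using finite_low_exponents by simp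
    show "\<forall>x\<in>?E \<times> ?E - ?P. ?h x = 0"
    proof
      fix x assume x: "x \<in> ?E \<times> ?E - ?P"
      obtain a b where ab: "x = (a, b)" by (cases x)
      have "mon a * mon b = (0 :: 'a fls alg)"
        using x ab mon_eq_0 [of "a + b"] by (auto simp: low_exponents_def simp flip: mon_add)
      moreover have "?h x = scalar (fps_to_fls (coeff_series a f)) * scalar (fps_to_fls (coeff_series b g)) * (mon a * mon b)"
        by (simp add: ab ac_simps)
      ultimately show "?h x = 0" by simp
    qed
  qed (rule sub)
  also have "\<dots> = to_alg f * to_alg g"
    by (simp add: to_alg_def sum_product sum.cartesian_product)
  finally show ?thesis .
qed

text \<open>
  The inclusion of \<open>k[[t]]\<close>.
\<close>

definition emb :: "'k::field fps \<Rightarrow> 'k S fps" where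
  "emb c = Abs_fps (\<lambda>n. Abs_mps (\<lambda>e. if e = 0 then fps_nth c n else 0))"

lemma emb_X: "emb fps_X = fps_X"
  by (auto simp: emb_def fps_eq_iff fps_X_def one_mps_def zero_mps_def fun_eq_iff Abs_mps_inject)

lemma coeff_series_emb: "coeff_series e (emb c) = (if e = 0 then c else 0)"
  by (simp add: coeff_series_def emb_def fps_eq_iff)

lemma coeff_series_x_elem: "coeff_series e (x_elem i) = (if e = Poly_Mapping.single i 1 then 1 else 0)"
  by (auto simp: coeff_series_def x_elem_def mps_var_def fps_eq_iff mps_coeff_simps)

lemma St_eqI: "(\<And>e. coeff_series e f = coeff_series e g) \<Longrightarrow> f = g"
  by (auto simp: coeff_series_def fps_eq_iff intro!: mps_eqI)

lemma emb_add: "emb (c + d) = emb c + emb d"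
  by (rule St_eqI) (simp add: coeff_series_emb coeff_series_add)

lemma emb_mult: "emb (c * d) = emb c * emb d"
proof (rule St_eqI)
  fix e
  have "coeff_series e (emb c * emb d) = (\<Sum>(a, b) | a + b = e. if a = 0 then c * coeff_series b (emb d) else 0)"
    unfolding coeff_series_mult by (rule sum.cong) (auto simp: coeff_series_emb)
  also have "\<dots> = c * coeff_series e (emb d)" by (rule sum_splittings_single) simp
  finally show "coeff_series e (emb (c * d)) = coeff_series e (emb c * emb d)" by (simp add: coeff_series_emb)
qed

lemma emb_1: "emb 1 = 1"
  by (rule St_eqI, simp only: coeff_series_emb) (auto simp: coeff_series_def fps_eq_iff mps_coeff_simps)

lemma emb_0: "emb 0 = 0"
  using emb_add [of 0 0] by simp

lemma emb_minus: "emb (- c) = - emb c"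
  using emb_add [of c "- c"] by (simp add: emb_0 eq_neg_iff_add_eq_0 add.commute)

lemma mon_0: "mon 0 = 1"
  by (simp add: mon_def)

lemma mon_single: "mon (Poly_Mapping.single i 1) = xv i"
  by (cases i) (simp_all add: mon_def lookup_single)

lemma to_alg_emb: "to_alg (emb c) = scalar (fps_to_fls c)"
proof -
  have "to_alg (emb c) = (\<Sum>e\<in>low_exponents. if e = 0 then scalar (fps_to_fls c) else 0)"
    unfolding to_alg_def by (rule sum.cong) (auto simp: coeff_series_emb scalar_hom mon_0)
  also have "\<dots> = scalar (fps_to_fls c)"
    using finite_low_exponents by (simp add: low_exponents_def deg_def)
  finally show ?thesis .
qed

lemma to_alg_x_elem: "to_alg (x_elem i) = xv i"
proof -
  have "to_alg (x_elem i) = (\<Sum>e\<in>low_exponents. if e = Poly_Mapping.single i 1 then xv i else 0)"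
    unfolding to_alg_def
    by (rule sum.cong) (auto simp: coeff_series_x_elem scalar_hom mon_single simp del: One_nat_def)
  also have "\<dots> = xv i"
    using finite_low_exponents
    by (cases i) (simp_all add: low_exponents_def deg_def lookup_single)
  finally show ?thesis .
qed

lemma to_alg_0: "to_alg 0 = 0" and to_alg_1: "to_alg 1 = 1"
  using to_alg_emb [of 0] to_alg_emb [of 1] by (simp_all add: emb_0 emb_1 scalar_hom)

lemma to_alg_minus: "to_alg (- f) = - to_alg f"
  using to_alg_add [of f "- f"] by (simp add: to_alg_0 eq_neg_iff_add_eq_0 add.commute)

lemma to_alg_diff: "to_alg (f - g) = to_alg f - to_alg g"
  using to_alg_add [of f "- g"] by (simp add: to_alg_minus)

lemma to_alg_X: "to_alg fps_X = scalar fls_X"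
  using to_alg_emb [of fps_X] by (simp add: emb_X)

text \<open>
  The residue class of \<open>to_alg f\<close> is the reduction of \<open>f\<close> modulo the variables, which decides
  whether \<open>f\<close> belongs to the prime ideal.
\<close>

lemma a0_to_alg: "a0 (to_alg f) = fps_to_fls (red_x f)"
proof -
  have a0_sum: "a0 (sum h A) = (\<Sum>x\<in>A. a0 (h x))" for h :: "(xvar \<Rightarrow>\<^sub>0 nat) \<Rightarrow> 'a fls alg" and A
    by (induction A rule: infinite_finite_induct) simp_all
  have mon: "a0 (mon e :: 'a fls alg) = (if e = 0 then 1 else 0)" for e
  proof (cases "e = 0")
    case False
    then obtain i where "Poly_Mapping.lookup e i \<noteq> 0" by (metis lookup_zero poly_mapping_eqI)
    hence "deg e \<ge> 1" by (cases i) (auto simp: deg_def)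
    moreover have "alg_max_power (deg e) (mon e :: 'a fls alg)" by (rule alg_max_power_mon)
    ultimately show ?thesis using False by (simp add: alg_max_power_def)
  qed (simp add: mon_0 one_alg_def)
  have "a0 (to_alg f) = (\<Sum>e\<in>low_exponents. if e = 0 then fps_to_fls (coeff_series 0 f) else 0)"
    unfolding to_alg_def a0_sum by (rule sum.cong) (auto simp: scalar_mult mon)
  also have "\<dots> = fps_to_fls (red_x f)"
    using finite_low_exponents by (simp add: low_exponents_def deg_def coeff_series_def red_x_def)
  finally show ?thesis .
qed


section \<open>The kernel is the ideal of relations\<close>

abbreviation one_plus_t :: "'k::field S fps" where "one_plus_t \<equiv> 1 + fps_X"

lemma ideal_I_add: "f \<in> ideal_I \<Longrightarrow> g \<in> ideal_I \<Longrightarrow> f + g \<in> ideal_I"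
  using additive_subgroup.a_closed [OF ideal.axioms(1) [OF ideal_ideal_I]] by fastforce

lemma ideal_I_mult: "f \<in> ideal_I \<Longrightarrow> g * f \<in> ideal_I"
  using ideal.I_l_closed [OF ideal_ideal_I] by fastforce

lemma ideal_I_0: "0 \<in> ideal_I"
  using additive_subgroup.zero_closed [OF ideal.axioms(1) [OF ideal_ideal_I]] by fastforce

lemma ideal_I_minus: "f \<in> ideal_I \<Longrightarrow> - f \<in> ideal_I"
  using ideal_I_mult [of f "- 1"] by simp

lemma ideal_I_diff: "f \<in> ideal_I \<Longrightarrow> g \<in> ideal_I \<Longrightarrow> f - g \<in> ideal_I"
  using ideal_I_add [of f "- g"] ideal_I_minus [of g] by simp

lemma ideal_I_relations:
  fixes x :: "xvar \<Rightarrow> 'k::field S fps"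
  defines "x \<equiv> x_elem"
  shows "one_plus_t * x X1 * x X3 + x X2 * x X3 \<in> ideal_I"
    and "x X1 * x X4 + x X2 * x X4 \<in> ideal_I"
    and "x X3 * x X3 + one_plus_t * x X1 * x X5 - x X2 * x X5 \<in> ideal_I"
    and "x X4 * x X4 + x X1 * x X5 - x X2 * x X5 \<in> ideal_I"
    and "x X1 * x X1 \<in> ideal_I" and "x X2 * x X2 \<in> ideal_I" and "x X3 * x X4 \<in> ideal_I"
    and "x X3 * x X5 \<in> ideal_I" and "x X4 * x X5 \<in> ideal_I" and "x X5 * x X5 \<in> ideal_I"
proof -
  interpret cring "St :: 'k S fps ring" by (rule cring_St)
  have "insert (one_plus_t * x X1 * x X3 + x X2 * x X3) {x X1 * x X4 + x X2 * x X4,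
        x X3 * x X3 + one_plus_t * x X1 * x X5 - x X2 * x X5,
        x X4 * x X4 + x X1 * x X5 - x X2 * x X5,
        x X1 * x X1, x X2 * x X2, x X3 * x X4, x X3 * x X5, x X4 * x X5, x X5 * x X5} \<subseteq> ideal_I"
    unfolding ideal_I_def Let_def x_def power2_eq_square by (rule genideal_self) simp
  thus "one_plus_t * x X1 * x X3 + x X2 * x X3 \<in> ideal_I" "x X1 * x X4 + x X2 * x X4 \<in> ideal_I"
    "x X3 * x X3 + one_plus_t * x X1 * x X5 - x X2 * x X5 \<in> ideal_I"
    "x X4 * x X4 + x X1 * x X5 - x X2 * x X5 \<in> ideal_I"
    "x X1 * x X1 \<in> ideal_I" "x X2 * x X2 \<in> ideal_I" "x X3 * x X4 \<in> ideal_I"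
    "x X3 * x X5 \<in> ideal_I" "x X4 * x X5 \<in> ideal_I" "x X5 * x X5 \<in> ideal_I"
    by auto
qed

lemma to_alg_ideal_I: "f \<in> ideal_I \<Longrightarrow> to_alg f = 0"
proof -
  interpret St: cring "St :: 'a S fps ring" by (rule cring_St)
  have neg: "\<ominus>\<^bsub>St\<^esub> f = - f" for f :: "'a S fps"
    by (rule St.minus_equality) auto
  have "ideal {f :: 'a S fps. to_alg f = 0} St"
  proof (rule idealI [OF St.ring_axioms])
    show "subgroup {f :: 'a S fps. to_alg f = 0} (add_monoid St)"
      by (rule St.add.subgroupI)
         (auto simp: to_alg_0 to_alg_add to_alg_minus neg intro!: exI [of _ 0] simp flip: a_inv_def)
  qed (auto simp: to_alg_mult)
  hence "ideal_I \<subseteq> {f :: 'a S fps. to_alg f = 0}"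
    unfolding ideal_I_def Let_def power2_eq_square
    by (rule St.genideal_minimal)
       (simp add: to_alg_add to_alg_diff to_alg_mult to_alg_1 to_alg_X to_alg_x_elem
          xv_mult xv_sel distrib_right alpha_fls_def scalar_mult plus_alg_def minus_alg_def
          zero_alg_def mult.assoc)
  thus "f \<in> ideal_I \<Longrightarrow> to_alg f = 0" by blast
qed

text \<open>
  The twelve basis monomials, paired with their degrees.  \<open>normal_forms d\<close> is the \<open>k[[t]]\<close>-module
  spanned by the ideal and by the basis monomials of degree at least \<open>d\<close>; the aim is to show that
  \<open>normal_forms 0\<close> is everything, so that each series is determined modulo the ideal by its image in
  the algebra.
\<close>

definition basis :: "(nat \<times> 'k::field S fps) set" where
  "basis = (let x1 = x_elem X1; x2 = x_elem X2; x3 = x_elem X3; x4 = x_elem X4; x5 = x_elem X5 in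
     {(0, 1), (1, x1), (1, x2), (1, x3), (1, x4), (1, x5),
      (2, x1 * x2), (2, x1 * x3), (2, x1 * x4), (2, x1 * x5), (2, x2 * x5), (3, x1 * x2 * x5)})"

inductive_set normal_forms :: "nat \<Rightarrow> 'k::field S fps set" for d where
  relation: "f \<in> ideal_I \<Longrightarrow> f \<in> normal_forms d"
| basis: "(n, m) \<in> basis \<Longrightarrow> d \<le> n \<Longrightarrow> emb c * m \<in> normal_forms d"
| add: "f \<in> normal_forms d \<Longrightarrow> g \<in> normal_forms d \<Longrightarrow> f + g \<in> normal_forms d"

lemma normal_forms_scale: "f \<in> normal_forms d \<Longrightarrow> emb c * f \<in> normal_forms d"
proof (induction f rule: normal_forms.induct)
  case (basis n m c')
  from normal_forms.basis [OF basis, of "c * c'"] show ?case by (simp add: emb_mult mult.assoc)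
qed (auto simp: distrib_left intro: normal_forms.relation normal_forms.add ideal_I_mult)

lemma normal_forms_mono: "f \<in> normal_forms d' \<Longrightarrow> d \<le> d' \<Longrightarrow> f \<in> normal_forms d"
  by (induction f rule: normal_forms.induct) (auto intro: normal_forms.intros)

lemma normal_forms_relation_diff:
  assumes "f - g \<in> ideal_I" "g \<in> normal_forms d"
  shows "f \<in> normal_forms d"
  using normal_forms.add [OF normal_forms.relation [OF assms(1)] assms(2)] by simp

lemma normal_forms_uminus: "f \<in> normal_forms d \<Longrightarrow> - f \<in> normal_forms d"
  using normal_forms_scale [of f d "- 1"] by (simp add: emb_minus emb_1)

lemma normal_forms_t1: "f \<in> normal_forms d \<Longrightarrow> one_plus_t * f \<in> normal_forms d"
  using normal_forms_scale [of f d "1 + fps_X"] by (simp add: emb_add emb_1 emb_X)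

text \<open>
  This is the multiplication table of the algebra, derived from the given relations alone.  For
  products of three variables, one of which is \<open>x\<^sub>1\<close>, the relation for the product of the other two
  is multiplied by \<open>x\<^sub>1\<close>, and the terms with \<open>x\<^sub>1\<^sup>2\<close> are removed.
\<close>

lemma x_elem_basis:
  assumes "(n, m) \<in> (basis :: (nat \<times> 'k::field S fps) set)"
  shows "x_elem i * m \<in> normal_forms (Suc n)"
proof -
  define x :: "xvar \<Rightarrow> 'k S fps" where "x = x_elem"
  note rel = ideal_I_relations [where 'k = 'k, folded x_def]
  have b: "(2, x X1 * x X2) \<in> basis" "(2, x X1 * x X3) \<in> basis" "(2, x X1 * x X4) \<in> basis"
    "(2, x X1 * x X5) \<in> basis" "(2, x X2 * x X5) \<in> basis" "(3, x X1 * x X2 * x X5) \<in> basis"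
    "\<And>i. (1, x i) \<in> basis"
  proof -
    show "(1, x i) \<in> basis" for i by (cases i) (simp_all add: basis_def Let_def x_def)
  qed (simp_all add: basis_def Let_def x_def)
  note nf = normal_forms.basis [where c = 1, simplified emb_1 mult_1]
  have 1: "x i \<in> normal_forms 1" for i using nf [OF b(7) order.refl] .
  have 2: "x X1 * x X2 \<in> normal_forms 2" "x X1 * x X3 \<in> normal_forms 2" "x X1 * x X4 \<in> normal_forms 2"
    "x X1 * x X5 \<in> normal_forms 2" "x X2 * x X5 \<in> normal_forms 2"
    by (rule nf [OF b(1) order.refl] nf [OF b(2) order.refl] nf [OF b(3) order.refl] nf [OF b(4) order.refl]
        nf [OF b(5) order.refl])+
  have w: "x X1 * x X2 * x X5 \<in> normal_forms 3" by (rule nf [OF b(6) order.refl])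
  have relI: "g \<in> normal_forms d" if "f \<in> ideal_I" "g = h * f" for f g h :: "'k S fps" and d
    using that by (simp add: normal_forms.relation ideal_I_mult)
  note arith = normal_forms.add normal_forms_uminus normal_forms_t1
  \<comment> \<open>Stating the two tables by symmetric predicates halves the number of cases.\<close>
  define Q where "Q = (\<lambda>i j. x i * x j \<in> normal_forms 2)"
  have Q_sym: "Q i j \<Longrightarrow> Q j i" for i j by (simp only: Q_def mult.commute)
  have Q: "Q X1 X1" "Q X2 X2" "Q X3 X4" "Q X3 X5" "Q X4 X5" "Q X5 X5"
    "Q X1 X2" "Q X1 X3" "Q X1 X4" "Q X1 X5" "Q X2 X5"
    unfolding Q_def by (rule normal_forms.relation rel 2)+
  have "Q X2 X3"
    unfolding Q_def
    by (rule normal_forms_relation_diff [where g = "- (one_plus_t * (x X1 * x X3))"])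
       (use rel(1) in \<open>simp add: algebra_simps\<close>, intro arith 2)
  moreover have "Q X2 X4"
    unfolding Q_def
    by (rule normal_forms_relation_diff [where g = "- (x X1 * x X4)"])
       (use rel(2) in \<open>simp add: algebra_simps\<close>, intro arith 2)
  moreover have "Q X3 X3"
    unfolding Q_def
    by (rule normal_forms_relation_diff [where g = "- (one_plus_t * (x X1 * x X5)) + x X2 * x X5"])
       (use rel(3) in \<open>simp add: algebra_simps\<close>, intro arith 2)
  moreover have "Q X4 X4"
    unfolding Q_def
    by (rule normal_forms_relation_diff [where g = "- (x X1 * x X5) + x X2 * x X5"])
       (use rel(4) in \<open>simp add: algebra_simps\<close>, intro arith 2)
  ultimately have "Q i j" for i j
    using Q Q [THEN Q_sym] Q_sym [of X2 X3] Q_sym [of X2 X4] by (cases i; cases j; simp only:)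
  hence quadratic: "x i * x j \<in> normal_forms 2" for i j by (simp add: Q_def)
  \<comment> \<open>All cubic monomials in question contain \<open>x\<^sub>1\<close> except \<open>x\<^sub>i x\<^sub>2 x\<^sub>5\<close>, which is treated below.\<close>
  define C where "C = (\<lambda>i j. x X1 * (x i * x j) \<in> normal_forms 3)"
  have C_sym: "C i j \<Longrightarrow> C j i" for i j by (simp only: C_def mult.commute [of "x i" "x j"])
  have "C X1 j" for j
    unfolding C_def by (rule relI [OF rel(5), where h = "x j"]) (simp add: algebra_simps)
  moreover have "C X2 X2" unfolding C_def by (rule relI [OF rel(6) refl])
  moreover have "C X3 X4" unfolding C_def by (rule relI [OF rel(7) refl])
  moreover have "C X3 X5" unfolding C_def by (rule relI [OF rel(8) refl])
  moreover have "C X4 X5" unfolding C_def by (rule relI [OF rel(9) refl])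
  moreover have "C X5 X5" unfolding C_def by (rule relI [OF rel(10) refl])
  moreover have "C X2 X5" unfolding C_def using w by (simp only: mult.assoc)
  moreover have "C X2 X3"
    unfolding C_def
    by (rule relI [OF ideal_I_diff [OF ideal_I_mult [OF rel(1), of "x X1"]
            ideal_I_mult [OF rel(5), of "one_plus_t * x X3"]], where h = 1])
       (simp add: algebra_simps)
  moreover have "C X2 X4"
    unfolding C_def
    by (rule relI [OF ideal_I_diff [OF ideal_I_mult [OF rel(2), of "x X1"]
            ideal_I_mult [OF rel(5), of "x X4"]], where h = 1])
       (simp add: algebra_simps)
  moreover have "C X3 X3"
    unfolding C_def
    by (rule normal_forms_relation_diff [where g = "x X1 * x X2 * x X5"])
       (use ideal_I_diff [OF ideal_I_mult [OF rel(3), of "x X1"] ideal_I_mult [OF rel(5), of "one_plus_t * x X5"]]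
        in \<open>simp add: algebra_simps\<close>, rule w)
  moreover have "C X4 X4"
    unfolding C_def
    by (rule normal_forms_relation_diff [where g = "x X1 * x X2 * x X5"])
       (use ideal_I_diff [OF ideal_I_mult [OF rel(4), of "x X1"] ideal_I_mult [OF rel(5), of "x X5"]]
        in \<open>simp add: algebra_simps\<close>, rule w)
  ultimately have "C i j" for i j
    using C_sym [of X1] C_sym [of X2] C_sym [of X3] C_sym [of X4] C_sym [of X5]
    by (cases i; cases j; simp only:)
  hence cubic: "x i * (x X1 * x j) \<in> normal_forms 3" for i j
    by (subst mult.left_commute) (simp only: C_def)
  have cubic': "x i * (x X2 * x X5) \<in> normal_forms 3" for i
  proof (cases i)
    case X1
    show ?thesis unfolding X1 using w by (simp only: mult.assoc)
  next
    case X2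
    show ?thesis unfolding X2 by (rule relI [OF rel(6), where h = "x X5"]) (simp add: algebra_simps)
  next
    case X3
    show ?thesis unfolding X3 by (rule relI [OF rel(8), where h = "x X2"]) (simp add: algebra_simps)
  next
    case X4
    show ?thesis unfolding X4 by (rule relI [OF rel(9), where h = "x X2"]) (simp add: algebra_simps)
  next
    case X5
    show ?thesis unfolding X5 by (rule relI [OF rel(10), where h = "x X2"]) (simp add: algebra_simps)
  qed
  have quartic: "x i * (x X1 * x X2 * x X5) \<in> normal_forms 4" for i
  proof (cases i)
    case X1
    show ?thesis unfolding X1 by (rule relI [OF rel(5), where h = "x X2 * x X5"]) (simp add: algebra_simps)
  next
    case X2
    show ?thesis unfolding X2 by (rule relI [OF rel(6), where h = "x X1 * x X5"]) (simp add: algebra_simps)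
  next
    case X3
    show ?thesis unfolding X3 by (rule relI [OF rel(8), where h = "x X1 * x X2"]) (simp add: algebra_simps)
  next
    case X4
    show ?thesis unfolding X4 by (rule relI [OF rel(9), where h = "x X1 * x X2"]) (simp add: algebra_simps)
  next
    case X5
    show ?thesis unfolding X5 by (rule relI [OF rel(10), where h = "x X1 * x X2"]) (simp add: algebra_simps)
  qed
  have "(n, m) = (0, 1) \<or> (\<exists>j. (n, m) = (1, x j)) \<or> (\<exists>j. (n, m) = (2, x X1 * x j)) \<or>
      (n, m) = (2, x X2 * x X5) \<or> (n, m) = (3, x X1 * x X2 * x X5)"
    using assms unfolding basis_def Let_def x_def [symmetric] by blast
  thus ?thesis
    unfolding x_def [symmetric] using 1 quadratic cubic cubic' quartic by (auto simp: numeral_eq_Suc)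
qed

lemma x_elem_normal_forms: "f \<in> normal_forms d \<Longrightarrow> x_elem i * f \<in> normal_forms (Suc d)"
proof (induction f rule: normal_forms.induct)
  case (relation f)
  thus ?case by (intro normal_forms.relation ideal_I_mult)
next
  case (basis n m c)
  have "x_elem i * m \<in> normal_forms (Suc d)"
    using x_elem_basis [OF basis(1)] by (rule normal_forms_mono) (use basis(2) in simp)
  from normal_forms_scale [OF this, of c] show ?case by (simp add: ac_simps)
next
  case (add f g)
  thus ?case by (simp add: distrib_left normal_forms.add)
qed

lemma normal_forms_4: "f \<in> normal_forms 4 \<Longrightarrow> f \<in> ideal_I"
  by (induction f rule: normal_forms.induct) (auto simp: basis_def Let_def intro: ideal_I_add)

lemma series_decompose:
  "\<exists>c g. f = emb c + (\<Sum>i\<in>{X1, X2, X3, X4, X5}. x_elem i * g i)"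
proof -
  have "red_x (f - emb (red_x f)) = 0"
    by (simp add: red_x_diff) (simp add: red_x_def emb_def fps_eq_iff)
  then obtain g where "f - emb (red_x f) = (\<Sum>i\<in>{X1, X2, X3, X4, X5}. x_elem i * g i)"
    using red_x_decompose by blast
  thus ?thesis by (intro exI [where x = "red_x f"] exI [where x = g]) (simp add: algebra_simps)
qed

text \<open>
  A power series is an element of \<open>k[[t]]\<close> plus a combination of the variables, and multiplication
  by a variable raises \<open>d\<close>.  Descending induction can start at \<open>d = 4\<close>, because
  \<open>normal_forms 4\<close> is the ideal itself.
\<close>

lemma mult_normal_forms: "d \<le> 4 \<Longrightarrow> u \<in> normal_forms d \<Longrightarrow> f * u \<in> normal_forms d"
proof (induction arbitrary: u f rule: inc_induct)
  case base
  thus ?case by (rule normal_forms.relation [OF ideal_I_mult [OF normal_forms_4]])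
next
  case (step d)
  obtain c g where f: "f = emb c + (\<Sum>i\<in>{X1, X2, X3, X4, X5}. x_elem i * g i)"
    using series_decompose by blast
  have "g i * (x_elem i * u) \<in> normal_forms d" for i
    using step.IH [OF x_elem_normal_forms [OF step.prems]] by (rule normal_forms_mono) simp
  hence "emb c * u + (g X1 * (x_elem X1 * u) + (g X2 * (x_elem X2 * u) + (g X3 * (x_elem X3 * u) +
      (g X4 * (x_elem X4 * u) + g X5 * (x_elem X5 * u))))) \<in> normal_forms d"
    by (intro normal_forms.add normal_forms_scale step.prems)
  thus ?case by (simp add: f algebra_simps)
qed

lemma all_normal_forms: "f \<in> normal_forms 0"
proof -
  have "emb 1 * 1 \<in> normal_forms 0"
    by (rule normal_forms.basis [where n = 0]) (simp_all add: basis_def Let_def)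
  from mult_normal_forms [OF _ this, of f] show ?thesis by (simp add: emb_1)
qed

definition series_of :: "'k::field fps alg \<Rightarrow> 'k S fps" where
  "series_of b = (let x1 = x_elem X1; x2 = x_elem X2; x3 = x_elem X3; x4 = x_elem X4; x5 = x_elem X5 in
     emb (a0 b) + emb (a1 b) * x1 + emb (a2 b) * x2 + emb (a3 b) * x3 + emb (a4 b) * x4 +
     emb (a5 b) * x5 + emb (a12 b) * (x1 * x2) + emb (a13 b) * (x1 * x3) + emb (a14 b) * (x1 * x4) +
     emb (a15 b) * (x1 * x5) + emb (a25 b) * (x2 * x5) + emb (aw b) * (x1 * x2 * x5))"

lemma to_alg_series_of: "to_alg (series_of b) = map_alg fps_to_fls b"
  by (cases b)
     (simp add: series_of_def Let_def to_alg_add to_alg_mult to_alg_emb to_alg_x_elem xv_mult xv_sel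
        scalar_mult plus_alg_def mult.assoc, simp add: scalar_def)

lemma ex_normal_form: "\<exists>b. f - series_of b \<in> ideal_I"
  using all_normal_forms [of f]
proof (induction f rule: normal_forms.induct)
  case (relation f)
  thus ?case
    by (intro exI [where x = "Alg 0 0 0 0 0 0 0 0 0 0 0 0"]) (simp add: series_of_def Let_def emb_0)
next
  case (basis n m c)
  \<comment> \<open>The vector with the coordinate \<open>c\<close> at the position of the basis monomial \<open>m\<close> is the witness.\<close>
  define e where "e = (\<lambda>i j :: nat. if i = j then c else (0 :: 'a fps))"
  have "emb c * m - series_of (Alg (e 0 i) (e 1 i) (e 2 i) (e 3 i) (e 4 i) (e 5 i) (e 6 i) (e 7 i) (e 8 i)
      (e 9 i) (e 10 i) (e 11 i)) = 0"
    if "m = [1, x_elem X1, x_elem X2, x_elem X3, x_elem X4, x_elem X5, x_elem X1 * x_elem X2,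
      x_elem X1 * x_elem X3, x_elem X1 * x_elem X4, x_elem X1 * x_elem X5, x_elem X2 * x_elem X5,
      x_elem X1 * x_elem X2 * x_elem X5] ! i" "i \<in> {0,1,2,3,4,5,6,7,8,9,10,11}" for i
    using that by (elim insertE emptyE) (simp_all add: series_of_def Let_def emb_0 e_def)
  note single = this
  have "\<exists>i\<in>{0,1,2,3,4,5,6,7,8,9,10,11::nat}. m = [1, x_elem X1, x_elem X2, x_elem X3, x_elem X4, x_elem X5, x_elem X1 * x_elem X2,
      x_elem X1 * x_elem X3, x_elem X1 * x_elem X4, x_elem X1 * x_elem X5, x_elem X2 * x_elem X5,
      x_elem X1 * x_elem X2 * x_elem X5] ! i"
    using basis(1) by (auto simp: basis_def Let_def)
  thus ?case using single ideal_I_0 by metis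
next
  case (add f g)
  then obtain b c where b: "f - series_of b \<in> ideal_I" and c: "g - series_of c \<in> ideal_I" by blast
  define bc where "bc = Alg (a0 b + a0 c) (a1 b + a1 c) (a2 b + a2 c) (a3 b + a3 c) (a4 b + a4 c)
    (a5 b + a5 c) (a12 b + a12 c) (a13 b + a13 c) (a14 b + a14 c) (a15 b + a15 c) (a25 b + a25 c) (aw b + aw c)"
  have "series_of bc = series_of b + series_of c"
    by (simp add: bc_def series_of_def Let_def emb_add algebra_simps)
  hence "f + g - series_of bc = (f - series_of b) + (g - series_of c)" by simp
  also have "\<dots> \<in> ideal_I" using b c by (rule ideal_I_add)
  finally show ?case by blast
qed

text \<open>
  A series in the kernel is congruent to a combination of the basis monomials, whose coefficients
  are the coordinates of its image and hence zero.
\<close>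

lemma to_alg_eq_0_iff: "to_alg f = 0 \<longleftrightarrow> f \<in> ideal_I"
proof
  assume f: "to_alg f = 0"
  obtain b where b: "f - series_of b \<in> ideal_I" using ex_normal_form by blast
  have "map_alg fps_to_fls b = 0"
    using to_alg_ideal_I [OF b] f by (simp add: to_alg_diff to_alg_series_of)
  hence "series_of b = 0"
    by (cases b) (simp add: series_of_def Let_def zero_alg_def emb_0)
  thus "f \<in> ideal_I" using b by simp
qed (rule to_alg_ideal_I)


section \<open>Rings given by a type, and localizations\<close>

text \<open>
  A ring with carrier that is isomorphic to a ring given as a type.  Computations in the former are
  done in the latter, where they need no membership assumptions.
\<close>

locale ring_copy =
  fixes A :: "'a ring" and \<iota> :: "'b::comm_ring_1 \<Rightarrow> 'a"
  assumes bij: "bij_betw \<iota> UNIV (carrier A)"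
    and plus: "\<iota> (b + c) = \<iota> b \<oplus>\<^bsub>A\<^esub> \<iota> c"
    and times: "\<iota> (b * c) = \<iota> b \<otimes>\<^bsub>A\<^esub> \<iota> c"
    and one: "\<iota> 1 = \<one>\<^bsub>A\<^esub>"
    and zero: "\<iota> 0 = \<zero>\<^bsub>A\<^esub>"
begin

lemma closed [simp]: "\<iota> b \<in> carrier A"
  using bij by (auto simp: bij_betw_def)

lemma inject [simp]: "\<iota> b = \<iota> c \<longleftrightarrow> b = c"
  using bij by (auto simp: bij_betw_def inj_def)

lemma elim:
  assumes "a \<in> carrier A" obtains b where "a = \<iota> b"
  using assms bij by (auto simp: bij_betw_def)

lemma is_cring: "cring A"
proof (rule cringI)
  show "abelian_group A"
  proof (rule abelian_groupI)
    fix x assume "x \<in> carrier A"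
    then obtain b where b: "x = \<iota> b" by (rule elim)
    show "\<exists>y\<in>carrier A. y \<oplus>\<^bsub>A\<^esub> x = \<zero>\<^bsub>A\<^esub>"
      by (rule bexI [where x = "\<iota> (- b)"]) (simp_all add: b flip: plus zero)
  qed (auto elim!: elim simp: ac_simps simp flip: plus zero)
  show "Group.comm_monoid A"
    by (rule comm_monoidI) (auto elim!: elim simp: ac_simps simp flip: times one)
qed (auto elim!: elim simp: algebra_simps simp flip: plus times)

end

lemma UN_pair_const:
  assumes "p \<in> U" "q \<in> V" and F: "\<And>a s b t. (a, s) \<in> U \<Longrightarrow> (b, t) \<in> V \<Longrightarrow> F a s b t = W"
  shows "(\<Union>(a, s)\<in>U. \<Union>(b, t)\<in>V. F a s b t) = W"
proof -
  have "(\<Union>(b, t)\<in>V. F a s b t) = W" if "(a, s) \<in> U" for a s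
    using F [OF that] assms(2) by force
  thus ?thesis using assms(1) by force
qed

text \<open>
  If \<open>h\<close> is injective, makes \<open>S\<close> invertible, and every \<open>b\<close> is of the form \<open>h a / h s\<close>, then the
  class of the fraction \<open>(a, s)\<close> consists exactly of the pairs with quotient \<open>h a / h s\<close>; so it
  can be identified with that quotient.
\<close>

lemma ring_copy_localization:
  fixes R :: "'a ring" and S :: "'a set" and h :: "'a \<Rightarrow> 'b::comm_ring_1"
  assumes "cring R" and S: "S \<subseteq> carrier R" "\<one>\<^bsub>R\<^esub> \<in> S"
    "\<And>s t. s \<in> S \<Longrightarrow> t \<in> S \<Longrightarrow> s \<otimes>\<^bsub>R\<^esub> t \<in> S"
    and h_add: "\<And>a b. a \<in> carrier R \<Longrightarrow> b \<in> carrier R \<Longrightarrow> h (a \<oplus>\<^bsub>R\<^esub> b) = h a + h b"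
    and h_mult: "\<And>a b. a \<in> carrier R \<Longrightarrow> b \<in> carrier R \<Longrightarrow> h (a \<otimes>\<^bsub>R\<^esub> b) = h a * h b"
    and h_inj: "\<And>a. a \<in> carrier R \<Longrightarrow> h a = 0 \<Longrightarrow> a = \<zero>\<^bsub>R\<^esub>"
    and h_unit: "\<And>s. s \<in> S \<Longrightarrow> \<exists>u. h s * u = 1"
    and h_surj: "\<And>b. \<exists>a\<in>carrier R. \<exists>s\<in>S. b * h s = h a"
  shows "ring_copy (localization R S) (\<lambda>b. {(a, s). a \<in> carrier R \<and> s \<in> S \<and> b * h s = h a})"
proof -
  interpret R: cring R by fact
  define \<iota> where "\<iota> = (\<lambda>b. {(a, s). a \<in> carrier R \<and> s \<in> S \<and> b * h s = h a})"
  have S_R: "s \<in> carrier R" if "s \<in> S" for s using S(1) that by blast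
  have h_zero: "h \<zero>\<^bsub>R\<^esub> = 0" using h_add [of "\<zero>\<^bsub>R\<^esub>" "\<zero>\<^bsub>R\<^esub>"] by simp
  have h_minus: "h (a \<ominus>\<^bsub>R\<^esub> b) = h a - h b" if "a \<in> carrier R" "b \<in> carrier R" for a b
  proof -
    have "(a \<ominus>\<^bsub>R\<^esub> b) \<oplus>\<^bsub>R\<^esub> b = a" using that by (simp add: R.minus_eq R.a_assoc R.l_neg)
    hence "h (a \<ominus>\<^bsub>R\<^esub> b) + h b = h a" using h_add [of "a \<ominus>\<^bsub>R\<^esub> b" b] that by simp
    thus ?thesis by (simp add: algebra_simps)
  qed
  have cancel: "h s * x = h s * y \<longleftrightarrow> x = y" if s: "s \<in> S" for s x y
  proof
    assume eq: "h s * x = h s * y"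
    obtain u where u: "h s * u = 1" using h_unit [OF s] by blast
    have u_cancel: "u * (h s * z) = z" for z
    proof -
      have "u * (h s * z) = (h s * u) * z" by (simp only: ac_simps)
      thus ?thesis by (simp add: u)
    qed
    show "x = y" using arg_cong [OF eq, of "\<lambda>z. u * z"] by (simp only: u_cancel)
  qed simp
  have rel: "((a, s), (a', t)) \<in> fraction_rel R S \<longleftrightarrow>
      a \<in> carrier R \<and> a' \<in> carrier R \<and> s \<in> S \<and> t \<in> S \<and> h t * h a = h s * h a'" for a s a' t
  proof -
    have "(\<exists>u\<in>S. u \<otimes>\<^bsub>R\<^esub> (t \<otimes>\<^bsub>R\<^esub> a \<ominus>\<^bsub>R\<^esub> s \<otimes>\<^bsub>R\<^esub> a') = \<zero>\<^bsub>R\<^esub>) \<longleftrightarrow> h t * h a = h s * h a'"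
      if *: "a \<in> carrier R" "a' \<in> carrier R" "s \<in> S" "t \<in> S"
    proof -
      let ?d = "t \<otimes>\<^bsub>R\<^esub> a \<ominus>\<^bsub>R\<^esub> s \<otimes>\<^bsub>R\<^esub> a'"
      have d: "?d \<in> carrier R" "h ?d = h t * h a - h s * h a'"
        using * S_R by (simp_all add: h_minus h_mult)
      have "u \<otimes>\<^bsub>R\<^esub> ?d = \<zero>\<^bsub>R\<^esub> \<longleftrightarrow> h t * h a = h s * h a'" if u: "u \<in> S" for u
      proof -
        have "u \<otimes>\<^bsub>R\<^esub> ?d = \<zero>\<^bsub>R\<^esub> \<longleftrightarrow> h (u \<otimes>\<^bsub>R\<^esub> ?d) = 0"
          using h_inj [of "u \<otimes>\<^bsub>R\<^esub> ?d"] h_zero S_R [OF u] d(1) by auto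
        also have "\<dots> \<longleftrightarrow> h u * h ?d = h u * 0" using S_R [OF u] d(1) by (simp add: h_mult)
        also have "\<dots> \<longleftrightarrow> h ?d = 0" by (rule cancel [OF u])
        finally show ?thesis by (simp add: d(2))
      qed
      thus ?thesis using S(2) by blast
    qed
    thus ?thesis unfolding fraction_rel_def by auto
  qed
  have frac: "fraction R S a s = \<iota> b" if as: "a \<in> carrier R" "s \<in> S" "b * h s = h a" for a s b
  proof -
    have "h t * h a = h s * h a' \<longleftrightarrow> b * h t = h a'" for a' t
      using cancel [OF as(2), of "b * h t" "h a'"] by (simp add: as(3) [symmetric] ac_simps)
    hence "((a, s), (a', t)) \<in> fraction_rel R S \<longleftrightarrow> (a', t) \<in> \<iota> b" for a' t
      unfolding rel using as by (auto simp: \<iota>_def)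
    thus ?thesis unfolding fraction_def by auto
  qed
  have nonempty: "\<exists>a s. a \<in> carrier R \<and> s \<in> S \<and> b * h s = h a" for b
    using h_surj [of b] by blast
  have "ring_copy (localization R S) \<iota>"
  proof
    have "inj \<iota>"
    proof (rule injI)
      fix b c assume eq: "\<iota> b = \<iota> c"
      obtain a s where "a \<in> carrier R" "s \<in> S" "b * h s = h a" using nonempty by blast
      moreover from this have "(a, s) \<in> \<iota> c" unfolding eq [symmetric] by (simp add: \<iota>_def)
      ultimately have "s \<in> S" "h s * b = h s * c" by (simp_all add: \<iota>_def mult.commute)
      thus "b = c" by (simp add: cancel)
    qed
    moreover have "range \<iota> = carrier (localization R S)"
    proof
      show "range \<iota> \<subseteq> carrier (localization R S)"
      proof clarify
        fix b
        obtain a s where as: "a \<in> carrier R" "s \<in> S" "b * h s = h a" using nonempty by blast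
        have "fraction R S a s \<in> (carrier R \<times> S) // fraction_rel R S"
          unfolding fraction_def by (rule quotientI) (use as in simp)
        thus "\<iota> b \<in> carrier (localization R S)"
          by (simp add: localization_def frac [OF as])
      qed
      show "carrier (localization R S) \<subseteq> range \<iota>"
      proof
        fix U assume "U \<in> carrier (localization R S)"
        then obtain a s where as: "a \<in> carrier R" "s \<in> S" "U = fraction R S a s"
          unfolding localization_def by (auto elim!: quotientE simp: fraction_def)
        obtain u where "h s * u = 1" using h_unit [OF as(2)] by blast
        moreover have "(h a * u) * h s = h a * (h s * u)" by (simp only: ac_simps)
        ultimately have "(h a * u) * h s = h a" by simp
        thus "U \<in> range \<iota>" using frac [OF as(1,2)] as(3) by blast
      qed
    qed
    ultimately show "bij_betw \<iota> UNIV (carrier (localization R S))" by (simp add: bij_betw_def)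
  next
    fix b c
    have *: "fraction R S (t \<otimes>\<^bsub>R\<^esub> a \<oplus>\<^bsub>R\<^esub> s \<otimes>\<^bsub>R\<^esub> a') (s \<otimes>\<^bsub>R\<^esub> t) = \<iota> (b + c)"
      if "(a, s) \<in> \<iota> b" "(a', t) \<in> \<iota> c" for a s a' t
    proof (rule frac)
      have "h (t \<otimes>\<^bsub>R\<^esub> a \<oplus>\<^bsub>R\<^esub> s \<otimes>\<^bsub>R\<^esub> a') = h t * (b * h s) + h s * (c * h t)"
        using that S_R by (auto simp: \<iota>_def h_add h_mult)
      moreover have "h (s \<otimes>\<^bsub>R\<^esub> t) = h s * h t" using that S_R by (auto simp: \<iota>_def h_mult)
      ultimately show "(b + c) * h (s \<otimes>\<^bsub>R\<^esub> t) = h (t \<otimes>\<^bsub>R\<^esub> a \<oplus>\<^bsub>R\<^esub> s \<otimes>\<^bsub>R\<^esub> a')"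
        by (simp add: algebra_simps)
    qed (use that S_R S(3) in \<open>auto simp: \<iota>_def\<close>)
    obtain p q where "p \<in> \<iota> b" "q \<in> \<iota> c" using nonempty [of b] nonempty [of c] by (auto simp: \<iota>_def)
    from UN_pair_const [OF this *] show "\<iota> (b + c) = \<iota> b \<oplus>\<^bsub>localization R S\<^esub> \<iota> c"
      unfolding localization_def by simp
  next
    fix b c
    have *: "fraction R S (a \<otimes>\<^bsub>R\<^esub> a') (s \<otimes>\<^bsub>R\<^esub> t) = \<iota> (b * c)"
      if "(a, s) \<in> \<iota> b" "(a', t) \<in> \<iota> c" for a s a' t
    proof (rule frac)
      have "h (a \<otimes>\<^bsub>R\<^esub> a') = (b * h s) * (c * h t)"
        using that S_R by (auto simp: \<iota>_def h_mult)
      moreover have "h (s \<otimes>\<^bsub>R\<^esub> t) = h s * h t" using that S_R by (auto simp: \<iota>_def h_mult)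
      ultimately show "b * c * h (s \<otimes>\<^bsub>R\<^esub> t) = h (a \<otimes>\<^bsub>R\<^esub> a')" by (simp add: ac_simps)
    qed (use that S_R S(3) in \<open>auto simp: \<iota>_def\<close>)
    obtain p q where "p \<in> \<iota> b" "q \<in> \<iota> c" using nonempty [of b] nonempty [of c] by (auto simp: \<iota>_def)
    from UN_pair_const [OF this *] show "\<iota> (b * c) = \<iota> b \<otimes>\<^bsub>localization R S\<^esub> \<iota> c"
      unfolding localization_def by simp
  next
    show "\<iota> 1 = \<one>\<^bsub>localization R S\<^esub>"
      unfolding localization_def using frac [of "\<one>\<^bsub>R\<^esub>" "\<one>\<^bsub>R\<^esub>" 1] S by simp
    show "\<iota> 0 = \<zero>\<^bsub>localization R S\<^esub>"
      unfolding localization_def using frac [of "\<zero>\<^bsub>R\<^esub>" "\<one>\<^bsub>R\<^esub>" 0] S by (simp add: h_zero)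
  qed
  thus ?thesis unfolding \<iota>_def .
qed


section \<open>The local ring\<close>

lemma alg_max_power_mult_1:
  "alg_max_power (Suc 0) n \<Longrightarrow> alg_max_power d f \<Longrightarrow> alg_max_power (Suc d) (n * f)"
  by (auto simp: alg_max_power_def times_alg_def)

text \<open>
  If \<open>a0 b\<close> is invertible, then \<open>b\<close> is a scalar times \<open>1 + m\<close> with \<open>m\<^sup>4 = 0\<close>, and the inverse of
  \<open>1 + m\<close> is \<open>1 - m + m\<^sup>2 - m\<^sup>3\<close>.
\<close>

lemma alg_unit:
  fixes b :: "'k::field fls alg"
  assumes "a0 b \<noteq> 0"
  shows "\<exists>u. b * u = 1"
proof -
  define c where "c = scalar (inverse (a0 b))"
  define m where "m = c * b - 1"
  have "alg_max_power 1 m"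
    using assms by (simp add: alg_max_power_def m_def c_def scalar_mult minus_alg_def one_alg_def)
  hence "alg_max_power (Suc (Suc (Suc 1))) (m * (m * (m * m)))"
    by (intro alg_max_power_mult_1) simp_all
  hence "m * (m * (m * m)) = 0" by (rule alg_max_power_4) simp
  moreover have "b * (c * (1 - m + m * m - m * (m * m))) = 1 - m * (m * (m * m))"
  proof -
    have "b * (c * (1 - m + m * m - m * (m * m))) = (m + 1) * (1 - m + m * m - m * (m * m))"
      by (simp add: m_def ac_simps)
    also have "\<dots> = 1 - m * (m * (m * m))" by (simp add: algebra_simps)
    finally show ?thesis .
  qed
  ultimately show ?thesis by (metis diff_zero)
qed

lemma fls_X_power_mult_integral:
  fixes c :: "'k::field fls"
  assumes "nat (- fls_subdegree c) \<le> n"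
  shows "\<exists>d. c * fls_X ^ n = fps_to_fls d"
proof -
  have "fls_X ^ n * c = fls_shift (- int n) c" by (simp add: fls_X_power_times_conv_shift)
  moreover have "fls_subdegree (fls_shift (- int n) c) \<ge> 0"
    using assms by (cases "c = 0") auto
  hence "fls_shift (- int n) c = fps_to_fls (fls_regpart (fls_shift (- int n) c))"
    by simp
  ultimately show ?thesis by (metis mult.commute)
qed

text \<open>
  A power of \<open>t\<close> is a common denominator of the twelve coordinates.
\<close>

lemma alg_integral:
  fixes b :: "'k::field fls alg"
  shows "\<exists>n b'. b * scalar (fls_X ^ n) = map_alg fps_to_fls b'"
proof -
  let ?cs = "[a0 b, a1 b, a2 b, a3 b, a4 b, a5 b, a12 b, a13 b, a14 b, a15 b, a25 b, aw b]"
  define n where "n = sum_list (map (\<lambda>c. nat (- fls_subdegree c)) ?cs)"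
  have "\<exists>d. c * fls_X ^ n = fps_to_fls d" if "c \<in> set ?cs" for c
  proof (rule fls_X_power_mult_integral)
    show "nat (- fls_subdegree c) \<le> n"
      unfolding n_def by (rule member_le_sum_list) (use that in auto)
  qed
  then obtain d where "\<And>c. c \<in> set ?cs \<Longrightarrow> c * fls_X ^ n = fps_to_fls (d c)" by metis
  hence "b * scalar (fls_X ^ n) = map_alg fps_to_fls (Alg (d (a0 b)) (d (a1 b)) (d (a2 b)) (d (a3 b))
      (d (a4 b)) (d (a5 b)) (d (a12 b)) (d (a13 b)) (d (a14 b)) (d (a15 b)) (d (a25 b)) (d (aw b)))"
    by (simp add: mult.commute [of b] scalar_mult mult.commute [of "fls_X ^ n"])
  thus ?thesis by blast
qed

text \<open>
  The homomorphism \<open>to_alg\<close> descends to an injection of \<open>R\<close> into the algebra.  Elements outside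
  \<open>\<pp>\<close> have a nonzero constant coordinate, so they become units, and each element of the algebra is a
  quotient whose denominator is a power of \<open>t\<close>; the powers of \<open>t\<close> are not in \<open>\<pp>\<close>.
\<close>

lemma local_ring_copy:
  "\<exists>\<iota> :: 'k::field fls alg \<Rightarrow> _. ring_copy (localization_at_prime (ring_R :: 'k S fps set ring) prime_p) \<iota>"
proof -
  interpret St: cring "St :: 'k S fps ring" by (rule cring_St)
  interpret I: ideal "ideal_I :: 'k S fps set" St by (rule ideal_ideal_I)
  let ?R = "ring_R :: 'k S fps set ring" and ?p = "prime_p :: 'k S fps set set"
  interpret R: cring ?R unfolding ring_R_def by (rule I.quotient_is_cring) (rule cring_St)
  interpret p: primeideal ?p ?R by (rule primeideal_prime_p)
  define q where "q = (\<lambda>f :: 'k S fps. ideal_I +>\<^bsub>St\<^esub> f)"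
  have hom: "q \<in> ring_hom St ?R"
    unfolding q_def ring_R_def by (rule I.rcos_ring_hom)
  have q_in: "q f \<in> carrier ?R" for f
    using ring_hom_closed [OF hom] by simp
  have q_add: "q (f + g) = q f \<oplus>\<^bsub>?R\<^esub> q g" and q_mult: "q (f * g) = q f \<otimes>\<^bsub>?R\<^esub> q g" for f g
    using ring_hom_add [OF hom, of f g] ring_hom_mult [OF hom, of f g] by auto
  have q_0: "q 0 = \<zero>\<^bsub>?R\<^esub>" using ring_hom_zero [OF hom St.ring_axioms R.ring_axioms] by simp
  have surj: "\<exists>f. U = q f" if "U \<in> carrier ?R" for U
    using that by (auto simp: ring_R_def FactRing_def A_RCOSETS_def' q_def)
  have q_eqD: "to_alg f = to_alg g" if "q f = q g" for f g
  proof -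
    have "f \<in> ideal_I +>\<^bsub>St\<^esub> g"
      using I.a_rcos_self [of f] that by (simp add: q_def)
    then obtain h where "h \<in> ideal_I" "f = h + g" by (auto simp: a_r_coset_def')
    thus ?thesis by (simp add: to_alg_add to_alg_ideal_I)
  qed
  \<comment> \<open>By \<open>q_eqD\<close>, the choice of the representative does not matter.\<close>
  define h where "h = (\<lambda>U. to_alg (SOME f. U = q f))"
  have h_q: "h (q f) = to_alg f" for f
  proof -
    have "q f = q (SOME g. q f = q g)" by (rule someI) (rule refl)
    from q_eqD [OF this] show ?thesis by (simp add: h_def)
  qed
  \<comment> \<open>The classes with constant coordinate \<open>0\<close> form an ideal; it contains the generators of \<open>\<pp>\<close>.\<close>
  define K where "K = {U \<in> carrier ?R. a0 (h U) = 0}"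
  have K_iff: "q f \<in> K \<longleftrightarrow> a0 (to_alg f) = 0" for f
    using q_in by (simp add: K_def h_q)
  have K_elim: "\<exists>f. U = q f \<and> a0 (to_alg f) = 0" if U: "U \<in> K" for U
  proof -
    obtain f where "U = q f" using surj U by (auto simp: K_def)
    thus ?thesis using U K_iff by blast
  qed
  have "ideal K ?R"
  proof (rule idealI [OF R.ring_axioms])
    show "subgroup K (add_monoid ?R)"
    proof (rule R.add.subgroupI)
      show "K \<subseteq> carrier ?R" by (auto simp: K_def)
      show "K \<noteq> {}" using K_iff [of 0] by (auto simp: to_alg_0)
    next
      fix U assume "U \<in> K"
      then obtain f where f: "U = q f" "a0 (to_alg f) = 0" using K_elim by blast
      have "q (- f) \<oplus>\<^bsub>?R\<^esub> q f = \<zero>\<^bsub>?R\<^esub>" using q_add [of "- f" f] q_0 by simp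
      hence "\<ominus>\<^bsub>?R\<^esub> U = q (- f)" using R.minus_equality q_in f by blast
      thus "\<ominus>\<^bsub>?R\<^esub> U \<in> K"
        using f(2) by (simp add: K_iff to_alg_minus uminus_alg_def)
    next
      fix U V assume "U \<in> K" "V \<in> K"
      then obtain f g where "U = q f" "a0 (to_alg f) = 0" "V = q g" "a0 (to_alg g) = 0"
        using K_elim by blast
      thus "U \<oplus>\<^bsub>?R\<^esub> V \<in> K"
        by (simp add: K_iff to_alg_add flip: q_add)
    qed
  next
    fix U V assume U: "U \<in> K" and V: "V \<in> carrier ?R"
    obtain f g where "U = q f" "a0 (to_alg f) = 0" "V = q g"
      using K_elim [OF U] surj [OF V] by blast
    thus "V \<otimes>\<^bsub>?R\<^esub> U \<in> K" "U \<otimes>\<^bsub>?R\<^esub> V \<in> K"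
      by (simp_all add: K_iff to_alg_mult times_alg_def flip: q_mult)
  qed
  hence p_sub: "?p \<subseteq> K"
    unfolding prime_p_def q_def [symmetric]
    by (rule R.genideal_minimal) (auto simp: K_iff to_alg_x_elem xv_sel)
  have gen_in: "q (x_elem i) \<in> ?p" for i
    using R.genideal_self [of "range (\<lambda>i. q (x_elem i))"] q_in unfolding prime_p_def q_def by auto
  have p_sup: "q f \<in> ?p" if f0: "red_x f = 0" for f
  proof -
    obtain g where g: "f = (\<Sum>i\<in>{X1, X2, X3, X4, X5}. x_elem i * g i)"
      using red_x_decompose [OF f0] by blast
    have "q (x_elem i * g i) \<in> ?p" for i
      unfolding q_mult by (rule p.I_r_closed [OF gen_in q_in])
    hence "q (x_elem X1 * g X1 + (x_elem X2 * g X2 + (x_elem X3 * g X3 +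
        (x_elem X4 * g X4 + x_elem X5 * g X5)))) \<in> ?p"
      unfolding q_add by (intro p.a_closed)
    thus ?thesis by (simp add: g)
  qed
  have "ring_copy (localization ?R (carrier ?R - ?p))
    (\<lambda>b. {(a, s). a \<in> carrier ?R \<and> s \<in> carrier ?R - ?p \<and> b * h s = h a})"
  proof (rule ring_copy_localization [OF R.is_cring])
    show "\<one>\<^bsub>?R\<^esub> \<in> carrier ?R - ?p" using p.I_notcarr p.one_imp_carrier by auto
    show "s \<otimes>\<^bsub>?R\<^esub> t \<in> carrier ?R - ?p" if "s \<in> carrier ?R - ?p" "t \<in> carrier ?R - ?p" for s t
      using that p.I_prime [of s t] by auto
    fix a assume "a \<in> carrier ?R"
    then obtain f where f: "a = q f" using surj by blast
    show "h (a \<oplus>\<^bsub>?R\<^esub> b) = h a + h b" if b: "b \<in> carrier ?R" for b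
    proof -
      obtain g where "b = q g" using surj [OF b] by blast
      thus ?thesis using f by (simp add: h_q to_alg_add flip: q_add)
    qed
    show "h (a \<otimes>\<^bsub>?R\<^esub> b) = h a * h b" if b: "b \<in> carrier ?R" for b
    proof -
      obtain g where "b = q g" using surj [OF b] by blast
      thus ?thesis using f by (simp add: h_q to_alg_mult flip: q_mult)
    qed
    show "a = \<zero>\<^bsub>?R\<^esub>" if "h a = 0"
    proof -
      have "f \<in> ideal_I" using that by (simp add: f h_q to_alg_eq_0_iff)
      hence "q f = ideal_I" unfolding q_def by (rule I.a_rcos_const)
      thus ?thesis by (simp add: f ring_R_def FactRing_def)
    qed
  next
    fix s assume s: "s \<in> carrier ?R - ?p"
    then obtain f where f: "s = q f" using surj by blast
    have "red_x f \<noteq> 0" using s f p_sup by blast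
    hence "a0 (to_alg f) \<noteq> 0" by (simp add: a0_to_alg)
    thus "\<exists>u. h s * u = 1" unfolding f h_q by (rule alg_unit)
  next
    fix b :: "'k fls alg"
    obtain n b' where b': "b * scalar (fls_X ^ n) = map_alg fps_to_fls b'" using alg_integral by blast
    have X: "to_alg (fps_X ^ n :: 'k S fps) = scalar (fls_X ^ n)"
      by (induction n) (simp_all add: to_alg_1 to_alg_mult to_alg_X scalar_hom)
    have "q (fps_X ^ n) \<notin> ?p"
    proof
      assume "q (fps_X ^ n) \<in> ?p"
      hence "q (fps_X ^ n) \<in> K" using p_sub by blast
      thus False by (simp add: K_iff X scalar_def)
    qed
    thus "\<exists>a\<in>carrier ?R. \<exists>s\<in>carrier ?R - ?p. b * h s = h a"
      using b' q_in
      by (intro bexI [where x = "q (series_of b')"] bexI [where x = "q (fps_X ^ n)"])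
         (simp_all add: h_q X to_alg_series_of)
  qed auto
  thus ?thesis unfolding localization_at_prime_def by (intro exI)
qed


section \<open>Equations over the algebra\<close>

lemma scalar_sel:
  "a0 (scalar s) = s" "a1 (scalar s) = 0" "a2 (scalar s) = 0" "a3 (scalar s) = 0" "a4 (scalar s) = 0"
  "a5 (scalar s) = 0" "a12 (scalar s) = 0" "a13 (scalar s) = 0" "a14 (scalar s) = 0"
  "a15 (scalar s) = 0" "a25 (scalar s) = 0" "aw (scalar s) = 0"
  by (simp_all add: scalar_def)

text \<open>
  Exactness of \<open>D\<^bsub>\<alpha>b\<^esub>\<close> followed by \<open>D\<^sub>b\<close>, where \<open>D\<^sub>b\<close> has the rows \<open>(x\<^sub>1, b x\<^sub>3)\<close> and \<open>(x\<^sub>4, x\<^sub>2)\<close>.  All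
  entries are homogeneous of degree one, so the equations decouple by degree.  The constant part of
  a vector in the kernel vanishes, and its linear, quadratic and cubic parts come from the constant,
  linear and quadratic parts of a preimage.
\<close>

lemma matrix_kernel:
  fixes v1 v2 :: "'k::field fls alg"
  assumes "b \<noteq> 0"
  shows "xv X1 * v1 + scalar b * (xv X3 * v2) = 0 \<and> xv X4 * v1 + xv X2 * v2 = 0 \<longleftrightarrow>
    (\<exists>u1 u2. v1 = xv X1 * u1 + scalar (alpha * b) * (xv X3 * u2) \<and> v2 = xv X4 * u1 + xv X2 * u2)"
    (is "?kernel \<longleftrightarrow> ?image")
proof
  have "alpha \<noteq> (0 :: 'k fls)" by (rule alpha_nonzero)
  assume ?kernel
  hence rows: "Alg 0 (a0 v1) 0 0 0 0 (a2 v1) (a3 v1) (a4 v1) (a5 v1) 0 (a25 v1) +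
      Alg 0 0 0 (b * a0 v2) 0 0 0 (b * (a1 v2 - alpha * a2 v2)) 0 (b * (- alpha * a3 v2)) (b * a3 v2)
        (b * a13 v2) = 0"
    "Alg 0 0 0 0 (a0 v1) 0 0 0 (a1 v1 - a2 v1) (- a4 v1) (a4 v1) (a14 v1) +
      Alg 0 0 (a0 v2) 0 0 0 (a1 v2) (- alpha * a3 v2) (- a4 v2) 0 (a5 v2) (a15 v2) = 0"
    by (simp_all add: xv_mult scalar_mult)
  hence "a0 v1 = 0" "a0 v2 = 0" "a2 v1 = 0" "a4 v1 = 0" "a1 v2 = 0" "a3 v2 = 0" "a5 v1 = 0" "a5 v2 = 0"
    "a3 v1 = alpha * b * a2 v2" "a1 v1 = a4 v2" "a25 v1 = - b * a13 v2" "a15 v2 = - a14 v1"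
    using assms by (auto simp: plus_alg_def zero_alg_def eq_neg_iff_add_eq_0 algebra_simps)
  \<comment> \<open>The linear and quadratic parts of a preimage; the constant parts are added below.\<close>
  moreover define u1 where "u1 = Alg 0 (a14 v2 + a12 v1) (a12 v1) (a13 v1 - alpha * b * a12 v2) (a14 v1)
      (a15 v1 - alpha * b * a13 v2) 0 0 (aw v2) 0 (aw v1) 0"
  moreover define u2 where "u2 = Alg 0 (a12 v2) 0 (- a13 v2 / alpha) 0 (a25 v2 - a14 v1) 0 0 0 0 0 0"
  ultimately have "v1 = xv X1 * (u1 + scalar (a1 v1)) + scalar (alpha * b) * (xv X3 * (u2 + scalar (a2 v2))) \<and>
      v2 = xv X4 * (u1 + scalar (a1 v1)) + xv X2 * (u2 + scalar (a2 v2))"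
    using \<open>alpha \<noteq> 0\<close>
    by (cases v1; cases v2) (simp add: xv_mult scalar_mult scalar_sel plus_alg_def field_simps)
  thus ?image by blast
next
  assume ?image
  then obtain u1 u2 where "v1 = xv X1 * u1 + scalar (alpha * b) * (xv X3 * u2)" "v2 = xv X4 * u1 + xv X2 * u2"
    by blast
  thus ?kernel
    by (simp add: xv_mult scalar_mult plus_alg_def) (simp add: zero_alg_def algebra_simps)
qed


text \<open>
  The test module is the ideal of the algebra generated by this element of degree two: the variables
  \<open>x\<^sub>1, \<dots>, x\<^sub>5\<close> multiply it by \<open>1, c, 1, 1, 0\<close> times the socle generator.
\<close>

definition test_elt :: "'k::field fls \<Rightarrow> 'k fls alg" where
  "test_elt c = Alg 0 0 0 0 0 0 0 1 1 c 1 0"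

definition socle :: "'k::field fls \<Rightarrow> 'k fls alg" where
  "socle s = Alg 0 0 0 0 0 0 0 0 0 0 0 s"

lemma xv_mult_test_elt:
  "xv X1 * (f * test_elt c) = socle (a0 f)"
  "xv X2 * (f * test_elt c) = socle (c * a0 f)"
  "scalar b * (xv X3 * (f * test_elt c)) = socle (b * a0 f)"
  "xv X4 * (f * test_elt c) = socle (a0 f)"
  by (simp_all add: xv_mult scalar_mult test_elt_def socle_def) (simp_all add: times_alg_def mult.commute)

lemma mult_test_elt_socle: "a0 f = 0 \<Longrightarrow> f * test_elt c = socle (a1 f + c * a2 f + a3 f + a4 f)"
  by (simp add: test_elt_def socle_def times_alg_def algebra_simps)

lemma socle_simps: "socle s + socle r = socle (s + r)" "socle s = socle r \<longleftrightarrow> s = r" "socle s = 0 \<longleftrightarrow> s = 0"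
  by (simp_all add: socle_def plus_alg_def zero_alg_def)

text \<open>
  Let \<open>y = test_elt c\<close>.  Modulo the socle, \<open>f y\<close> and \<open>g y\<close> are scalar multiples of \<open>y\<close>.  The matrix with rows
  \<open>(1, 1)\<close> and \<open>(b, c)\<close> is invertible, hence these multiples are zero and \<open>f y\<close>, \<open>g y\<close> lie in the
  socle; the matrix with rows \<open>(1, 1)\<close> and \<open>(b', c)\<close> is invertible as well, hence they can be
  reached from scalar multiples of \<open>y\<close>.
\<close>

lemma test_elt_bounded:
  fixes f g :: "'k::field fls alg"
  assumes "b \<noteq> c" "b' \<noteq> c"
    and "xv X1 * (f * test_elt c) + xv X4 * (g * test_elt c) = 0"
    and "scalar b * (xv X3 * (f * test_elt c)) + xv X2 * (g * test_elt c) = 0"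
  shows "\<exists>f' g'. f * test_elt c = xv X1 * (f' * test_elt c) + xv X4 * (g' * test_elt c) \<and>
    g * test_elt c = scalar b' * (xv X3 * (f' * test_elt c)) + xv X2 * (g' * test_elt c)"
proof -
  have "a0 f + a0 g = 0" "b * a0 f + c * a0 g = 0"
    using assms(3,4) by (simp_all add: xv_mult_test_elt socle_simps)
  moreover have "(b - c) * a0 f = (b * a0 f + c * a0 g) - c * (a0 f + a0 g)" by (simp add: algebra_simps)
  ultimately have "a0 f = 0" "a0 g = 0" using assms(1) by auto
  then obtain s r where s: "f * test_elt c = socle s" and r: "g * test_elt c = socle r"
    using mult_test_elt_socle by blast
  \<comment> \<open>The solution of \<open>p + p' = s\<close>, \<open>b' p + c p' = r\<close>, with \<open>p' = s - p\<close>.\<close>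
  define p where "p = (r - c * s) / (b' - c)"
  have "(b' - c) * p = r - c * s" using assms(2) by (simp add: p_def)
  hence "b' * p + c * (s - p) = r" by (simp add: algebra_simps)
  hence "f * test_elt c = xv X1 * (scalar p * test_elt c) + xv X4 * (scalar (s - p) * test_elt c) \<and>
    g * test_elt c = scalar b' * (xv X3 * (scalar p * test_elt c)) + xv X2 * (scalar (s - p) * test_elt c)"
    by (simp add: xv_mult_test_elt s r socle_simps scalar_sel)
  thus ?thesis by blast
qed

text \<open>
  The matrix with rows \<open>(1, 1)\<close> and \<open>(c, c)\<close> does not reach \<open>(1, 0)\<close>.
\<close>

lemma test_elt_unbounded:
  fixes f' g' :: "'k::field fls alg"
  assumes "socle 1 = xv X1 * (f' * test_elt c) + xv X4 * (g' * test_elt c)"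
    and "0 = scalar c * (xv X3 * (f' * test_elt c)) + xv X2 * (g' * test_elt c)"
    and "c \<noteq> 0"
  shows False
proof -
  have "a0 f' + a0 g' = 1" "c * a0 f' + c * a0 g' = 0"
    using assms(1,2) by (simp_all add: xv_mult_test_elt socle_simps eq_commute [of 0] eq_commute [of 1])
  hence "c * 1 = 0" by (metis distrib_left)
  thus False using assms(3) by simp
qed


section \<open>Free modules of rank two\<close>

context ring_copy
begin

definition \<kappa> :: "'a \<Rightarrow> 'b" where "\<kappa> = inv_into UNIV \<iota>"

lemma \<kappa>_\<iota> [simp]: "\<kappa> (\<iota> b) = b"
  using bij by (simp add: \<kappa>_def bij_betw_def inv_into_f_f)

abbreviation F2 :: "('a, nat \<Rightarrow> 'a) module" where "F2 \<equiv> free_module A 2"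

definition vec :: "'b \<Rightarrow> 'b \<Rightarrow> nat \<Rightarrow> 'a" where
  "vec a b = (\<lambda>i\<in>{..<2}. \<iota> (if i = 0 then a else b))"

lemma vec_nth [simp]: "vec a b 0 = \<iota> a" "vec a b (Suc 0) = \<iota> b"
  by (simp_all add: vec_def)

lemma vec_closed [simp]: "vec a b \<in> carrier F2"
  by (auto simp: vec_def free_module_simps)

lemma vec_inject [simp]: "vec a b = vec c d \<longleftrightarrow> a = c \<and> b = d"
  by (metis vec_nth inject)

lemma vec_elim:
  assumes "v \<in> carrier F2" obtains a b where "v = vec a b"
proof -
  have "v 0 \<in> carrier A" "v 1 \<in> carrier A" and ext: "v \<in> extensional {..<2}"
    using assms by (auto simp: free_module_simps PiE_iff)
  then obtain a b where ab: "v 0 = \<iota> a" "v (Suc 0) = \<iota> b" by (metis elim One_nat_def)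
  have "v = vec a b"
  proof (rule extensionalityI [OF ext])
    show "vec a b \<in> extensional {..<2}" by (simp add: vec_def)
    fix i :: nat assume "i \<in> {..<2}"
    hence "i = 0 \<or> i = Suc 0" by auto
    thus "v i = vec a b i" using ab by auto
  qed
  thus ?thesis by (rule that)
qed

lemma vec_plus: "vec a b \<oplus>\<^bsub>F2\<^esub> vec c d = vec (a + c) (b + d)"
  by (auto simp: vec_def free_module_simps plus)

lemma vec_scale: "\<iota> c \<odot>\<^bsub>F2\<^esub> vec a b = vec (c * a) (c * b)"
  by (auto simp: vec_def free_module_simps times)

lemma vec_zero: "\<zero>\<^bsub>F2\<^esub> = vec 0 0"
  by (auto simp: vec_def free_module_simps zero)

definition mat :: "'b \<Rightarrow> 'b \<Rightarrow> 'b \<Rightarrow> 'b \<Rightarrow> (nat \<Rightarrow> 'a) \<Rightarrow> nat \<Rightarrow> 'a" where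
  "mat p q r s v = vec (p * \<kappa> (v 0) + q * \<kappa> (v 1)) (r * \<kappa> (v 0) + s * \<kappa> (v 1))"

lemma mat_vec [simp]: "mat p q r s (vec a b) = vec (p * a + q * b) (r * a + s * b)"
  by (simp add: mat_def)

lemma mat_hom: "mat p q r s \<in> module_homs A F2 F2"
  by (rule module_homsI) (auto elim!: vec_elim elim simp: vec_plus vec_scale algebra_simps)

lemma module_F2: "module A F2"
  by (rule module_free_module [OF is_cring])

end


section \<open>Ext modules that vanish arbitrarily late\<close>

lemma alpha_power_inject: "(alpha :: 'k::field fls) ^ m = alpha ^ n \<longleftrightarrow> m = n"
proof -
  have less: "(alpha :: 'k fls) ^ m \<noteq> alpha ^ n" if "m < n" for m n
  proof
    assume "(alpha :: 'k fls) ^ m = alpha ^ n"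
    also have "\<dots> = alpha ^ m * alpha ^ (n - m)" using that by (simp flip: power_add)
    finally have "(alpha :: 'k fls) ^ (n - m) = 1" using alpha_nonzero [where 'k = 'k] by simp
    thus False using alpha_power_neq_1 [of "n - m", where 'k = 'k] that by simp
  qed
  show ?thesis using less [of m n] less [of n m] by (cases m n rule: linorder_cases) auto
qed

locale algebra_copy = ring_copy A \<iota> for A :: "'a ring" and \<iota> :: "'k::field fls alg \<Rightarrow> 'a"
begin

definition D :: "'k fls \<Rightarrow> (nat \<Rightarrow> 'a) \<Rightarrow> nat \<Rightarrow> 'a" where
  "D b = mat (xv X1) (scalar b * xv X3) (xv X4) (xv X2)"

lemma D_vec: "D b (vec u v) = vec (xv X1 * u + scalar b * (xv X3 * v)) (xv X4 * u + xv X2 * v)"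
  by (simp add: D_def mult.assoc)

lemma D_hom: "D b \<in> module_homs A F2 F2"
  unfolding D_def by (rule mat_hom)

lemma D_kernel:
  assumes "b \<noteq> 0"
  shows "D (alpha * b) ` carrier F2 = {v \<in> carrier F2. D b v = \<zero>\<^bsub>F2\<^esub>}"
proof (intro equalityI subsetI)
  fix v assume "v \<in> D (alpha * b) ` carrier F2"
  then obtain u1 u2 where v: "v = D (alpha * b) (vec u1 u2)" by (auto elim: vec_elim)
  hence "D b v = \<zero>\<^bsub>F2\<^esub>"
    unfolding v D_vec [of "alpha * b"] D_vec [of b] vec_zero vec_inject matrix_kernel [OF assms] by blast
  thus "v \<in> {v \<in> carrier F2. D b v = \<zero>\<^bsub>F2\<^esub>}" by (simp add: v D_vec)
next
  fix v assume "v \<in> {v \<in> carrier F2. D b v = \<zero>\<^bsub>F2\<^esub>}"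
  hence "v \<in> carrier F2" "D b v = \<zero>\<^bsub>F2\<^esub>" by auto
  then obtain v1 v2 where v: "v = vec v1 v2" by (auto elim: vec_elim)
  obtain u1 u2 where "v1 = xv X1 * u1 + scalar (alpha * b) * (xv X3 * u2)" "v2 = xv X4 * u1 + xv X2 * u2"
    using \<open>D b v = \<zero>\<^bsub>F2\<^esub>\<close> unfolding v D_vec vec_zero vec_inject matrix_kernel [OF assms] by blast
  hence "v = D (alpha * b) (vec u1 u2)" by (simp add: v D_vec)
  thus "v \<in> D (alpha * b) ` carrier F2" by simp
qed

text \<open>
  By exactness the image of \<open>D 1\<close> is isomorphic to the cokernel of \<open>D \<alpha>\<close>; as an image it is a
  submodule of \<open>A\<^sup>2\<close>.
\<close>

definition M :: "'a univ_module" where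
  "M = singleton_module F2 (D 1 ` carrier F2)"

lemma module_M: "module A M"
  unfolding M_def by (rule module_singleton_module [OF module_F2 submodule_image [OF module_F2 module_F2 D_hom]])

lemma M_resolution: "free_resolution A M (\<lambda>_. 2) (\<lambda>i. D (alpha ^ Suc i)) (\<lambda>v. {D 1 v})"
proof -
  have "(\<lambda>v. {D 1 v}) \<in> module_homs A F2 M"
    unfolding M_def by (rule singleton_module_image_hom [OF D_hom])
  moreover have "(\<lambda>v. {D 1 v}) ` carrier F2 = carrier M"
    by (auto simp: M_def singleton_module_simps)
  moreover have "D alpha ` carrier F2 = a_kernel F2 M (\<lambda>v. {D 1 v})"
    using D_kernel [of 1] by (simp add: a_kernel_def' M_def singleton_module_simps)
  moreover have "D (alpha * alpha ^ Suc i) ` carrier F2 = a_kernel F2 F2 (D (alpha ^ Suc i))" for i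
    using D_kernel [of "alpha ^ Suc i"] alpha_nonzero [where 'k = 'k] by (simp add: a_kernel_def')
  ultimately show ?thesis
    unfolding free_resolution_def Let_def using D_hom by simp
qed

text \<open>The ideal generated by \<open>test_elt c\<close>, placed in the first coordinate of \<open>A\<^sup>2\<close>.\<close>

definition N :: "'k fls \<Rightarrow> 'a univ_module" where
  "N c = singleton_module F2 (mat (test_elt c) 0 0 0 ` carrier F2)"

lemma module_N: "module A (N c)"
  unfolding N_def by (rule module_singleton_module [OF module_F2 submodule_image [OF module_F2 module_F2 mat_hom]])

abbreviation n_elt :: "'k fls \<Rightarrow> 'k fls alg \<Rightarrow> (nat \<Rightarrow> 'a) set" where
  "n_elt c p \<equiv> {vec (p * test_elt c) 0}"

lemma carrier_N: "carrier (N c) = range (n_elt c)"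
proof -
  have val: "{mat (test_elt c) 0 0 0 (vec p q)} = n_elt c p" for p q by (simp add: mult.commute)
  show ?thesis
    unfolding N_def singleton_module_simps image_image
  proof (intro equalityI subsetI)
    fix U assume "U \<in> (\<lambda>v. {mat (test_elt c) 0 0 0 v}) ` carrier F2"
    then obtain v where "v \<in> carrier F2" "U = {mat (test_elt c) 0 0 0 v}" by blast
    moreover from this obtain p q where "v = vec p q" by (auto elim: vec_elim)
    ultimately have "U = n_elt c p" by (simp only: val)
    thus "U \<in> range (n_elt c)" by (rule range_eqI)
  next
    fix U assume "U \<in> range (n_elt c)"
    then obtain p where "U = n_elt c p" by blast
    hence "U = {mat (test_elt c) 0 0 0 (vec p 0)}" by (simp only: val)
    thus "U \<in> (\<lambda>v. {mat (test_elt c) 0 0 0 v}) ` carrier F2" 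
      by (rule image_eqI [where x = "vec p 0"]) (rule vec_closed)
  qed
qed

lemma N_simps:
  "n_elt c p \<oplus>\<^bsub>N c\<^esub> n_elt c q = n_elt c (p + q)"
  "\<iota> a \<odot>\<^bsub>N c\<^esub> n_elt c p = n_elt c (a * p)"
  "\<zero>\<^bsub>N c\<^esub> = {vec 0 0}"
  by (simp_all add: N_def singleton_module_simps vec_plus vec_scale vec_zero distrib_right mult.assoc)

lemma hom_to_N:
  assumes f: "f \<in> module_homs A F2 (N c)"
  shows "\<exists>p q. \<forall>u v. f (vec u v) = n_elt c (u * p + v * q)"
proof -
  obtain p q where p: "f (vec 1 0) = n_elt c p" and q: "f (vec 0 1) = n_elt c q"
    using module_homs_closed [OF f vec_closed] unfolding carrier_N by (meson rangeE)
  have "f (vec u v) = n_elt c (u * p + v * q)" for u v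
  proof -
    have s: "\<iota> u \<odot>\<^bsub>F2\<^esub> vec 1 0 \<in> carrier F2" "\<iota> v \<odot>\<^bsub>F2\<^esub> vec 0 1 \<in> carrier F2"
      by (simp_all add: vec_scale)
    have "vec u v = \<iota> u \<odot>\<^bsub>F2\<^esub> vec 1 0 \<oplus>\<^bsub>F2\<^esub> \<iota> v \<odot>\<^bsub>F2\<^esub> vec 0 1" by (simp add: vec_scale vec_plus)
    hence "f (vec u v) = \<iota> u \<odot>\<^bsub>N c\<^esub> f (vec 1 0) \<oplus>\<^bsub>N c\<^esub> \<iota> v \<odot>\<^bsub>N c\<^esub> f (vec 0 1)"
      by (simp only: module_homs_add [OF f s] module_homs_smult [OF f closed vec_closed])
    thus ?thesis by (simp only: p q N_simps)
  qed
  thus ?thesis by blast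
qed

lemma hom_to_N_exists:
  "\<exists>f\<in>module_homs A F2 (N c). \<forall>u v. f (vec u v) = n_elt c (u * p + v * q)"
proof -
  define f where "f = (\<lambda>w :: nat \<Rightarrow> 'a. n_elt c (\<kappa> (w 0) * p + \<kappa> (w 1) * q))"
  have f: "f (vec u v) = n_elt c (u * p + v * q)" for u v by (simp add: f_def)
  have "f \<in> module_homs A F2 (N c)"
  proof (rule module_homsI)
    fix w assume "w \<in> carrier F2"
    thus "f w \<in> carrier (N c)" by (simp add: carrier_N f_def)
  next
    fix w z assume "w \<in> carrier F2" "z \<in> carrier F2"
    then obtain u v s t where "w = vec u v" "z = vec s t" by (metis vec_elim)
    thus "f (w \<oplus>\<^bsub>F2\<^esub> z) = f w \<oplus>\<^bsub>N c\<^esub> f z" by (simp only: f vec_plus N_simps) (simp add: algebra_simps)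
  next
    fix a w assume "a \<in> carrier A" "w \<in> carrier F2"
    then obtain d u v where "a = \<iota> d" "w = vec u v" by (metis elim vec_elim)
    thus "f (a \<odot>\<^bsub>F2\<^esub> w) = a \<odot>\<^bsub>N c\<^esub> f w" by (simp only: f vec_scale N_simps) (simp add: algebra_simps)
  qed
  thus ?thesis using f by blast
qed

text \<open>
  A homomorphism from \<open>A\<^sup>2\<close> to \<open>N c\<close> is given by its values \<open>p y\<close>, \<open>q y\<close> on the unit vectors,
  where \<open>y = test_elt c\<close>, and composing it with \<open>D b\<close> applies the transpose of the matrix to these values.  As the resolution
  starts with the parameter \<open>\<alpha>\<close>, the differentials next to position \<open>j + 1\<close> have the parameters
  \<open>\<alpha>\<^bsup>j + 1\<^esup>\<close> and \<open>\<alpha>\<^bsup>j + 2\<^esup>\<close>.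
\<close>

lemma is_zero_Ext_iff:
  "is_zero_module (Ext (Suc j) A M (N c)) \<longleftrightarrow>
    (\<forall>p q. xv X1 * (p * test_elt c) + xv X4 * (q * test_elt c) = 0 \<longrightarrow>
       scalar (alpha ^ (j + 2)) * (xv X3 * (p * test_elt c)) + xv X2 * (q * test_elt c) = 0 \<longrightarrow>
       (\<exists>p' q'. p * test_elt c = xv X1 * (p' * test_elt c) + xv X4 * (q' * test_elt c) \<and>
          q * test_elt c = scalar (alpha ^ (j + 1)) * (xv X3 * (p' * test_elt c)) + xv X2 * (q' * test_elt c)))"
proof -
  have iff: "is_zero_module (Ext (Suc j) A M (N c)) \<longleftrightarrow>
    (\<forall>f\<in>module_homs A F2 (N c). (\<forall>v\<in>carrier F2. f (D (alpha ^ (j + 2)) v) = \<zero>\<^bsub>N c\<^esub>) \<longrightarrow>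
       (\<exists>g\<in>module_homs A F2 (N c). \<forall>v\<in>carrier F2. f v = g (D (alpha ^ (j + 1)) v)))"
    using is_zero_Ext_Suc_iff [OF is_cring module_M module_N M_resolution, of j c] by simp
  have comp: "f (D b (vec u v)) = {vec (u * (xv X1 * (p * test_elt c) + xv X4 * (q * test_elt c)) +
      v * (scalar b * (xv X3 * (p * test_elt c)) + xv X2 * (q * test_elt c))) 0}"
    if "\<forall>u v. f (vec u v) = n_elt c (u * p + v * q)" for f b p q u v
    unfolding D_vec that [rule_format] by (simp add: algebra_simps)
  have zero_iff: "(\<forall>v\<in>carrier F2. f (D b v) = \<zero>\<^bsub>N c\<^esub>) \<longleftrightarrow>
      xv X1 * (p * test_elt c) + xv X4 * (q * test_elt c) = 0 \<and>
      scalar b * (xv X3 * (p * test_elt c)) + xv X2 * (q * test_elt c) = 0" (is "?l \<longleftrightarrow> ?r")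
    if f: "\<forall>u v. f (vec u v) = n_elt c (u * p + v * q)" for f b p q
  proof
    assume ?l
    hence "f (D b (vec 1 0)) = \<zero>\<^bsub>N c\<^esub>" "f (D b (vec 0 1)) = \<zero>\<^bsub>N c\<^esub>" by simp_all
    thus ?r unfolding comp [OF f] N_simps by simp
  next
    assume r: ?r
    show ?l
    proof
      fix w assume "w \<in> carrier F2"
      then obtain u v where w: "w = vec u v" by (rule vec_elim)
      show "f (D b w) = \<zero>\<^bsub>N c\<^esub>" unfolding w comp [OF f] N_simps using r by simp
    qed
  qed
  have eq_iff: "(\<forall>v\<in>carrier F2. f v = g (D b v)) \<longleftrightarrow>
      p * test_elt c = xv X1 * (p' * test_elt c) + xv X4 * (q' * test_elt c) \<and>
      q * test_elt c = scalar b * (xv X3 * (p' * test_elt c)) + xv X2 * (q' * test_elt c)" (is "?l \<longleftrightarrow> ?r")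
    if f: "\<forall>u v. f (vec u v) = n_elt c (u * p + v * q)"
      and g: "\<forall>u v. g (vec u v) = n_elt c (u * p' + v * q')" for f g b p q p' q'
  proof
    assume ?l
    hence "f (vec 1 0) = g (D b (vec 1 0))" "f (vec 0 1) = g (D b (vec 0 1))" by simp_all
    thus ?r unfolding comp [OF g] f [rule_format] by simp
  next
    assume r: ?r
    show ?l
    proof
      fix w assume "w \<in> carrier F2"
      then obtain u v where w: "w = vec u v" by (rule vec_elim)
      have "(u * p + v * q) * test_elt c = u * (p * test_elt c) + v * (q * test_elt c)"
        by (simp add: algebra_simps)
      thus "f w = g (D b w)" unfolding w comp [OF g] f [rule_format] using r by simp
    qed
  qed
  show ?thesis
    unfolding iff
  proof (intro iffI allI impI ballI)
    fix p q
    assume b: "\<forall>f\<in>module_homs A F2 (N c). (\<forall>v\<in>carrier F2. f (D (alpha ^ (j + 2)) v) = \<zero>\<^bsub>N c\<^esub>) \<longrightarrow>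
       (\<exists>g\<in>module_homs A F2 (N c). \<forall>v\<in>carrier F2. f v = g (D (alpha ^ (j + 1)) v))"
      and z: "xv X1 * (p * test_elt c) + xv X4 * (q * test_elt c) = 0"
        "scalar (alpha ^ (j + 2)) * (xv X3 * (p * test_elt c)) + xv X2 * (q * test_elt c) = 0"
    obtain f where f: "f \<in> module_homs A F2 (N c)" "\<forall>u v. f (vec u v) = n_elt c (u * p + v * q)"
      using hom_to_N_exists by metis
    have "\<forall>v\<in>carrier F2. f (D (alpha ^ (j + 2)) v) = \<zero>\<^bsub>N c\<^esub>"
      unfolding zero_iff [OF f(2)] using z by simp
    then obtain g where g: "g \<in> module_homs A F2 (N c)" "\<forall>v\<in>carrier F2. f v = g (D (alpha ^ (j + 1)) v)"
      using b f(1) by metis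
    obtain p' q' where g': "\<forall>u v. g (vec u v) = n_elt c (u * p' + v * q')" using hom_to_N [OF g(1)] by metis
    show "\<exists>p' q'. p * test_elt c = xv X1 * (p' * test_elt c) + xv X4 * (q' * test_elt c) \<and>
        q * test_elt c = scalar (alpha ^ (j + 1)) * (xv X3 * (p' * test_elt c)) + xv X2 * (q' * test_elt c)"
      using g(2) unfolding eq_iff [OF f(2) g'] by blast
  next
    fix f
    assume b: "\<forall>p q. xv X1 * (p * test_elt c) + xv X4 * (q * test_elt c) = 0 \<longrightarrow>
       scalar (alpha ^ (j + 2)) * (xv X3 * (p * test_elt c)) + xv X2 * (q * test_elt c) = 0 \<longrightarrow>
       (\<exists>p' q'. p * test_elt c = xv X1 * (p' * test_elt c) + xv X4 * (q' * test_elt c) \<and>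
          q * test_elt c = scalar (alpha ^ (j + 1)) * (xv X3 * (p' * test_elt c)) + xv X2 * (q' * test_elt c))"
      and f: "f \<in> module_homs A F2 (N c)"
      and z: "\<forall>v\<in>carrier F2. f (D (alpha ^ (j + 2)) v) = \<zero>\<^bsub>N c\<^esub>"
    obtain p q where f': "\<forall>u v. f (vec u v) = n_elt c (u * p + v * q)" using hom_to_N [OF f] by metis
    obtain p' q' where pq: "p * test_elt c = xv X1 * (p' * test_elt c) + xv X4 * (q' * test_elt c) \<and>
          q * test_elt c = scalar (alpha ^ (j + 1)) * (xv X3 * (p' * test_elt c)) + xv X2 * (q' * test_elt c)"
      using b z unfolding zero_iff [OF f'] by blast
    obtain g where g: "g \<in> module_homs A F2 (N c)" "\<forall>u v. g (vec u v) = n_elt c (u * p' + v * q')"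
      using hom_to_N_exists by metis
    have "\<forall>v\<in>carrier F2. f v = g (D (alpha ^ (j + 1)) v)"
      unfolding eq_iff [OF f' g(2)] by (rule pq)
    thus "\<exists>g\<in>module_homs A F2 (N c). \<forall>v\<in>carrier F2. f v = g (D (alpha ^ (j + 1)) v)"
      using g(1) by (rule bexI [where x = g])
  qed
qed

lemma Ext_vanishes:
  assumes "j > n"
  shows "is_zero_module (Ext (Suc j) A M (N (alpha ^ Suc n)))"
proof -
  have "alpha ^ (j + 2) \<noteq> (alpha ^ Suc n :: 'k fls)" "alpha ^ (j + 1) \<noteq> (alpha ^ Suc n :: 'k fls)"
    using assms unfolding alpha_power_inject by simp_all
  thus ?thesis unfolding is_zero_Ext_iff using test_elt_bounded by blast
qed

text \<open>
  The homomorphism with values \<open>(w, 0)\<close> is a cocycle because the variables annihilate the socle; it is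
  not a coboundary because the map into position \<open>n + 1\<close> has the parameter \<open>c\<close> of \<open>N\<close>, so that the
  values of a coboundary have the form \<open>(s w, c s w)\<close>.
\<close>

lemma Ext_nonzero: "\<not> is_zero_module (Ext (Suc n) A M (N (alpha ^ Suc n)))"
proof
  let ?c = "alpha ^ Suc n :: 'k fls"
  assume zero: "is_zero_module (Ext (Suc n) A M (N ?c))"
  have socle: "xv X1 * test_elt ?c = socle 1"
    using xv_mult_test_elt(1) [of 1 ?c] by (simp add: one_alg_def [symmetric]) (simp add: one_alg_def)
  have "xv X1 * (xv X1 * test_elt ?c) = 0" "scalar (alpha ^ (n + 2)) * (xv X3 * (xv X1 * test_elt ?c)) = 0"
    by (simp_all add: xv_mult_test_elt xv_sel socle_simps)
  hence "\<exists>p' q'. xv X1 * test_elt ?c = xv X1 * (p' * test_elt ?c) + xv X4 * (q' * test_elt ?c) \<and>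
      0 * test_elt ?c = scalar ?c * (xv X3 * (p' * test_elt ?c)) + xv X2 * (q' * test_elt ?c)"
    using zero unfolding is_zero_Ext_iff
    by (elim allE [where x = "xv X1"] allE [where x = 0]) simp
  then obtain p' q' where "socle 1 = xv X1 * (p' * test_elt ?c) + xv X4 * (q' * test_elt ?c)"
    "0 = scalar ?c * (xv X3 * (p' * test_elt ?c)) + xv X2 * (q' * test_elt ?c)"
    unfolding socle by auto
  thus False by (rule test_elt_unbounded) (simp add: alpha_nonzero)
qed

lemma ext_index_infinite: "ext_index A = \<infinity>"
proof -
  have fg: "fg_module A M" "fg_module A (N c)" for c
    unfolding M_def N_def
    by (rule fg_singleton_module_image [OF is_cring module_F2 D_hom]
          fg_singleton_module_image [OF is_cring module_F2 mat_hom])+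
  have le: "enat (Suc n) \<le> ext_index A" for n
    unfolding ext_index_def
  proof (rule Sup_upper, rule CollectI, intro exI conjI allI impI)
    show "fg_module A M" "fg_module A (N (alpha ^ Suc n))" by (rule fg)+
    show "\<not> is_zero_module (Ext (Suc n) A M (N (alpha ^ Suc n)))" by (rule Ext_nonzero)
    fix i assume "Suc n < i"
    then obtain j where "i = Suc j" "j > n" by (cases i) auto
    thus "is_zero_module (Ext i A M (N (alpha ^ Suc n)))" using Ext_vanishes by simp
  qed (rule refl)
  show ?thesis
  proof (cases "ext_index A")
    case (enat m)
    thus ?thesis using le [of m] by simp
  qed
qed

end

theorem theorem2p4:
  shows "\<not> AB_ring (localization_at_prime (ring_R :: 'k::field S fps set ring) prime_p)"
proof -
  obtain \<iota> :: "'k fls alg \<Rightarrow> _" where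
    "ring_copy (localization_at_prime (ring_R :: 'k S fps set ring) prime_p) \<iota>"
    using local_ring_copy by blast
  then interpret algebra_copy "localization_at_prime (ring_R :: 'k S fps set ring) prime_p" \<iota>
    by (rule algebra_copy.intro)
  show ?thesis by (simp add: AB_ring_def uniform_auslander_def ext_index_infinite)
qed

end
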